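(* Let $\alpha>0$, let $M_\alpha$ and $Q$ be independent real random variables, where $M_\alpha$ has density $\alpha x^{\alpha-1}\mathbb{1}_{(0,1)}(x)$, $\mathbb{E}[\log^+|Q|]<\infty$, and $b:=\sup\{x:\mathbb{P}\{Q\ge x\}>0\}\in(0,\infty)$. Let $Z_\alpha$ be the perpetuity generated by $(M_\alpha,Q)$, let $p_\alpha$ be the density of $Z_\alpha$ specified in the context, let $g(s):=\mathbb{E}[e^{sQ}]$ for $s\ge 0$ and, for all sufficiently large $t$, let $s_\alpha(t)$ be the unique positive solution $s$ of $\alpha\,(g(s)-1)/s=t$. Then, as $t\to\infty$, $$p_\alpha(t)\sim\frac{1}{\alpha(2\pi b)^{1/2}}\,t^{1/2}s_\alpha(t)\exp\Big(-ts_\alpha(t)+\alpha\int_0^{s_\alpha(t)}\frac{g(y)-1}{y}\,dy\Big)$$ and $$\mathbb{P}\{Z_\alpha>t\}\sim\frac{1}{\alpha(2\pi b)^{1/2}}\,t^{1/2}\exp\Big(-ts_\alpha(t)+\alpha\int_0^{s_\alpha(t)}\frac{g(y)-1}{y}\,dy\Big).$$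
   Context: Notation: $\log^+y=\log y$ for $y\ge1$ and $\log^+ y=0$ for $0\le y<1$; $r_1(t)\sim r_2(t)$ as $t\to\infty$ means $\lim_{t\to\infty}r_1(t)/r_2(t)=1$. Perpetuity: let $(M_{\alpha,k},Q_k)_{k\ge1}$ be independent copies of $(M_\alpha,Q)$ on a common probability space. Then $Z_\alpha:=Q_1+\sum_{k\ge1}M_{\alpha,1}\cdots M_{\alpha,k}Q_{k+1}$; under the stated assumptions the series converges almost surely. Densities: the distribution of $Z_\alpha-Q_1$ is absolutely continuous and has a density $q_\alpha$ which is continuous on $(0,\infty)$; $q_\alpha$ denotes such a density. Put $p_\alpha(t):=\int_{(-\infty,b]}q_\alpha(t-y)\,d\mathbb{P}\{Q\le y\}$ for $t\in\mathbb{R}$. Then $p_\alpha$ is a density, continuous on $(b,\infty)$, of the distribution of $Z_\alpha$. The function $s_\alpha$: the function $\psi_\alpha(s):=\log\mathbb{E}[e^{s(Z_\alpha-Q_1)}]=\alpha\int_0^s\frac{g(y)-1}{y}\,dy$ is finite for $s\ge0$ and strictly convex on $(0,\infty)$, and its derivative $\psi_\alpha'(s)=\alpha(g(s)-1)/s$ is continuous and strictly increasing on $(0,\infty)$ with $\psi_\alpha'(s)\to\infty$ as $s\to\infty$; hence for all large $t$ the equation $\psi_\alpha'(s)=t$ has a unique positive solution $s_\alpha(t)$. *)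

theory Defs
  imports "HOL-Probability.Probability" "HOL-Library.Landau_Symbols"
begin

definition log_plus :: "real \<Rightarrow> real" where
  "log_plus y = (if y \<ge> 1 then ln y else 0)"

text \<open>The sequences below are indexed by \<open>k \<ge> 1\<close>; their value at \<open>0\<close> is irrelevant.\<close>

definition independent_copies ::
  "'b measure \<Rightarrow> (nat \<Rightarrow> 'b \<Rightarrow> real) \<Rightarrow> (nat \<Rightarrow> 'b \<Rightarrow> real) \<Rightarrow>
   'a measure \<Rightarrow> ('a \<Rightarrow> real) \<Rightarrow> ('a \<Rightarrow> real) \<Rightarrow> bool" where
  "independent_copies P Ms Qs \<Omega> M Q \<longleftrightarrow>
     prob_space.indep_vars P (\<lambda>_. borel \<Otimes>\<^sub>M borel) (\<lambda>k \<omega>. (Ms k \<omega>, Qs k \<omega>)) {1..} \<and>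
     (\<forall>k\<ge>1. distr P (borel \<Otimes>\<^sub>M borel) (\<lambda>\<omega>. (Ms k \<omega>, Qs k \<omega>)) =
             distr \<Omega> (borel \<Otimes>\<^sub>M borel) (\<lambda>\<omega>. (M \<omega>, Q \<omega>)))"

text \<open>Since \<open>suminf\<close> starts at \<open>0\<close>, the summation index is shifted by one. Where the series diverges (a null event in the setting considered), \<open>suminf\<close> is an
  unspecified constant.\<close>

definition perpetuity ::
  "(nat \<Rightarrow> 'b \<Rightarrow> real) \<Rightarrow> (nat \<Rightarrow> 'b \<Rightarrow> real) \<Rightarrow> 'b \<Rightarrow> real" where
  "perpetuity Ms Qs \<omega> =
     Qs 1 \<omega> + (\<Sum>k. (\<Prod>j=1..Suc k. Ms j \<omega>) * Qs (Suc (Suc k)) \<omega>)"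

text \<open>Nonnegativity is required separately, since \<open>ennreal\<close> truncates negative values.\<close>

definition density_of :: "'b measure \<Rightarrow> ('b \<Rightarrow> real) \<Rightarrow> (real \<Rightarrow> real) \<Rightarrow> bool" where
  "density_of P X f \<longleftrightarrow> (\<forall>x. 0 \<le> f x) \<and> distributed P lborel X (\<lambda>x. ennreal (f x))"

definition p_fun ::
  "'a measure \<Rightarrow> ('a \<Rightarrow> real) \<Rightarrow> real \<Rightarrow> (real \<Rightarrow> real) \<Rightarrow> real \<Rightarrow> real" where
  "p_fun \<Omega> Q b q t = (LINT y:{..b}|distr \<Omega> borel Q. q (t - y))"

definition mgf :: "'a measure \<Rightarrow> ('a \<Rightarrow> real) \<Rightarrow> real \<Rightarrow> real" where
  "mgf \<Omega> Q s = (LINT \<omega>|\<Omega>. exp (s * Q \<omega>))"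

text \<open>In the setting considered the solution exists and is unique for all sufficiently
  large \<open>t\<close>; for other \<open>t\<close> the value is arbitrary.\<close>

definition saddle :: "real \<Rightarrow> (real \<Rightarrow> real) \<Rightarrow> real \<Rightarrow> real" where
  "saddle \<alpha> g t = (THE s. s > 0 \<and> \<alpha> * (g s - 1) / s = t)"

end

theory Submission
  imports Defs "HOL-Real_Asymp.Real_Asymp"
begin

text \<open>
  Put \<open>X = Z - Q\<^sub>1\<close>, which has the law of \<open>M Z\<close>. Integrating out \<open>M\<close> gives, on \<open>(0, \<infinity>)\<close>, the density
  \<open>q(x) = \<alpha> x\<^bsup>\<alpha> - 1\<^esup> E[Z\<^bsup>-\<alpha>\<^esup>; Z > x]\<close> of \<open>X\<close>. Hence \<open>x\<^bsup>1 - \<alpha>\<^esup> q(x)\<close> is decreasing and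
  \<open>P{Z > t} = P{X > t} + t q(t) / \<alpha>\<close>, so both claims reduce to the asymptotics of \<open>q\<close> near \<open>t\<close>, the term
  \<open>P{X > t}\<close> being negligible by Markov's inequality.

  The fixed-point equation for the law of \<open>X\<close> is a linear differential equation for \<open>E e\<^bsup>zX\<^esup>\<close> along
  rays in the right half-plane, which yields \<open>E e\<^bsup>zX\<^esup> = exp (\<alpha> \<integral>\<^sub>0\<^sup>1 (E e\<^bsup>rzQ\<^esup> - 1) / r dr)\<close>.
  Under the exponentially tilted law with parameter \<open>s = s(t)\<close>, \<open>X\<close> has mean \<open>t\<close> and variance
  asymptotic to \<open>b t\<close>, and its characteristic function converges, on the scale \<open>t\<^bsup>-1/2\<^esup>\<close>, to a Gaussian one.
  That characteristic function is not integrable in general, so Fourier inversion is applied after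
  adding an independent Gaussian variable of standard deviation of order \<open>1 / s\<close>. On this scale the
  tilted density is nearly constant from one side by the monotonicity above, which turns the smoothed
  local limit theorem into a pointwise one.
\<close>

section \<open>The density of the tail of the series\<close>

text \<open>Three obstacles shape the argument. \<open>Q\<close> is bounded above only, with a
  logarithmic moment below: transforms are taken in the right half-plane, and negative values of
  \<open>Q\<close> need separate estimates throughout. Away from the origin the tilted
  characteristic function is only known to be uniformly small, of order exp(-\<kappa> t / s^2),
  without decay; the smoothing factor supplies integrability at a cost polynomial in t, affordable
  because t grows at least exponentially in s. Finally, p(t) integrates q(t - y) against the law of
  \<open>Q\<close> over an unbounded range of y. This asks for an upper bound of the tilted density
  that is uniform on [t - b, \<infinity>), whereas the lower bound is used on a bounded window only.
  Since q(t - y) is close to e^(sy) q(t) for 0 \<le> y \<le> b, p(t) is close to g(s) q(t); with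
  g(s) asymptotic to t s / \<alpha> this is s times t q(t) / \<alpha>, which explains the factor s
  between the two claims.\<close>

definition power_density :: "real \<Rightarrow> real \<Rightarrow> real" where
  "power_density \<alpha> m = \<alpha> * m powr (\<alpha> - 1) * indicator {0<..<1} m"

lemma power_density_measurable [measurable]: "power_density \<alpha> \<in> borel_measurable borel"
  unfolding power_density_def by measurable

text \<open>Here \<open>F\<close>, \<open>\<mu>\<close> and \<open>\<zeta>\<close> are the laws of \<open>Q\<close>, \<open>Z - Q\<^sub>1\<close> and \<open>Z\<close>.\<close>

locale perpetuity_laws = F: prob_space F + \<mu>: prob_space \<mu> + \<zeta>: prob_space \<zeta>
  for F \<mu> \<zeta> :: "real measure" +
  fixes \<alpha> b :: real
  assumes \<alpha>_pos: "\<alpha> > 0" and b_pos: "b > 0"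
    and sets_F [measurable_cong]: "sets F = sets borel"
    and sets_\<mu> [measurable_cong]: "sets \<mu> = sets borel"
    and sets_\<zeta> [measurable_cong]: "sets \<zeta> = sets borel"
    and nn_integral_\<zeta>: "\<And>f. f \<in> borel_measurable borel \<Longrightarrow>
      (\<integral>\<^sup>+z. f z \<partial>\<zeta>) = (\<integral>\<^sup>+q. \<integral>\<^sup>+x. f (q + x) \<partial>\<mu> \<partial>F)"
    and nn_integral_\<mu>: "\<And>f. f \<in> borel_measurable borel \<Longrightarrow>
      (\<integral>\<^sup>+x. f x \<partial>\<mu>) = (\<integral>\<^sup>+z. \<integral>\<^sup>+m. ennreal (power_density \<alpha> m) * f (m * z) \<partial>lborel \<partial>\<zeta>)"
    and integrable_log_plus: "integrable F (\<lambda>q. log_plus \<bar>q\<bar>)"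
    and AE_le_b: "AE q in F. q \<le> b"
    and mass_near_b: "\<And>x. x < b \<Longrightarrow> measure F {x..} > 0"
begin

lemma space_F [simp]: "space F = UNIV" and space_\<mu> [simp]: "space \<mu> = UNIV"
  and space_\<zeta> [simp]: "space \<zeta> = UNIV"
  using sets_F sets_\<mu> sets_\<zeta> by (auto dest: sets_eq_imp_space_eq)

definition q0 :: "real \<Rightarrow> real" where
  "q0 x = \<alpha> * x powr (\<alpha> - 1) * (\<integral>z. indicator {x<..} z * z powr (-\<alpha>) \<partial>\<zeta>)"

lemma integrable_truncated_power:
  assumes "x > 0" shows "integrable \<zeta> (\<lambda>z. indicator {x<..} z * z powr (-\<alpha>))"
proof (rule \<zeta>.integrable_const_bound[where B="x powr (-\<alpha>)"])
  show "AE z in \<zeta>. norm (indicator {x<..} z * z powr (-\<alpha>)) \<le> x powr (-\<alpha>)"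
    using assms \<alpha>_pos by (auto simp: indicator_def intro!: powr_mono2')
qed simp

lemma q0_nonneg: "q0 x \<ge> 0"
  unfolding q0_def using \<alpha>_pos
  by (intro mult_nonneg_nonneg integral_nonneg_AE) auto

text \<open>The power cancels the prefactor of \<open>q0\<close> and leaves the integral of a
  nonnegative function over the shrinking set \<open>{x<..}\<close>. This one-sided regularity takes
  the place of continuity, both in the local limit theorem and when a continuous density is
  identified with \<open>q0\<close>.\<close>

lemma q0_antimono:
  assumes "0 < x" "x \<le> y" shows "y powr (1 - \<alpha>) * q0 y \<le> x powr (1 - \<alpha>) * q0 x"
proof -
  have *: "w powr (1 - \<alpha>) * q0 w = \<alpha> * (\<integral>z. indicator {w<..} z * z powr (-\<alpha>) \<partial>\<zeta>)" if "w > 0" for w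
  proof -
    have "w powr (1 - \<alpha>) * w powr (\<alpha> - 1) = 1"
      using that by (simp add: powr_add[symmetric])
    then have eq: "w powr (1 - \<alpha>) * (\<alpha> * w powr (\<alpha> - 1) * I) = \<alpha> * I" for I
      by (metis mult.assoc mult.commute mult_1)
    show ?thesis
      unfolding q0_def using eq by simp
  qed
  have "(\<integral>z. indicator {y<..} z * z powr (-\<alpha>) \<partial>\<zeta>) \<le> (\<integral>z. indicator {x<..} z * z powr (-\<alpha>) \<partial>\<zeta>)"
    using assms by (intro integral_mono integrable_truncated_power) (auto simp: indicator_def)
  then show ?thesis using assms \<alpha>_pos by (simp add: *)
qed

lemma q0_nn_integral:
  assumes "x > 0"
  shows "ennreal (q0 x) = (\<integral>\<^sup>+z. ennreal (\<alpha> * x powr (\<alpha> - 1) * indicator {x<..} z * z powr (-\<alpha>)) \<partial>\<zeta>)"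
  unfolding q0_def using \<alpha>_pos integrable_truncated_power[OF assms]
  by (subst nn_integral_eq_integral) (auto simp: mult.assoc)

lemma q0_measurable [measurable]: "(\<lambda>x. ennreal (q0 x * indicator {0<..} x)) \<in> borel_measurable borel"
proof -
  have "(\<lambda>x. ennreal (q0 x * indicator {0<..} x)) =
      (\<lambda>x. (\<integral>\<^sup>+z. ennreal (\<alpha> * x powr (\<alpha> - 1) * indicator {x<..} z * z powr (-\<alpha>)) \<partial>\<zeta>) * indicator {0<..} x)"
    by (auto simp: indicator_def q0_nn_integral)
  also have "\<dots> \<in> borel_measurable borel"
  proof -
    have [measurable]: "(\<lambda>w::real \<times> real. indicator {fst w<..} (snd w) :: real) \<in> borel_measurable (borel
        \<Otimes>\<^sub>M \<zeta>)"
    proof -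
      have "(\<lambda>w::real \<times> real. indicator {fst w<..} (snd w) :: real) = (\<lambda>w. if fst w < snd w then 1 else 0)"
        by (auto simp: indicator_def)
      then show ?thesis by simp
    qed
    show ?thesis
      by (intro borel_measurable_times_ennreal \<zeta>.borel_measurable_nn_integral)
        (simp_all add: split_beta')
  qed
  finally show ?thesis .
qed

text \<open>Substitution \<open>x = m * z\<close>: the support \<open>(0, 1)\<close> of
  \<open>m\<close> becomes \<open>(0, z)\<close>, written as a condition on \<open>z\<close> for
  fixed \<open>x\<close> in preparation for exchanging the integrals.\<close>

lemma nn_integral_scaled_power:
  assumes [measurable]: "f \<in> borel_measurable borel" and "z > 0"
  shows "(\<integral>\<^sup>+m. ennreal (power_density \<alpha> m) * f (m * z) \<partial>lborel)
    = (\<integral>\<^sup>+x. ennreal (indicator {0<..} x * \<alpha> * x powr (\<alpha> - 1) * indicator {x<..} z * z powr (-\<alpha>)) * f x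
        \<partial>lborel)"
proof -
  have "(\<integral>\<^sup>+x. ennreal (indicator {0<..} x * \<alpha> * x powr (\<alpha> - 1) * indicator {x<..} z * z powr (-\<alpha>)) * f x
      \<partial>lborel)
    = (\<integral>\<^sup>+x. ennreal (indicator {0<..<z} x * \<alpha> * x powr (\<alpha> - 1) * z powr (-\<alpha>)) * f x \<partial>lborel)"
    by (intro nn_integral_cong) (auto simp: indicator_def)
  also have "\<dots> = ennreal \<bar>z\<bar> * (\<integral>\<^sup>+m. ennreal (indicator {0<..<z} (0 + z * m) * \<alpha> * (0 + z * m) powr (\<alpha> - 1)
      * z powr (-\<alpha>)) * f (0 + z * m) \<partial>lborel)"
    using assms by (intro nn_integral_real_affine) auto
  also have "\<dots> = (\<integral>\<^sup>+m. ennreal (power_density \<alpha> m) * f (m * z) \<partial>lborel)"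
  proof (subst nn_integral_cmult[symmetric], simp, rule nn_integral_cong, unfold mult.assoc[symmetric])
    fix m :: real
    have "ennreal \<bar>z\<bar> * ennreal (indicator {0<..<z} (0 + z * m) * \<alpha> * (0 + z * m) powr (\<alpha> - 1) * z powr
        (-\<alpha>))
      = ennreal (power_density \<alpha> m)"
    proof (cases "0 < m \<and> m < 1")
      case True
      have "z * (z powr (\<alpha> - 1) * z powr (-\<alpha>)) = 1"
        using \<open>z > 0\<close> by (simp add: powr_diff powr_minus field_simps)
      then have "z * (\<alpha> * (z * m) powr (\<alpha> - 1) * z powr (-\<alpha>)) = \<alpha> * m powr (\<alpha> - 1)"
        using True \<open>z > 0\<close> by (simp add: powr_mult)
      then show ?thesis using True \<open>z > 0\<close> \<alpha>_pos
        by (simp add: power_density_def ennreal_mult'[symmetric])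
    next
      case False
      then show ?thesis using \<open>z > 0\<close>
        by (auto simp: power_density_def indicator_def zero_less_mult_iff)
    qed
    then show "ennreal \<bar>z\<bar> * ennreal (indicator {0<..<z} (0 + z * m) * \<alpha> * (0 + z * m) powr (\<alpha> - 1) * z powr
        (-\<alpha>)) * f (0 + z * m) =
       ennreal (power_density \<alpha> m) * f (m * z)" by (simp add: mult.commute)
  qed
  finally show ?thesis by simp
qed

text \<open>As \<open>m > 0\<close>, a product \<open>m * z\<close> is positive only for
  \<open>z > 0\<close>; there the substitution applies, and Tonelli's theorem gathers the integral
  over \<open>\<zeta>\<close> into \<open>q0\<close>.\<close>

lemma nn_integral_\<mu>_pos:
  assumes [measurable]: "f \<in> borel_measurable borel"
  shows "(\<integral>\<^sup>+x. indicator {0<..} x * f x \<partial>\<mu>) = (\<integral>\<^sup>+x. ennreal (q0 x * indicator {0<..} x) * f x \<partial>lborel)"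
proof -
  interpret pair_sigma_finite \<zeta> lborel ..
  have [measurable]: "(\<lambda>w::real \<times> real. indicator {snd w<..} (fst w) :: real) \<in> borel_measurable (\<zeta> \<Otimes>\<^sub>M
      borel)"
  proof -
    have "(\<lambda>w::real \<times> real. indicator {snd w<..} (fst w) :: real) = (\<lambda>w. if snd w < fst w then 1 else 0)"
      by (auto simp: indicator_def)
    then show ?thesis by simp
  qed
  have "(\<integral>\<^sup>+x. indicator {0<..} x * f x \<partial>\<mu>) =
      (\<integral>\<^sup>+z. \<integral>\<^sup>+m. ennreal (power_density \<alpha> m) * (indicator {0<..} (m * z) * f (m * z)) \<partial>lborel \<partial>\<zeta>)"
    by (subst nn_integral_\<mu>) auto
  also have "\<dots> = (\<integral>\<^sup>+z. \<integral>\<^sup>+x. ennreal (indicator {0<..} x * \<alpha> * x powr (\<alpha> - 1) * indicator {x<..} z * z powr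
      (-\<alpha>)) * f x \<partial>lborel \<partial>\<zeta>)"
  proof (rule nn_integral_cong)
    fix z :: real
    show "(\<integral>\<^sup>+m. ennreal (power_density \<alpha> m) * (indicator {0<..} (m * z) * f (m * z)) \<partial>lborel)
      = (\<integral>\<^sup>+x. ennreal (indicator {0<..} x * \<alpha> * x powr (\<alpha> - 1) * indicator {x<..} z * z powr (-\<alpha>)) * f x
          \<partial>lborel)"
    proof (cases "z > 0")
      case True
      then show ?thesis by (subst nn_integral_scaled_power[symmetric])
        (auto intro!: nn_integral_cong simp: power_density_def indicator_def)
    next
      case False
      then have "(\<integral>\<^sup>+m. ennreal (power_density \<alpha> m) * (indicator {0<..} (m * z) * f (m * z)) \<partial>lborel)
          = (\<integral>\<^sup>+m. 0 \<partial>(lborel::real measure))"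
        by (intro nn_integral_cong) (auto simp: power_density_def indicator_def zero_less_mult_iff)
      moreover have "(\<integral>\<^sup>+x. ennreal (indicator {0<..} x * \<alpha> * x powr (\<alpha> - 1) * indicator {x<..} z * z powr
          (-\<alpha>)) * f x \<partial>lborel) = (\<integral>\<^sup>+x. 0 \<partial>(lborel::real measure))"
        using False by (intro nn_integral_cong) (auto simp: indicator_def)
      ultimately show ?thesis by simp
    qed
  qed
  also have "\<dots> = (\<integral>\<^sup>+x. \<integral>\<^sup>+z. ennreal (indicator {0<..} x * \<alpha> * x powr (\<alpha> - 1) * indicator {x<..} z * z powr
      (-\<alpha>)) * f x \<partial>\<zeta> \<partial>lborel)"
    by (subst Fubini') (simp_all add: split_beta')
  also have "\<dots> = (\<integral>\<^sup>+x. ennreal (q0 x * indicator {0<..} x) * f x \<partial>lborel)"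
  proof (rule nn_integral_cong)
    fix x :: real
    show "(\<integral>\<^sup>+z. ennreal (indicator {0<..} x * \<alpha> * x powr (\<alpha> - 1) * indicator {x<..} z * z powr (-\<alpha>)) * f x
        \<partial>\<zeta>)
       = ennreal (q0 x * indicator {0<..} x) * f x"
      by (subst nn_integral_multc) (auto simp: q0_nn_integral indicator_def)
  qed
  finally show ?thesis .
qed

text \<open>For \<open>z > t\<close> the event M z > t has probability
  \<open>1 - (t / z) powr \<alpha>\<close>. Averaging over \<open>\<zeta>\<close> gives P{X > t} =
  P{Z > t} - t^\<alpha> E[Z^(-\<alpha>); Z > t], and the subtracted term is
  \<open>t * q0 t / \<alpha>\<close>.\<close>

lemma tail_\<zeta>:
  assumes "t > 0"
  shows "measure \<zeta> {t<..} = measure \<mu> {t<..} + t * q0 t / \<alpha>"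
proof -
  have 1: "(\<integral>\<^sup>+m. ennreal (power_density \<alpha> m) * indicator {t<..} (m * z) \<partial>lborel)
      = ennreal (indicator {t<..} z * (1 - t powr \<alpha> * z powr (-\<alpha>)))" for z
  proof (cases "z > t")
    case True
    have "(\<integral>\<^sup>+m. ennreal (power_density \<alpha> m) * indicator {t<..} (m * z) \<partial>lborel)
       = (\<integral>\<^sup>+m. ennreal (\<alpha> * m powr (\<alpha> - 1)) * indicator {t/z..1} m \<partial>lborel)"
    proof (rule nn_integral_cong_AE, rule AE_mp)
      show "AE m in lborel. m \<noteq> t / z \<and> m \<noteq> 1" using AE_lborel_singleton by (auto intro: AE_conjI)
      show "AE m in lborel. m \<noteq> t / z \<and> m \<noteq> 1 \<longrightarrow> ennreal (power_density \<alpha> m) * indicator {t<..} (m * z)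
          = ennreal (\<alpha> * m powr (\<alpha> - 1)) * indicator {t/z..1} m"
      proof (intro AE_I2 impI)
        fix m assume m: "m \<noteq> t / z \<and> m \<noteq> 1"
        have "t / z > 0" "z > 0" using assms True by auto
        moreover have "t < m * z \<longleftrightarrow> t / z < m" using \<open>z > 0\<close> by (simp add: field_simps)
        ultimately show "ennreal (power_density \<alpha> m) * indicator {t<..} (m * z)
            = ennreal (\<alpha> * m powr (\<alpha> - 1)) * indicator {t/z..1} m"
          using m by (auto simp: power_density_def indicator_def)
      qed
    qed
    also have "\<dots> = ennreal (1 powr \<alpha> - (t/z) powr \<alpha>)"
    proof (intro nn_integral_FTC_Icc)
      fix m assume "m \<in> {t/z..1}"
      moreover have "t / z > 0" using assms True by simp
      ultimately have "m > 0" by auto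
      then show "((\<lambda>m. m powr \<alpha>) has_real_derivative \<alpha> * m powr (\<alpha> - 1)) (at m)"
        "0 \<le> \<alpha> * m powr (\<alpha> - 1)"
        using \<alpha>_pos by (auto intro!: derivative_eq_intros)
    qed (use assms True in auto)
    also have "\<dots> = ennreal (indicator {t<..} z * (1 - t powr \<alpha> * z powr (-\<alpha>)))"
      using assms True by (simp add: powr_divide powr_minus_divide)
    finally show ?thesis .
  next
    case False
    then have "(\<integral>\<^sup>+m. ennreal (power_density \<alpha> m) * indicator {t<..} (m * z) \<partial>lborel)
        = (\<integral>\<^sup>+m. 0 \<partial>(lborel::real measure))"
    proof (intro nn_integral_cong)
      fix m :: real
      have "m * z \<le> t" if "0 < m" "m < 1"
      proof (cases "z \<ge> 0")
        case True
        then have "m * z \<le> 1 * z" using that by (intro mult_right_mono) auto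
        then show ?thesis using False by simp
      next
        case False
        then have "m * z \<le> 0" using that by (simp add: mult_le_0_iff)
        then show ?thesis using assms by simp
      qed
      then show "ennreal (power_density \<alpha> m) * indicator {t<..} (m * z) = 0"
        by (auto simp: power_density_def indicator_def)
    qed
    then show ?thesis using False by simp
  qed
  have "emeasure \<mu> {t<..} = (\<integral>\<^sup>+x. indicator {t<..} x \<partial>\<mu>)" by (simp add: sets_\<mu>)
  also have "\<dots> = (\<integral>\<^sup>+z. ennreal (indicator {t<..} z * (1 - t powr \<alpha> * z powr (-\<alpha>))) \<partial>\<zeta>)"
    by (subst nn_integral_\<mu>) (auto simp: 1)
  finally have "emeasure \<mu> {t<..} = \<dots>" .
  moreover have "integrable \<zeta> (\<lambda>z. indicator {t<..} z - t powr \<alpha> * (indicator {t<..} z * z powr (-\<alpha>)) ::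
      real)"
    by (intro Bochner_Integration.integrable_diff integrable_mult_right integrable_truncated_power assms)
      (auto intro!: \<zeta>.integrable_const_bound[where B=1])
  moreover have "indicator {t<..} z * (1 - t powr \<alpha> * z powr (-\<alpha>))
      = indicator {t<..} z - t powr \<alpha> * (indicator {t<..} z * z powr (-\<alpha>))" for z :: real
    by (simp add: algebra_simps)
  moreover have "indicator {t<..} z * (1 - t powr \<alpha> * z powr (-\<alpha>)) \<ge> 0" for z
  proof (cases "z > t")
    case True
    have "t powr \<alpha> * z powr (-\<alpha>) \<le> z powr \<alpha> * z powr (-\<alpha>)"
      using True assms \<alpha>_pos by (intro mult_right_mono powr_mono2) auto
    also have "\<dots> = 1" using True assms by (simp add: powr_add[symmetric])
    finally show ?thesis by simp
  qed simp
  ultimately have "emeasure \<mu> {t<..} = ennreal (\<integral>z. indicator {t<..} z - t powr \<alpha> * (indicator {t<..} z * z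
      powr (-\<alpha>)) \<partial>\<zeta>)"
    and nn: "(\<integral>z. indicator {t<..} z - t powr \<alpha> * (indicator {t<..} z * z powr (-\<alpha>)) \<partial>\<zeta>) \<ge> 0"
    by (auto intro!: nn_integral_eq_integral integral_nonneg_AE)
  then have "measure \<mu> {t<..} = (\<integral>z. indicator {t<..} z - t powr \<alpha> * (indicator {t<..} z * z powr (-\<alpha>)) \<partial>\<zeta>)"
    by (simp add: measure_def)
  also have "\<dots> = measure \<zeta> {t<..} - t powr \<alpha> * (\<integral>z. indicator {t<..} z * z powr (-\<alpha>) \<partial>\<zeta>)"
    using assms by (subst Bochner_Integration.integral_diff)
      (auto intro!: integrable_mult_right integrable_truncated_power \<zeta>.integrable_const_bound[where B=1])
  also have "t powr \<alpha> * (\<integral>z. indicator {t<..} z * z powr (-\<alpha>) \<partial>\<zeta>) = t * q0 t / \<alpha>"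
    using assms \<alpha>_pos unfolding q0_def by (simp add: powr_diff field_simps)
  finally show ?thesis by simp
qed

end

section \<open>Exponential moments\<close>

context perpetuity_laws begin

lemma \<zeta>_tail_le: "measure \<zeta> {u<..} \<le> measure \<mu> {u - b<..}"
proof -
  have "emeasure \<zeta> {u<..} = (\<integral>\<^sup>+z. indicator {u<..} z \<partial>\<zeta>)" by (simp add: sets_\<zeta>)
  also have "\<dots> = (\<integral>\<^sup>+q. \<integral>\<^sup>+x. indicator {u<..} (q + x) \<partial>\<mu> \<partial>F)"
    by (subst nn_integral_\<zeta>) auto
  also have "\<dots> \<le> (\<integral>\<^sup>+q. emeasure \<mu> {u - b<..} \<partial>F)"
  proof (rule nn_integral_mono_AE, use AE_le_b in eventually_elim)
    fix q assume "q \<le> b"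
    then have "(\<integral>\<^sup>+x. indicator {u<..} (q + x) \<partial>\<mu>) \<le> (\<integral>\<^sup>+x. indicator {u - b<..} x \<partial>\<mu>)"
      by (intro nn_integral_mono) (auto simp: indicator_def)
    then show "(\<integral>\<^sup>+x. indicator {u<..} (q + x) \<partial>\<mu>) \<le> emeasure \<mu> {u - b<..}"
      by (simp add: sets_\<mu>)
  qed
  also have "\<dots> = emeasure \<mu> {u - b<..}" by (simp add: F.emeasure_space_1[simplified])
  finally show ?thesis
    by (simp add: \<mu>.emeasure_eq_measure \<zeta>.emeasure_eq_measure)
qed

text \<open>By \<open>tail_\<zeta>\<close>, \<open>u * q0 u / \<alpha>\<close> equals P{Z > u} - P{X
  > u}, and Z exceeds X by at most b. The density is thus controlled by the mass of X in a window of
  length b behind \<open>u\<close>, a delay inequality from which all exponential moments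
  follow.\<close>

lemma q0_le:
  assumes "u > 0"
  shows "ennreal (u * q0 u) \<le> ennreal \<alpha> * (\<integral>\<^sup>+x. indicator {u - b<..u} x \<partial>\<mu>)"
proof -
  have "u * q0 u = \<alpha> * (measure \<zeta> {u<..} - measure \<mu> {u<..})"
    using tail_\<zeta>[OF assms] \<alpha>_pos by (simp add: field_simps)
  also have "\<dots> \<le> \<alpha> * (measure \<mu> {u - b<..} - measure \<mu> {u<..})"
    using \<zeta>_tail_le[of u] \<alpha>_pos by (intro mult_left_mono) auto
  also have "measure \<mu> {u - b<..} - measure \<mu> {u<..} = measure \<mu> ({u - b<..} - {u<..})"
    using b_pos by (intro \<mu>.finite_measure_Diff[symmetric]) (auto simp: sets_\<mu>)
  also have "{u - b<..} - {u<..} = {u-b<..u}" by auto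
  finally have "ennreal (u * q0 u) \<le> ennreal (\<alpha> * measure \<mu> {u-b<..u})" by (rule ennreal_leI)
  also have "\<dots> = ennreal \<alpha> * (\<integral>\<^sup>+x. indicator {u - b<..u} x \<partial>\<mu>)"
    using \<alpha>_pos by (simp add: ennreal_mult' \<mu>.emeasure_eq_measure sets_\<mu>)
  finally show ?thesis .
qed

text \<open>Multiply \<open>u q0(u) \<le> \<alpha> P{u - b < X \<le> u}\<close> by \<open>e\<^bsup>su\<^esup>\<close>
    and integrate over \<open>(T0, T]\<close>: the choice of \<open>T0\<close> lets the right-hand side be absorbed.\<close>

lemma exp_moment_bounded:
  assumes "s \<ge> 0" and T0: "T0 = 2 * \<alpha> * b * exp (s * b)" and T: "T \<ge> T0"
  shows "(\<integral>\<^sup>+x. ennreal (exp (s * x)) * indicator {..T} x \<partial>\<mu>) \<le> ennreal (2 * exp (s * T0))"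
proof -
  interpret pair_sigma_finite \<mu> lborel ..
  define c where "c = \<alpha> * b * exp (s * b)"
  have c: "c > 0" "T0 = 2 * c" unfolding c_def T0 using \<alpha>_pos b_pos by auto
  define I where "I = (\<integral>\<^sup>+x. ennreal (exp (s * x)) * indicator {T0<..T} x \<partial>\<mu>)"
  define J where "J = (\<integral>\<^sup>+x. ennreal (exp (s * x)) * indicator {..T} x \<partial>\<mu>)"
  \<comment> \<open>Absorption works only for a finite quantity; the truncation at \<open>T\<close>
    provides it.\<close>
  have "I \<le> (\<integral>\<^sup>+x. ennreal (exp (s * T)) \<partial>\<mu>)" unfolding I_def
    using \<open>s \<ge> 0\<close> by (intro nn_integral_mono) (auto simp: indicator_def mult_left_mono)
  then have I_fin: "I < \<top>" by (simp add: \<mu>.emeasure_space_1[simplified] order_le_less_trans)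
  have "ennreal T0 * I = (\<integral>\<^sup>+x. ennreal T0 * (ennreal (exp (s * x)) * indicator {T0<..T} x) \<partial>\<mu>)"
    unfolding I_def by (rule nn_integral_cmult[symmetric]) simp
  also have "\<dots> \<le> (\<integral>\<^sup>+x. indicator {0<..} x * (ennreal x * (ennreal (exp (s * x)) * indicator {T0<..T} x))
      \<partial>\<mu>)"
    using c by (intro nn_integral_mono) (auto simp: indicator_def intro!: mult_right_mono ennreal_leI)
  also have "\<dots> = (\<integral>\<^sup>+x. ennreal (q0 x * indicator {0<..} x) * (ennreal x * (ennreal (exp (s * x)) *
      indicator {T0<..T} x)) \<partial>lborel)"
    by (rule nn_integral_\<mu>_pos) simp
  also have "\<dots> \<le> (\<integral>\<^sup>+u. \<integral>\<^sup>+x. ennreal (exp (s * u) * \<alpha> * indicator {T0<..T} u * (if u - b < x \<and> x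
      \<le> u then 1 else 0)) \<partial>\<mu> \<partial>lborel)"
  proof (rule nn_integral_mono)
    fix u :: real
    show "ennreal (q0 u * indicator {0<..} u) * (ennreal u * (ennreal (exp (s * u)) * indicator {T0<..T} u))
      \<le> (\<integral>\<^sup>+x. ennreal (exp (s * u) * \<alpha> * indicator {T0<..T} u * (if u - b < x \<and> x \<le> u then 1 else 0)) \<partial>\<mu>)"
    proof (cases "u \<in> {T0<..T}")
      case True
      then have "u > 0" using c by auto
      have "ennreal (q0 u * indicator {0<..} u) * (ennreal u * (ennreal (exp (s * u)) * indicator {T0<..T}
          u))
        = ennreal (exp (s * u)) * ennreal (u * q0 u)"
        using True \<open>u > 0\<close> q0_nonneg[of u] by (simp add: ennreal_mult'[symmetric] mult_ac)
      also have "\<dots> \<le> ennreal (exp (s * u)) * (ennreal \<alpha> * (\<integral>\<^sup>+x. indicator {u - b<..u} x \<partial>\<mu>))"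
        by (intro mult_left_mono q0_le \<open>u > 0\<close>) auto
      also have "\<dots> = (\<integral>\<^sup>+x. ennreal (exp (s * u) * \<alpha>) * indicator {u - b<..u} x \<partial>\<mu>)"
        using \<alpha>_pos by (subst nn_integral_cmult) (auto simp: ennreal_mult' mult_ac)
      also have "\<dots> = (\<integral>\<^sup>+x. ennreal (exp (s * u) * \<alpha> * indicator {T0<..T} u * (if u - b < x \<and> x
          \<le> u then 1 else 0)) \<partial>\<mu>)"
        using True by (intro nn_integral_cong) (auto simp: indicator_def)
      finally show ?thesis .
    qed simp
  qed
  also have "\<dots> = (\<integral>\<^sup>+x. \<integral>\<^sup>+u. ennreal (exp (s * u) * \<alpha> * indicator {T0<..T} u * (if u - b < x \<and> x
      \<le> u then 1 else 0)) \<partial>lborel \<partial>\<mu>)"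
    by (rule Fubini') (simp add: split_beta')
  also have "\<dots> \<le> (\<integral>\<^sup>+x. ennreal c * (ennreal (exp (s * x)) * indicator {..T} x) \<partial>\<mu>)"
  proof (rule nn_integral_mono)
    fix x :: real
    \<comment> \<open>For fixed \<open>x\<close> only \<open>u\<close> in \<open>[x, x + b)\<close>
      counts: the length \<open>b\<close> and \<open>exp (s * u) \<le> exp (s * (x + b))\<close>
      produce the constant \<open>c\<close>.\<close>
    have "(\<integral>\<^sup>+u. ennreal (exp (s * u) * \<alpha> * indicator {T0<..T} u * (if u - b < x \<and> x
        \<le> u then 1 else 0)) \<partial>lborel)
      \<le> (\<integral>\<^sup>+u. ennreal (exp (s * (x + b)) * \<alpha> * indicator {..T} x) * indicator {x..x+b} u \<partial>lborel)"
      using \<open>s \<ge> 0\<close> \<alpha>_pos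
      by (intro nn_integral_mono) (auto simp: indicator_def intro!: ennreal_leI mult_left_mono)
    also have "\<dots> = ennreal (exp (s * (x + b)) * \<alpha> * indicator {..T} x) * ennreal b"
      using b_pos by (subst nn_integral_cmult) auto
    also have "\<dots> = ennreal c * (ennreal (exp (s * x)) * indicator {..T} x)"
      using \<alpha>_pos b_pos c unfolding c_def
      by (auto simp: indicator_def ennreal_mult'[symmetric] exp_add[symmetric] algebra_simps)
    finally show "(\<integral>\<^sup>+u. ennreal (exp (s * u) * \<alpha> * indicator {T0<..T} u * (if u - b < x \<and> x
        \<le> u then 1 else 0)) \<partial>lborel)
      \<le> ennreal c * (ennreal (exp (s * x)) * indicator {..T} x)" .
  qed
  also have "\<dots> = ennreal c * J" unfolding J_def by (rule nn_integral_cmult) simp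
  finally have 1: "ennreal T0 * I \<le> ennreal c * J" .
  have "J \<le> (\<integral>\<^sup>+x. ennreal (exp (s * T0)) + ennreal (exp (s * x)) * indicator {T0<..T} x \<partial>\<mu>)"
    unfolding J_def using \<open>s \<ge> 0\<close>
    by (intro nn_integral_mono) (auto simp: indicator_def intro!: mult_left_mono)
  also have "\<dots> = ennreal (exp (s * T0)) + I"
    unfolding I_def by (subst nn_integral_add) (auto simp: \<mu>.emeasure_space_1[simplified])
  finally have 2: "J \<le> ennreal (exp (s * T0)) + I" .
  obtain i where i: "I = ennreal i" "i \<ge> 0" using I_fin by (cases I) auto
  have J_fin: "J < \<top>" using 2 I_fin by (simp add: order_le_less_trans)
  obtain j where j: "J = ennreal j" "j \<ge> 0" using J_fin by (cases J) auto
  \<comment> \<open>\<open>T0 = 2 * c\<close> makes \<open>I\<close> at most half of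
    \<open>J\<close>, so that it can be absorbed in \<open>J \<le> exp (s * T0) + I\<close>.\<close>
  have "2 * c * i \<le> c * j" using 1 i j c by (simp add: ennreal_mult'[symmetric])
  then have "2 * i \<le> j" using c by simp
  moreover have "j \<le> exp (s * T0) + i" using 2 i j by (simp add: ennreal_plus[symmetric] del: ennreal_plus)
  ultimately have "j \<le> 2 * exp (s * T0)" by simp
  then show ?thesis using j unfolding J_def by (simp add: ennreal_leI)
qed

text \<open>The bound on the truncated moments does not depend on \<open>T\<close>, so monotone
  convergence removes the truncation.\<close>

lemma exp_moment_\<mu>:
  assumes "s \<ge> 0" shows "integrable \<mu> (\<lambda>x. exp (s * x))"
proof -
  define T0 where "T0 = 2 * \<alpha> * b * exp (s * b)"
  let ?f = "\<lambda>n x. ennreal (exp (s * x)) * indicator {..T0 + real n} x"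
  have "(\<integral>\<^sup>+x. ennreal (exp (s * x)) \<partial>\<mu>) = (\<integral>\<^sup>+x. (SUP n. ?f n x) \<partial>\<mu>)"
  proof (rule nn_integral_cong)
    fix x :: real
    obtain n where n: "x - T0 \<le> real n" using real_arch_simple by blast
    show "ennreal (exp (s * x)) = (SUP n. ?f n x)"
    proof (rule antisym)
      have "ennreal (exp (s * x)) = ?f n x" using n by (auto simp: indicator_def)
      also have "\<dots> \<le> (SUP n. ?f n x)" by (rule SUP_upper) simp
      finally show "ennreal (exp (s * x)) \<le> (SUP n. ?f n x)" .
      show "(SUP n. ?f n x) \<le> ennreal (exp (s * x))"
        by (rule SUP_least) (auto simp: indicator_def)
    qed
  qed
  also have "\<dots> = (SUP n. integral\<^sup>N \<mu> (?f n))"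
    by (intro nn_integral_monotone_convergence_SUP) (auto simp: incseq_def le_fun_def indicator_def)
  also have "\<dots> \<le> ennreal (2 * exp (s * T0))"
    by (intro SUP_least exp_moment_bounded[OF assms T0_def]) simp
  finally have "(\<integral>\<^sup>+x. ennreal (exp (s * x)) \<partial>\<mu>) < \<infinity>"
    by (simp add: order_le_less_trans)
  then show ?thesis by (intro integrableI_bounded) auto
qed

lemma exp_moment_F:
  assumes "s \<ge> 0" shows "integrable F (\<lambda>q. exp (s * q))"
proof (rule F.integrable_const_bound)
  show "AE q in F. norm (exp (s * q)) \<le> exp (s * b)"
    using AE_le_b by eventually_elim (use assms in \<open>auto intro: mult_left_mono\<close>)
qed simp

end

section \<open>The moment generating function along rays\<close>

text \<open>Mean value inequality on the half-plane \<open>Re z \<le> max 0 (Re w)\<close>: it is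
  convex, contains \<open>0\<close> and \<open>w\<close>, and bounds the derivative of
  \<open>exp\<close>.\<close>

lemma norm_exp_minus_one_le: "cmod (exp w - 1) \<le> exp (max 0 (Re w)) * cmod w"
proof -
  have "cmod (exp w - exp 0) \<le> exp (max 0 (Re w)) * cmod (w - 0)"
  proof (rule field_differentiable_bound[where S="{z. Re z \<le> max 0 (Re w)}" and f'=exp])
    show "convex {z. Re z \<le> max 0 (Re w)}" by (rule convex_halfspace_Re_le)
  qed (auto intro!: derivative_eq_intros)
  then show ?thesis by simp
qed

definition cmgf :: "real measure \<Rightarrow> complex \<Rightarrow> complex" where
  "cmgf N z = (\<integral>x. exp (z * of_real x) \<partial>N)"

locale exp_moments = prob_space N for N :: "real measure" +
  assumes sets_N [measurable_cong]: "sets N = sets borel"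
    and exp_moment: "\<And>s. s \<ge> 0 \<Longrightarrow> integrable N (\<lambda>x. exp (s * x))"
begin

lemma integrable_cexp: "Re z \<ge> 0 \<Longrightarrow> integrable N (\<lambda>x. exp (z * of_real x))"
  by (rule Bochner_Integration.integrable_bound[OF exp_moment[of "Re z"]]) auto

lemma cmgf_of_real: "cmgf N (of_real s) = of_real (\<integral>x. exp (s * x) \<partial>N)"
  unfolding cmgf_def by (simp add: of_real_exp[symmetric] del: of_real_exp flip: of_real_mult)

lemma cmgf_0: "cmgf N 0 = 1"
  by (simp add: cmgf_def prob_space)

lemma continuous_on_cmgf_ray:
  assumes "Re z \<ge> 0"
  shows "continuous_on {0..} (\<lambda>r. cmgf N (of_real r * z))"
proof (unfold continuous_on_sequentially comp_def, intro allI ballI impI, elim conjE)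
  fix x :: "nat \<Rightarrow> real" and a :: real
  assume a: "a \<in> {0..}" and x: "\<forall>n. x n \<in> {0..}" and lim: "x \<longlonglongrightarrow> a"
  obtain B where B: "\<And>n. norm (x n) \<le> B"
    using convergent_imp_Bseq[of x] lim by (meson BseqE convergentI)
  then have "0 \<le> B" using norm_ge_zero order_trans by blast
  show "(\<lambda>n. cmgf N (of_real (x n) * z)) \<longlonglongrightarrow> cmgf N (of_real a * z)"
    unfolding cmgf_def
  \<comment> \<open>\<open>B\<close> bounds the sequence of radii;
    \<open>exp ((B * Re z) * y)\<close> dominates for \<open>y \<ge> 0\<close> and the constant
    \<open>1\<close> for \<open>y < 0\<close>.\<close>
  proof (rule integral_dominated_convergence[where w="\<lambda>y. 1 + exp ((B * Re z) * y)"])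
    show "integrable N (\<lambda>y. 1 + exp ((B * Re z) * y))"
      using exp_moment[of "B * Re z"] \<open>0 \<le> B\<close> assms by auto
    show "AE y in N. (\<lambda>n. exp (of_real (x n) * z * of_real y)) \<longlonglongrightarrow> exp (of_real a * z * of_real y)"
      by (intro AE_I2 tendsto_intros lim)
    show "AE y in N. cmod (exp (of_real (x n) * z * of_real y)) \<le> 1 + exp ((B * Re z) * y)" for n
    proof (rule AE_I2)
      fix y
      show "cmod (exp (of_real (x n) * z * of_real y)) \<le> 1 + exp ((B * Re z) * y)"
      proof (cases "y \<ge> 0")
        case True
        have "x n * Re z * y \<le> B * Re z * y"
          using True assms B[of n] by (intro mult_right_mono) auto
        then show ?thesis by (simp add: add_increasing)
      next
        case False
        then have "x n * Re z * y \<le> 0"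
          using assms x by (simp add: mult_nonneg_nonpos)
        then show ?thesis by (simp add: add_increasing2)
      qed
    qed
  qed simp_all
qed

end

section \<open>The fixed-point equation as a differential equation along rays\<close>

context perpetuity_laws begin

sublocale F: exp_moments F
  by unfold_locales (auto simp: sets_F exp_moment_F)

sublocale \<mu>: exp_moments \<mu>
  by unfold_locales (auto simp: sets_\<mu> exp_moment_\<mu>)

definition Mlaw :: "real measure" where "Mlaw = density lborel (\<lambda>m. ennreal (power_density \<alpha> m))"

lemma sets_Mlaw [measurable_cong]: "sets Mlaw = sets borel" by (simp add: Mlaw_def)

lemma power_density_nonneg: "power_density \<alpha> m \<ge> 0"
  using \<alpha>_pos by (simp add: power_density_def)

lemma prob_space_Mlaw: "prob_space Mlaw"
proof
  \<comment> \<open>The total mass is read off the fixed-point identity for the constant function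
    \<open>1\<close>.\<close>
  have "1 = (\<integral>\<^sup>+x. 1 \<partial>\<mu>)" by (simp add: \<mu>.emeasure_space_1[simplified])
  also have "\<dots> = (\<integral>\<^sup>+m. ennreal (power_density \<alpha> m) \<partial>lborel)"
    by (subst nn_integral_\<mu>) (auto simp: \<zeta>.emeasure_space_1[simplified])
  finally show "emeasure Mlaw (space Mlaw) = 1"
    unfolding Mlaw_def by (subst emeasure_density) auto
qed

sublocale Mlaw: prob_space Mlaw by (rule prob_space_Mlaw)

lemma \<zeta>_eq_distr: "\<zeta> = distr (F \<Otimes>\<^sub>M \<mu>) borel (\<lambda>(q, x). q + x)"
proof (rule measure_eqI)
  fix A assume "A \<in> sets \<zeta>"
  then have [measurable]: "A \<in> sets borel" by (simp add: sets_\<zeta>)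
  have "emeasure \<zeta> A = (\<integral>\<^sup>+z. indicator A z \<partial>\<zeta>)" by (simp add: sets_\<zeta>)
  also have "\<dots> = (\<integral>\<^sup>+q. \<integral>\<^sup>+x. indicator A (q + x) \<partial>\<mu> \<partial>F)" by (subst nn_integral_\<zeta>) auto
  also have "\<dots> = (\<integral>\<^sup>+w. indicator A (fst w + snd w) \<partial>(F \<Otimes>\<^sub>M \<mu>))"
    by (subst \<mu>.nn_integral_fst[symmetric]) auto
  also have "\<dots> = emeasure (distr (F \<Otimes>\<^sub>M \<mu>) borel (\<lambda>(q, x). q + x)) A"
    by (subst nn_integral_indicator[symmetric], simp, subst nn_integral_distr) (auto simp: split_beta')
  finally show "emeasure \<zeta> A = emeasure (distr (F \<Otimes>\<^sub>M \<mu>) borel (\<lambda>(q, x). q + x)) A" .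
qed (simp add: sets_\<zeta>)

lemma \<mu>_eq_distr: "\<mu> = distr (\<zeta> \<Otimes>\<^sub>M Mlaw) borel (\<lambda>(z, m). m * z)"
proof (rule measure_eqI)
  fix A assume "A \<in> sets \<mu>"
  then have [measurable]: "A \<in> sets borel" by (simp add: sets_\<mu>)
  have "emeasure \<mu> A = (\<integral>\<^sup>+z. indicator A z \<partial>\<mu>)" by (simp add: sets_\<mu>)
  also have "\<dots> = (\<integral>\<^sup>+z. \<integral>\<^sup>+m. indicator A (m * z) \<partial>Mlaw \<partial>\<zeta>)"
    unfolding Mlaw_def by (subst nn_integral_\<mu>) (auto simp: nn_integral_density)
  also have "\<dots> = (\<integral>\<^sup>+w. indicator A (snd w * fst w) \<partial>(\<zeta> \<Otimes>\<^sub>M Mlaw))"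
    by (subst Mlaw.nn_integral_fst[symmetric]) auto
  also have "\<dots> = emeasure (distr (\<zeta> \<Otimes>\<^sub>M Mlaw) borel (\<lambda>(z, m). m * z)) A"
    by (subst nn_integral_indicator[symmetric], simp, subst nn_integral_distr) (auto simp: split_beta')
  finally show "emeasure \<mu> A = emeasure (distr (\<zeta> \<Otimes>\<^sub>M Mlaw) borel (\<lambda>(z, m). m * z)) A" .
qed (simp add: sets_\<mu>)

sublocale \<zeta>: exp_moments \<zeta>
proof unfold_locales
  fix s :: real assume s: "s \<ge> 0"
  interpret pair_sigma_finite F \<mu> ..
  have "integrable (F \<Otimes>\<^sub>M \<mu>) (\<lambda>(q, x). exp (s * q) * exp (s * x))"
    using s by (intro Fubini_integrable)
      (auto simp: split_beta' abs_mult intro!: F.exp_moment \<mu>.exp_moment)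
  then show "integrable \<zeta> (\<lambda>x. exp (s * x))"
    by (subst \<zeta>_eq_distr, subst integrable_distr_eq)
      (auto simp: split_beta' exp_add[symmetric] distrib_left)
qed (simp add: sets_\<zeta>)


lemma cmgf_\<zeta>:
  assumes "Re z \<ge> 0" shows "cmgf \<zeta> z = cmgf F z * cmgf \<mu> z"
proof -
  interpret pair_sigma_finite F \<mu> ..
  have "integrable \<zeta> (\<lambda>x. exp (z * of_real x))" by (rule \<zeta>.integrable_cexp[OF assms])
  then have int: "integrable (F \<Otimes>\<^sub>M \<mu>) (\<lambda>(q, x). exp (z * of_real (q + x)))"
    by (subst (asm) \<zeta>_eq_distr, subst (asm) integrable_distr_eq) (auto simp: split_beta')
  have "cmgf \<zeta> z = (\<integral>w. exp (z * of_real (fst w + snd w)) \<partial>(F \<Otimes>\<^sub>M \<mu>))"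
    unfolding cmgf_def by (subst \<zeta>_eq_distr, subst integral_distr) (auto simp: split_beta')
  also have "\<dots> = (\<integral>q. \<integral>x. exp (z * of_real (q + x)) \<partial>\<mu> \<partial>F)"
    using integral_fst[OF int] by (simp add: split_beta')
  also have "\<dots> = (\<integral>q. exp (z * of_real q) * cmgf \<mu> z \<partial>F)"
    unfolding cmgf_def by (simp add: distrib_left exp_add)
  also have "\<dots> = cmgf F z * cmgf \<mu> z"
    unfolding cmgf_def by simp
  finally show ?thesis .
qed

lemma cmgf_\<mu>_mixture:
  assumes "Re z \<ge> 0"
  shows "integrable lborel (\<lambda>m. power_density \<alpha> m *\<^sub>R cmgf \<zeta> (of_real m * z))"
    and "cmgf \<mu> z = (\<integral>m. power_density \<alpha> m *\<^sub>R cmgf \<zeta> (of_real m * z) \<partial>lborel)"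
proof -
  interpret pair_sigma_finite \<zeta> Mlaw ..
  have "integrable \<mu> (\<lambda>x. exp (z * of_real x))" by (rule \<mu>.integrable_cexp[OF assms])
  then have int: "integrable (\<zeta> \<Otimes>\<^sub>M Mlaw) (\<lambda>(x, m). exp (z * of_real (m * x)))"
    by (subst (asm) \<mu>_eq_distr, subst (asm) integrable_distr_eq) (auto simp: split_beta')
  have eq: "exp (of_real m * z * of_real x) = exp (z * of_real (m * x))" for m x
    by (simp add: mult_ac)
  have "integrable Mlaw (\<lambda>m. \<integral>x. exp (z * of_real (m * x)) \<partial>\<zeta>)"
    by (rule integrable_snd[OF int])
  then have "integrable Mlaw (\<lambda>m. cmgf \<zeta> (of_real m * z))"
    unfolding cmgf_def eq .
  moreover from this have [measurable]: "(\<lambda>m. cmgf \<zeta> (of_real m * z)) \<in> borel_measurable borel"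
    by (auto dest!: borel_measurable_integrable)
  ultimately show "integrable lborel (\<lambda>m. power_density \<alpha> m *\<^sub>R cmgf \<zeta> (of_real m * z))"
    unfolding Mlaw_def by (subst (asm) integrable_density) (auto simp: power_density_nonneg)
  have "cmgf \<mu> z = (\<integral>w. exp (z * of_real (snd w * fst w)) \<partial>(\<zeta> \<Otimes>\<^sub>M Mlaw))"
    unfolding cmgf_def by (subst \<mu>_eq_distr, subst integral_distr) (auto simp: split_beta')
  also have "\<dots> = (\<integral>m. \<integral>x. exp (z * of_real (m * x)) \<partial>\<zeta> \<partial>Mlaw)"
    using integral_snd[OF int] by (simp add: split_beta')
  also have "\<dots> = (\<integral>m. cmgf \<zeta> (of_real m * z) \<partial>Mlaw)"
    unfolding cmgf_def eq ..
  also have "\<dots> = (\<integral>m. power_density \<alpha> m *\<^sub>R cmgf \<zeta> (of_real m * z) \<partial>lborel)"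
    unfolding Mlaw_def by (subst integral_density) (auto simp: power_density_nonneg)
  finally show "cmgf \<mu> z = (\<integral>m. power_density \<alpha> m *\<^sub>R cmgf \<zeta> (of_real m * z) \<partial>lborel)" .
qed

text \<open>The substitution \<open>w = r * m\<close> moves \<open>r\<close> from the integrand into
  the upper limit, at the price of the factor \<open>r powr \<alpha>\<close>. The transform of the
  mixture can then be differentiated in \<open>r\<close> by the fundamental theorem of
  calculus.\<close>

lemma cmgf_\<mu>_ray:
  assumes z: "Re z \<ge> 0" and r: "r > 0"
  defines "k \<equiv> \<lambda>w. (\<alpha> * w powr (\<alpha> - 1)) *\<^sub>R cmgf \<zeta> (of_real w * z)"
  shows "k integrable_on {0..r}"
    and "(r powr \<alpha>) *\<^sub>R cmgf \<mu> (of_real r * z) = integral {0..r} k"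
proof -
  have rz: "Re (of_real r * z) \<ge> 0" using z r by simp
  have *: "power_density \<alpha> (w / r) *\<^sub>R cmgf \<zeta> (of_real (w / r) * (of_real r * z))
     = (r powr (1 - \<alpha>)) *\<^sub>R (indicator {0<..<r} w *\<^sub>R k w)" for w
  proof (cases "0 < w \<and> w < r")
    case True
    have "r powr (\<alpha> - 1) = inverse (r powr (1 - \<alpha>))" by (simp add: powr_minus[symmetric])
    then show ?thesis using True r
      by (simp add: power_density_def k_def powr_divide field_simps)
  next
    case False
    then show ?thesis using r by (auto simp: power_density_def indicator_def field_simps)
  qed
  have "integrable lborel (\<lambda>w. power_density \<alpha> (0 + (1/r) * w) *\<^sub>R cmgf \<zeta> (of_real (0 + (1/r) * w) *
      (of_real r * z)))"
    using r by (intro lborel_integrable_real_affine[OF cmgf_\<mu>_mixture(1)[OF rz]]) auto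
  then have scaled: "integrable lborel (\<lambda>w. (r powr (1 - \<alpha>)) *\<^sub>R (indicator {0<..<r} w *\<^sub>R k w))"
    by (simp only: *[symmetric]) simp
  have scaled': "integrable lborel (\<lambda>w. (r powr (\<alpha> - 1)) *\<^sub>R (r powr (1 - \<alpha>)) *\<^sub>R (indicator {0<..<r} w *\<^sub>R
      k w))"
    by (rule integrable_scaleR_right, rule scaled)
  have int: "set_integrable lborel {0<..<r} k"
  proof -
    have "r powr (\<alpha> - 1) * r powr (1 - \<alpha>) = 1" using r by (simp add: powr_add[symmetric])
    then have "(r powr (\<alpha> - 1)) *\<^sub>R (r powr (1 - \<alpha>)) *\<^sub>R v = v" for v :: complex by simp
    with scaled' show ?thesis unfolding set_integrable_def by (simp only:)
  qed
  then show "k integrable_on {0..r}"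
    by (simp add: set_borel_integral_eq_integral(1) flip: integrable_on_open_interval_real)
  have "cmgf \<mu> (of_real r * z) = (\<integral>m. power_density \<alpha> m *\<^sub>R cmgf \<zeta> (of_real m * (of_real r * z)) \<partial>lborel)"
    by (rule cmgf_\<mu>_mixture(2)[OF rz])
  also have "\<dots> = \<bar>1/r\<bar> *\<^sub>R (\<integral>w. power_density \<alpha> (0 + (1/r) * w) *\<^sub>R cmgf \<zeta> (of_real (0 + (1/r) * w) *
      (of_real r * z)) \<partial>lborel)"
    using r by (intro lborel_integral_real_affine) auto
  also have "\<dots> = (1/r) *\<^sub>R (\<integral>w. (r powr (1 - \<alpha>)) *\<^sub>R (indicator {0<..<r} w *\<^sub>R k w) \<partial>lborel)"
    using r by (simp only: *[symmetric]) simp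
  also have "\<dots> = (r powr (-\<alpha>)) *\<^sub>R (LINT w:{0<..<r}|lborel. k w)"
    using r unfolding set_lebesgue_integral_def
    by (subst integral_scaleR_right) (simp add: powr_diff powr_minus field_simps)
  also have "(LINT w:{0<..<r}|lborel. k w) = integral {0..r} k"
    by (simp add: set_borel_integral_eq_integral(2)[OF int] integral_open_interval_real)
  finally show "(r powr \<alpha>) *\<^sub>R cmgf \<mu> (of_real r * z) = integral {0..r} k"
    using r by (simp add: powr_add[symmetric])
qed

text \<open>Product rule for \<open>r powr (-\<alpha>)\<close> times the indefinite integral;
  \<open>cmgf_\<zeta>\<close> expresses the integrand by the transforms of \<open>F\<close> and
  \<open>\<mu>\<close>, which closes the equation. The point \<open>r = 0\<close> is excluded
  because the power in \<open>k\<close> may be singular there.\<close>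

lemma cmgf_\<mu>_has_derivative:
  assumes z: "Re z \<ge> 0" and r: "r \<in> {0<..1}"
  shows "((\<lambda>r. cmgf \<mu> (of_real r * z)) has_vector_derivative
    of_real \<alpha> * ((cmgf F (of_real r * z) - 1) / of_real r) * cmgf \<mu> (of_real r * z)) (at r within {0..1})"
proof -
  define k where "k = (\<lambda>w. (\<alpha> * w powr (\<alpha> - 1)) *\<^sub>R cmgf \<zeta> (of_real w * z))"
  define f where "f = (\<lambda>r. cmgf \<mu> (of_real r * z))"
  have rpos: "r > 0" using r by simp
  have cont: "continuous (at r within {0..1}) (\<lambda>w. cmgf \<zeta> (of_real w * z))"
    using continuous_on_subset[OF \<zeta>.continuous_on_cmgf_ray[OF z], of "{0..1}"] r
    by (auto simp: continuous_on_eq_continuous_within)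
  have "continuous (at r within {0..1}) k" unfolding k_def
    using rpos by (intro continuous_intros cont) auto
  then have "((\<lambda>u. integral {0..u} k) has_vector_derivative k r) (at r within {0..1})"
    using integral_has_vector_derivative_continuous_at[of k 0 1 r "{}"] cmgf_\<mu>_ray(1)[OF z, of 1] r
    by (simp add: k_def)
  moreover have "((\<lambda>u. u powr (-\<alpha>)) has_real_derivative (-\<alpha>) * r powr (-\<alpha> - 1)) (at r within {0..1})"
    using rpos by (auto intro!: derivative_eq_intros)
  ultimately have "((\<lambda>u. (u powr (-\<alpha>)) *\<^sub>R integral {0..u} k) has_vector_derivative
     (r powr (-\<alpha>)) *\<^sub>R k r + ((-\<alpha>) * r powr (-\<alpha> - 1)) *\<^sub>R integral {0..r} k) (at r within {0..1})"
    by (rule has_vector_derivative_scaleR[rotated])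
  also have "(r powr (-\<alpha>)) *\<^sub>R k r = (\<alpha> / r) *\<^sub>R (cmgf F (of_real r * z) * f r)"
    using rpos z by (simp add: k_def f_def cmgf_\<zeta> powr_minus powr_diff)
  also have "((-\<alpha>) * r powr (-\<alpha> - 1)) *\<^sub>R integral {0..r} k = (-\<alpha> / r) *\<^sub>R f r"
  proof -
    have "integral {0..r} k = (r powr \<alpha>) *\<^sub>R f r"
      using cmgf_\<mu>_ray(2)[OF z rpos] by (simp add: k_def f_def)
    then show ?thesis using rpos by (simp add: powr_minus powr_diff)
  qed
  also have "(\<alpha> / r) *\<^sub>R (cmgf F (of_real r * z) * f r) + (-\<alpha> / r) *\<^sub>R f r
     = of_real \<alpha> * ((cmgf F (of_real r * z) - 1) / of_real r) * f r"
    using rpos by (simp add: scaleR_conv_of_real field_simps)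
  finally have D: "((\<lambda>u. (u powr (-\<alpha>)) *\<^sub>R integral {0..u} k) has_vector_derivative
     of_real \<alpha> * ((cmgf F (of_real r * z) - 1) / of_real r) * f r) (at r within {0..1})" .
  have "(f has_vector_derivative of_real \<alpha> * ((cmgf F (of_real r * z) - 1) / of_real r) * f r) (at r within
      {0..1})"
  proof (rule has_vector_derivative_transform_within[OF D rpos])
    show "r \<in> {0..1}" using r by simp
    fix u assume "u \<in> {0..1}" "dist u r < r"
    then have "u > 0" by (auto simp: dist_real_def)
    then show "(u powr (-\<alpha>)) *\<^sub>R integral {0..u} k = f u"
      using cmgf_\<mu>_ray(2)[OF z, of u] by (simp add: k_def f_def powr_add[symmetric] flip: cmgf_\<mu>_ray(2)[OF
          z])
  qed
  then show ?thesis by (simp add: f_def)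
qed

text \<open>Integrating factor: \<open>K\<close> has derivative zero on \<open>(0, 1]\<close>, and
  continuity suffices at the exceptional point \<open>0\<close>, where \<open>K 0 = 1\<close>.
  Solving the equation directly avoids the choice of a branch of the complex logarithm.\<close>

lemma cmgf_\<mu>_eq_exp:
  assumes z: "Re z \<ge> 0"
    and int: "(\<lambda>r. (cmgf F (of_real r * z) - 1) / of_real r) integrable_on {0..1}"
  shows "cmgf \<mu> z = exp (of_real \<alpha> * integral {0..1} (\<lambda>r. (cmgf F (of_real r * z) - 1) / of_real r))"
proof -
  define c where "c = (\<lambda>r. (cmgf F (of_real r * z) - 1) / of_real r)"
  define I where "I = (\<lambda>r. integral {0..r} c)"
  define K where "K = (\<lambda>r. cmgf \<mu> (of_real r * z) * exp (- (of_real \<alpha> * I r)))"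
  have "K 1 = 1"
  proof (rule has_derivative_zero_unique_strong_interval[where a=0 and b=1 and k="{0}"])
    show "continuous_on {0..1} K" unfolding K_def I_def
      using int by (intro continuous_intros continuous_on_subset[OF \<mu>.continuous_on_cmgf_ray[OF z]]
          indefinite_integral_continuous_1)
       (auto simp: c_def)
    show "K 0 = 1" by (simp add: K_def I_def \<mu>.cmgf_0)
    fix r :: real assume "r \<in> {0..1} - {0}"
    then have r: "r \<in> {0<..1}" by auto
    have "continuous (at r within {0..1}) (\<lambda>w. cmgf F (of_real w * z))"
      using continuous_on_subset[OF F.continuous_on_cmgf_ray[OF z], of "{0..1}"] r
      by (auto simp: continuous_on_eq_continuous_within)
    then have "continuous (at r within {0..1}) c" unfolding c_def
      using r by (intro continuous_intros) auto
    then have I: "(I has_vector_derivative c r) (at r within {0..1})"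
      using integral_has_vector_derivative_continuous_at[of c 0 1 r "{}"] int r
      by (simp add: I_def c_def)
    have "((\<lambda>r. exp (- (of_real \<alpha> * I r))) has_vector_derivative (- (of_real \<alpha> * c r)) * exp (- (of_real \<alpha> *
        I r))) (at r within {0..1})"
    proof -
      have "((\<lambda>r. - (of_real \<alpha> * I r)) has_vector_derivative - (of_real \<alpha> * c r)) (at r within {0..1})"
        by (intro derivative_intros I)
      from field_vector_diff_chain_within[OF this DERIV_subset[OF DERIV_exp subset_UNIV]] show ?thesis
        by (simp add: o_def)
    qed
    from has_vector_derivative_mult[OF cmgf_\<mu>_has_derivative[OF z r] this]
    have "(K has_vector_derivative 0) (at r within {0..1})"
      unfolding K_def by (simp add: c_def algebra_simps)
    then show "(K has_derivative (\<lambda>h. 0)) (at r within {0..1})"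
      by (simp add: has_vector_derivative_def)
  qed auto
  then show ?thesis unfolding K_def I_def c_def by (simp add: exp_minus field_simps)
qed

end

section \<open>Logarithm of the moment generating function\<close>

text \<open>The logarithm of \<open>E e\<^bsup>zX\<^esup>\<close> is \<open>\<alpha> E[ein (z Q)]\<close>.\<close>

definition ein :: "complex \<Rightarrow> complex" where
  "ein w = integral {0<..<1} (\<lambda>r. (exp (of_real r * w) - 1) / of_real r)"

lemma ein_integrand_bound:
  fixes w :: complex
  assumes "r \<in> {0<..1}"
  shows "cmod ((exp (of_real r * w) - 1) / of_real r) \<le> exp (max 0 (Re w)) * cmod w"
proof -
  have "max 0 (r * Re w) \<le> max 0 (Re w)"
    using assms by (auto simp: max_def mult_le_0_iff mult_left_le_one_le)
  then have "cmod (exp (of_real r * w) - 1) \<le> exp (max 0 (Re w)) * cmod (of_real r * w)"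
    using norm_exp_minus_one_le[of "of_real r * w"] by (auto elim!: order_trans intro!: mult_right_mono)
  then show ?thesis using assms by (simp add: norm_divide norm_mult field_simps)
qed

lemma set_integrable_ein:
  fixes w :: complex
  shows "set_integrable lborel {0<..<1} (\<lambda>r. (exp (of_real r * w) - 1) / of_real r)"
  unfolding set_integrable_def
  by (rule integrableI_bounded_set_indicator[where B="exp (max 0 (Re w)) * cmod w"])
    (auto intro!: AE_I2 ein_integrand_bound)

lemma ein_eq_LINT: "ein w = (LINT r:{0<..<1}|lborel. (exp (of_real r * w) - 1) / of_real r)"
  unfolding ein_def by (rule set_borel_integral_eq_integral(2)[OF set_integrable_ein, symmetric])

lemma ein_has_integral:
  "((\<lambda>r. (exp (of_real r * w) - 1) / of_real r) has_integral ein w) {0<..<1}"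
  unfolding ein_def using set_borel_integral_eq_integral(1)[OF set_integrable_ein] integrable_integral
      by blast

lemma LINT_norm_ein_integrand_le:
  assumes "cmod w \<le> B" "Re w \<le> R" "R \<ge> 0"
  shows "(LINT r:{0<..<1}|lborel. cmod ((exp (of_real r * w) - 1) / of_real r)) \<le> exp R * B"
proof -
  have "(LINT r:{0<..<1}|lborel. cmod ((exp (of_real r * w) - 1) / of_real r))
      \<le> (LINT r:{0<..<1::real}|lborel. exp R * B)"
  proof (rule set_integral_mono)
    show "set_integrable lborel {0<..<1} (\<lambda>r. cmod ((exp (of_real r * w) - 1) / of_real r))"
      by (rule set_integrable_norm[OF set_integrable_ein])
    show "set_integrable lborel {0<..<1::real} (\<lambda>_. exp R * B)"
      unfolding set_integrable_def by simp
    fix r :: real assume "r \<in> {0<..<1}"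
    then have "cmod ((exp (of_real r * w) - 1) / of_real r) \<le> exp (max 0 (Re w)) * cmod w"
      by (intro ein_integrand_bound) auto
    also have "\<dots> \<le> exp R * B" using assms by (intro mult_mono) auto
    finally show "cmod ((exp (of_real r * w) - 1) / of_real r) \<le> exp R * B" .
  qed
  also have "\<dots> = exp R * B" unfolding set_lebesgue_integral_def by (subst integral_scaleR_left) auto
  finally show ?thesis .
qed

lemma log_plus_nonneg: "log_plus y \<ge> 0"
  by (simp add: log_plus_def)

lemma log_plus_mult_le:
  assumes "x \<ge> 0" "y \<ge> 0" shows "log_plus (x * y) \<le> log_plus x + log_plus y"
proof (cases "x * y \<ge> 1")
  case True
  then have pos: "x > 0" "y > 0" using assms by (auto simp: less_le)
  have "ln x \<le> log_plus x" "ln y \<le> log_plus y"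
    using pos by (auto simp: log_plus_def)
  with True pos show ?thesis by (simp add: log_plus_def[of "x * y"] ln_mult)
qed (simp add: log_plus_def[of "x * y"] log_plus_nonneg)

text \<open>The integrand is at most \<open>cmod w\<close> and at most \<open>2 / r\<close>; cutting
  at \<open>r = 1 / cmod w\<close> gives \<open>1 + 2 * ln (cmod w)\<close>. This is how the
  logarithmic moment of \<open>Q\<close> enters, through its negative values.\<close>

lemma LINT_norm_ein_integrand_le_log:
  assumes w: "Re w \<le> 0"
  shows "(LINT r:{0<..<1}|lborel. cmod ((exp (of_real r * w) - 1) / of_real r)) \<le> 1 + 2 * log_plus (cmod w)"
proof (cases "cmod w \<ge> 1")
  case False
  have "(LINT r:{0<..<1}|lborel. cmod ((exp (of_real r * w) - 1) / of_real r)) \<le> exp 0 * 1"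
    using False w by (intro LINT_norm_ein_integrand_le) auto
  then show ?thesis using log_plus_nonneg[of "cmod w"] by simp
next
  case True
  define c where "c = cmod w"
  have c: "c \<ge> 1" using True by (simp add: c_def)
  have I2: "has_bochner_integral lborel (\<lambda>r. (2/r) * indicator {1/c..1} r) (2 * ln 1 - 2 * ln (1/c))"
  proof (rule has_bochner_integral_FTC_Icc_nonneg)
    fix r assume "r \<in> {1/c..1}"
    moreover have "1 / c > 0" using c by simp
    ultimately have "r > 0" by (meson atLeastAtMost_iff less_le_trans)
    then show "((\<lambda>r. 2 * ln r) has_real_derivative 2 / r) (at r)" "2 / r \<ge> 0"
      by (auto intro!: derivative_eq_intros)
  qed (use c in auto)
  have I1: "has_bochner_integral lborel (\<lambda>r. c * indicator {0..1/c} r) (c * (1/c))"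
    using c by (intro has_bochner_integral_mult_right) (auto simp: has_bochner_integral_iff)
  note I = has_bochner_integral_add[OF I1 I2]
  have "(LINT r:{0<..<1}|lborel. cmod ((exp (of_real r * w) - 1) / of_real r)) \<le>
     (\<integral>r. c * indicator {0..1/c} r + (2/r) * indicator {1/c..1} r \<partial>lborel)"
    unfolding set_lebesgue_integral_def
  proof (rule integral_mono)
    show "integrable lborel (\<lambda>r. indicat_real {0<..<1} r *\<^sub>R cmod ((exp (of_real r * w) - 1) / of_real r))"
      using set_integrable_norm[OF set_integrable_ein] unfolding set_integrable_def .
    show "integrable lborel (\<lambda>r. c * indicator {0..1/c} r + (2/r) * indicator {1/c..1} r)"
      using I by (rule integrable.intros)
    fix r :: real
    show "indicat_real {0<..<1} r *\<^sub>R cmod ((exp (of_real r * w) - 1) / of_real r)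
      \<le> c * indicator {0..1/c} r + (2/r) * indicator {1/c..1} r"
    proof (cases "r \<in> {0<..<1}")
      case True
      have "cmod ((exp (of_real r * w) - 1) / of_real r) \<le> exp (max 0 (Re w)) * cmod w"
        using True by (intro ein_integrand_bound) auto
      then have 1: "cmod ((exp (of_real r * w) - 1) / of_real r) \<le> c" using w
          by (simp add: c_def max.absorb1)
      have "cmod (exp (of_real r * w) - 1) \<le> exp (r * Re w) + 1"
        by (rule order_trans[OF norm_triangle_ineq4]) simp
      also have "\<dots> \<le> 2" using w True by (simp add: mult_le_0_iff)
      finally have 2: "cmod ((exp (of_real r * w) - 1) / of_real r) \<le> 2 / r"
        using True by (simp add: norm_divide divide_right_mono)
      show ?thesis
      proof (cases "r \<le> 1 / c")
        case True
        then show ?thesis using 1 \<open>r \<in> {0<..<1}\<close> by (auto simp: indicator_def)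
      next
        case False
        then show ?thesis using 2 \<open>r \<in> {0<..<1}\<close> by (auto simp: indicator_def)
      qed
    next
      case False
      have "c > 0" using c by simp
      then have "r > 0" if "1 / c \<le> r" using that by (meson divide_pos_pos less_le_trans zero_less_one)
      then show ?thesis using c False by (auto simp: indicator_def)
    qed
  qed
  also have "\<dots> = c * (1/c) + (2 * ln 1 - 2 * ln (1/c))"
    by (rule has_bochner_integral_integral_eq[OF I])
  also have "\<dots> = 1 + 2 * log_plus (cmod w)"
    using c by (simp add: log_plus_def ln_div c_def[symmetric])
  finally show ?thesis .
qed

context perpetuity_laws begin

text \<open>For \<open>q \<ge> 0\<close> the bound \<open>q \<le> b\<close> keeps the integral over
  \<open>r\<close> bounded; for \<open>q < 0\<close> the exponent \<open>z * of_real q\<close> has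
  nonpositive real part, and the logarithmic bound is integrable by
  \<open>integrable_log_plus\<close>.\<close>

lemma integrable_ein_kernel:
  assumes z: "Re z \<ge> 0"
  shows "integrable (F \<Otimes>\<^sub>M lborel) (\<lambda>(q, r). indicator {0<..<1} r *\<^sub>R ((exp (of_real r * (z * of_real q)) -
      1) / of_real r))"
proof -
  interpret pair_sigma_finite F "lborel :: real measure" ..
  let ?k = "\<lambda>q r. indicat_real {0<..<1} r *\<^sub>R ((exp (of_real r * (z * of_real q)) - 1) / of_real r)"
  have nk: "norm (?k q r) = indicat_real {0<..<1} r *\<^sub>R cmod ((exp (of_real r * (z * of_real q)) - 1) /
      of_real r)" for q r
    by simp
  show ?thesis
  proof (rule Fubini_integrable)
    show "(\<lambda>(q, r). ?k q r) \<in> borel_measurable (F \<Otimes>\<^sub>M lborel)" by (simp add: split_beta')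
    have "integrable F (\<lambda>q. \<integral>r. norm (?k q r) \<partial>lborel)"
    proof (rule Bochner_Integration.integrable_bound)
      let ?w = "\<lambda>q. (exp (Re z * b) * (cmod z * b) + 1 + 2 * log_plus (cmod z)) + 2 * log_plus \<bar>q\<bar>"
      show "integrable F ?w" using integrable_log_plus by simp
      show "AE q in F. norm (\<integral>r. norm (?k q r) \<partial>lborel) \<le> norm (?w q)"
        using AE_le_b
      proof eventually_elim
        fix q assume q: "q \<le> b"
        define B where "B = exp (Re z * b) * (cmod z * b)"
        have "B \<ge> 0" using b_pos by (simp add: B_def)
        have "(\<integral>r. norm (?k q r) \<partial>lborel) \<le> ?w q"
        proof (cases "q \<ge> 0")
          case True
          then have "(\<integral>r. norm (?k q r) \<partial>lborel) \<le> B"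
            using q z b_pos unfolding nk set_lebesgue_integral_def[symmetric] B_def
            by (intro LINT_norm_ein_integrand_le) (auto simp: norm_mult intro!: mult_left_mono)
          then show ?thesis using log_plus_nonneg[of "cmod z"] log_plus_nonneg[of "\<bar>q\<bar>"] unfolding B_def
              by simp
        next
          case False
          then have "(\<integral>r. norm (?k q r) \<partial>lborel) \<le> 1 + 2 * log_plus (cmod (z * of_real q))"
            using z unfolding nk set_lebesgue_integral_def[symmetric]
            by (intro LINT_norm_ein_integrand_le_log) (auto simp: mult_nonneg_nonpos)
          also have "\<dots> \<le> 1 + 2 * (log_plus (cmod z) + log_plus \<bar>q\<bar>)"
            using log_plus_mult_le[of "cmod z" "\<bar>q\<bar>"] by (simp add: norm_mult)
          finally show ?thesis using \<open>B \<ge> 0\<close> unfolding B_def by simp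
        qed
        moreover have "(\<integral>r. norm (?k q r) \<partial>lborel) \<ge> 0" by (intro integral_nonneg_AE) simp
        ultimately show "norm (\<integral>r. norm (?k q r) \<partial>lborel) \<le> norm (?w q)" by simp
      qed
      show "(\<lambda>q. \<integral>r. norm (?k q r) \<partial>lborel) \<in> borel_measurable F"
        by (rule lborel.borel_measurable_lebesgue_integral) (simp add: split_beta')
    qed
    then show "integrable F (\<lambda>q. \<integral>r. norm (case (q, r) of (q, r) \<Rightarrow> ?k q r) \<partial>lborel)" by simp
    show "AE q in F. integrable lborel (\<lambda>r. case (q, r) of (q, r) \<Rightarrow> ?k q r)"
      using set_integrable_ein unfolding set_integrable_def by (auto intro!: AE_I2)
  qed
qed

lemma
  assumes z: "Re z \<ge> 0"
  shows integrable_ein: "integrable F (\<lambda>q. ein (z * of_real q))"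
    and set_integrable_cmgf_quotient:
      "set_integrable lborel {0<..<1} (\<lambda>r. (cmgf F (of_real r * z) - 1) / of_real r)"
    and LINT_cmgf_quotient: "(LINT r:{0<..<1}|lborel. (cmgf F (of_real r * z) - 1) / of_real r)
        = (\<integral>q. ein (z * of_real q) \<partial>F)"
proof -
  interpret pair_sigma_finite F "lborel :: real measure" ..
  let ?k = "\<lambda>q r. indicat_real {0<..<1} r *\<^sub>R ((exp (of_real r * (z * of_real q)) - 1) / of_real r)"
  note int = integrable_ein_kernel[OF z]
  have 1: "(\<integral>r. ?k q r \<partial>lborel) = ein (z * of_real q)" for q
    by (simp add: ein_eq_LINT set_lebesgue_integral_def)
  have 2: "(\<integral>q. ?k q r \<partial>F) = indicat_real {0<..<1} r *\<^sub>R ((cmgf F (of_real r * z) - 1) / of_real r)" for r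
  proof (cases "r \<in> {0<..<1}")
    case True
    then have "integrable F (\<lambda>q. exp (of_real r * z * of_real q))"
      using z by (intro F.integrable_cexp) auto
    then have "(\<integral>q. exp (of_real r * z * of_real q) - 1 \<partial>F) = cmgf F (of_real r * z) - 1"
      unfolding cmgf_def by (subst Bochner_Integration.integral_diff) (auto simp: F.prob_space[simplified])
    then show ?thesis using True by (simp add: mult.assoc)
  qed simp
  show "integrable F (\<lambda>q. ein (z * of_real q))" using integrable_fst[OF int] unfolding 1 .
  show "set_integrable lborel {0<..<1} (\<lambda>r. (cmgf F (of_real r * z) - 1) / of_real r)"
    using integrable_snd[OF int] unfolding 2 set_integrable_def .
  show "(LINT r:{0<..<1}|lborel. (cmgf F (of_real r * z) - 1) / of_real r) = (\<integral>q. ein (z * of_real q) \<partial>F)"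
    using Fubini_integral[OF int] unfolding 1 2 set_lebesgue_integral_def .
qed

lemma cmgf_\<mu>_eq_exp_ein:
  assumes z: "Re z \<ge> 0"
  shows "cmgf \<mu> z = exp (of_real \<alpha> * (\<integral>q. ein (z * of_real q) \<partial>F))"
proof -
  note int = set_borel_integral_eq_integral[OF set_integrable_cmgf_quotient[OF z]]
  show ?thesis
    using int cmgf_\<mu>_eq_exp[OF z] LINT_cmgf_quotient[OF z]
    by (simp add: integrable_on_open_interval_real integral_open_interval_real)
qed

definition mgf_F :: "real \<Rightarrow> real" where "mgf_F s = (\<integral>q. exp (s * q) \<partial>F)"
definition mgf_\<mu> :: "real \<Rightarrow> real" where "mgf_\<mu> s = (\<integral>x. exp (s * x) \<partial>\<mu>)"

text \<open>The change of variables \<open>y = r * s\<close> turns the integral along the ray into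
  the interval integral of the theorem.\<close>

lemma mgf_\<mu>_eq_exp:
  assumes s: "s > 0"
  shows "mgf_\<mu> s = exp (\<alpha> * (LBINT y=0..ereal s. (mgf_F y - 1) / y))"
proof -
  have rs: "(cmgf F (of_real r * of_real s) - 1) / of_real r = of_real ((mgf_F (r * s) - 1) / r)" for r
    using F.cmgf_of_real[of "r * s"] by (simp add: mgf_F_def)
  have int: "set_integrable lborel {0<..<1} (\<lambda>r. (mgf_F (r * s) - 1) / r)"
    using set_integrable_cmgf_quotient[of "of_real s"] s unfolding rs set_integrable_def
    by (auto dest!: integrable_Re)
  have "(LINT r:{0<..<1}|lborel. (cmgf F (of_real r * of_real s) - 1) / of_real r)
     = of_real (LINT r:{0<..<1}|lborel. (mgf_F (r * s) - 1) / r)"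
  proof -
    have *: "indicat_real {0<..<1} r *\<^sub>R complex_of_real x
        = of_real (indicat_real {0<..<1} r *\<^sub>R x)" for r x
      by (simp add: scaleR_conv_of_real)
    show ?thesis unfolding rs set_lebesgue_integral_def * by (rule integral_complex_of_real)
  qed
  also have "(LINT r:{0<..<1}|lborel. (mgf_F (r * s) - 1) / r) = (LBINT y=0..ereal s. (mgf_F y - 1) / y)"
  proof -
    have "(LBINT y=0..ereal s. (mgf_F y - 1) / y) = (\<integral>y. indicator {0<..<s} y *\<^sub>R ((mgf_F y - 1) / y)
        \<partial>lborel)"
      using s by (simp add: interval_lebesgue_integral_def set_lebesgue_integral_def einterval_def
          zero_ereal_def greaterThanLessThan_def greaterThan_def lessThan_def Int_def)
    also have "\<dots> = \<bar>s\<bar> *\<^sub>R (\<integral>r. indicator {0<..<s} (0 + s * r) *\<^sub>R ((mgf_F (0 + s * r) - 1) / (0 + s * r))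
        \<partial>lborel)"
      using s by (intro lborel_integral_real_affine) auto
    also have "\<dots> = (\<integral>r. s * (indicator {0<..<s} (s * r) *\<^sub>R ((mgf_F (s * r) - 1) / (s * r))) \<partial>lborel)"
      using s by (subst integral_mult_right_zero) simp
    also have "\<dots> = (LINT r:{0<..<1}|lborel. (mgf_F (r * s) - 1) / r)"
      unfolding set_lebesgue_integral_def using s
      by (intro Bochner_Integration.integral_cong) (auto simp: indicator_def zero_less_mult_iff
          mult.commute)
    finally show ?thesis by simp
  qed
  finally have "of_real (mgf_\<mu> s) = exp (of_real \<alpha> * complex_of_real (LBINT y=0..ereal s. (mgf_F y - 1) /
      y))"
    using LINT_cmgf_quotient[of "of_real s"] cmgf_\<mu>_eq_exp_ein[of "of_real s"] s \<mu>.cmgf_of_real[of s]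
    by (simp add: mgf_\<mu>_def)
  then have "complex_of_real (mgf_\<mu> s) = of_real (exp (\<alpha> * (LBINT y=0..ereal s. (mgf_F y - 1) / y)))"
    by (simp add: exp_of_real[symmetric] del: exp_of_real)
  then show ?thesis by (simp only: of_real_eq_iff)
qed

end

section \<open>The tilted characteristic function\<close>

text \<open>\<open>curvature s q\<close> is the derivative of \<open>(e\<^bsup>sq\<^esup> - 1) / s\<close> with respect to \<open>s\<close>.\<close>

definition curvature :: "real \<Rightarrow> real \<Rightarrow> real" where
  "curvature s q = (s * q * exp (s * q) - exp (s * q) + 1) / s\<^sup>2"

text \<open>\<open>\<alpha>\<close> times its mean under \<open>F\<close> is an exponent of the
  tilted characteristic function at \<open>u\<close>, so estimates for a fixed \<open>q\<close>
  carry over by integration.\<close>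

definition ein_diff :: "real \<Rightarrow> real \<Rightarrow> real \<Rightarrow> complex" where
  "ein_diff s u q = ein (Complex s u * of_real q) - ein (of_real s * of_real q)"

section \<open>Estimates for a single value of \<open>Q\<close>\<close>

lemma has_integral_exp_linear:
  fixes s q :: real
  assumes "s > 0" shows "((\<lambda>r. q * exp (r * s * q)) has_integral (exp (s * q) - 1) / s) {0<..<1}"
proof -
  have "((\<lambda>r. q * exp (r * s * q)) has_integral exp (1 * s * q) / s - exp (0 * s * q) / s) {0..1}"
  proof (rule fundamental_theorem_of_calculus[where f="\<lambda>r. exp (r * s * q) / s"])
    fix r :: real
    show "((\<lambda>r. exp (r * s * q) / s) has_vector_derivative q * exp (r * s * q)) (at r within {0..1})"
      using assms unfolding has_real_derivative_iff_has_vector_derivative[symmetric]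
      by (auto intro!: derivative_eq_intros)
  qed simp
  then show ?thesis by (simp add: has_integral_Icc_iff_Ioo diff_divide_distrib)
qed

lemma has_integral_curvature:
  assumes "s > 0" shows "((\<lambda>r. r * q\<^sup>2 * exp (r * s * q)) has_integral curvature s q) {0<..<1}"
proof -
  have "((\<lambda>r. r * q\<^sup>2 * exp (r * s * q)) has_integral
      (1 * q / s - 1 / s\<^sup>2) * exp (1 * s * q) - (0 * q / s - 1 / s\<^sup>2) * exp (0 * s * q)) {0..1}"
  proof (rule fundamental_theorem_of_calculus)
    fix r :: real
    show "((\<lambda>r. (r * q / s - 1 / s\<^sup>2) * exp (r * s * q)) has_vector_derivative r * q\<^sup>2 * exp (r * s * q))
        (at r within {0..1})"
      using assms unfolding has_real_derivative_iff_has_vector_derivative[symmetric]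
      by (auto intro!: derivative_eq_intros) (simp add: field_simps power2_eq_square)
  qed simp
  also have "(1 * q / s - 1 / s\<^sup>2) * exp (1 * s * q) - (0 * q / s - 1 / s\<^sup>2) * exp (0 * s * q)
      = curvature s q"
    using assms by (simp add: curvature_def field_simps power2_eq_square)
  finally show ?thesis by (simp add: has_integral_Icc_iff_Ioo)
qed

lemma has_integral_ein_diff:
  "((\<lambda>r. of_real (exp (r * s * q) / r) * (exp (\<i> * of_real (r * u * q)) - 1)) has_integral ein_diff s u q)
      {0<..<1}"
proof -
  have e1: "exp (of_real r * (Complex s u * of_real q)) = of_real (exp (r * s * q)) * exp (\<i> * of_real (r *
      u * q))" for r
    by (simp add: exp_of_real[symmetric] mult_exp_exp Complex_eq algebra_simps del: exp_of_real)
  have e2: "exp (of_real r * (of_real s * of_real q)) = complex_of_real (exp (r * s * q))" for r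
    by (simp add: exp_of_real[symmetric] mult_ac del: exp_of_real)
  have e3: "(A * B - 1) / R - (A - 1) / R = A / R * (B - 1)" for A B R :: complex
    by (simp add: algebra_simps diff_divide_distrib)
  have "(exp (of_real r * (Complex s u * of_real q)) - 1) / of_real r - (exp (of_real r * (of_real s *
      of_real q)) - 1) / of_real r
    = of_real (exp (r * s * q) / r) * (exp (\<i> * of_real (r * u * q)) - 1)" for r
    unfolding e1 e2 e3 by simp
  then show ?thesis
    using has_integral_diff[OF ein_has_integral[of "Complex s u * of_real q"] ein_has_integral[of "of_real s
        * of_real q"]]
    by (simp add: ein_diff_def)
qed

lemma has_integral_Re_ein_diff:
  "((\<lambda>r. exp (r * s * q) / r * (1 - cos (r * u * q))) has_integral - Re (ein_diff s u q)) {0<..<1}"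
proof -
  have "Re (of_real x * (exp (\<i> * of_real y) - 1)) = - (x * (1 - cos y))" for x y
    by (simp add: Re_exp algebra_simps)
  then have "((\<lambda>r. - (exp (r * s * q) / r * (1 - cos (r * u * q)))) has_integral Re (ein_diff s u q))
      {0<..<1}"
    using has_integral_linear[OF has_integral_ein_diff bounded_linear_Re, of s q u]
    by (simp only: o_def)
  from has_integral_neg[OF this] show ?thesis by simp
qed

lemma Re_ein_diff_nonpos: "Re (ein_diff s u q) \<le> 0"
proof -
  have "0 \<le> - Re (ein_diff s u q)"
    by (rule has_integral_nonneg[OF has_integral_Re_ein_diff]) auto
  then show ?thesis by simp
qed

lemma curvature_nonneg: "s > 0 \<Longrightarrow> curvature s q \<ge> 0"
  by (rule has_integral_nonneg[OF has_integral_curvature]) auto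

lemma curvature_neg_le:
  assumes "s > 0" "q < 0" shows "curvature s q \<le> 1 / s\<^sup>2"
proof -
  have "s * q * exp (s * q) \<le> 0" using assms by (simp add: mult_le_0_iff)
  then have "s * q * exp (s * q) - exp (s * q) + 1 \<le> 1" using exp_ge_zero[of "s * q"] by linarith
  then show ?thesis unfolding curvature_def by (rule divide_right_mono) simp
qed

text \<open>On \<open>[-1, 1]\<close> the Taylor remainder costs at most
  \<open>x\<^sup>2 / 24\<close>, and 1/2 - 1/24 exceeds 1/4.\<close>

lemma one_minus_cos_ge:
  assumes "\<bar>x\<bar> \<le> (1::real)" shows "1 - cos x \<ge> x\<^sup>2 / 4"
proof -
  have "\<bar>Re (iexp x - (\<Sum>k \<le> 3. (\<i> * x)^k / fact k))\<bar> \<le> \<bar>x\<bar>^4 / 24"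
    using order_trans[OF abs_Re_le_cmod iexp_approx1[of x 3]] by (simp add: fact_numeral eval_nat_numeral)
  moreover have "Re (iexp x - (\<Sum>k \<le> 3. (\<i> * x)^k / fact k)) = cos x - (1 - x\<^sup>2 / 2)"
    by (simp add: eval_nat_numeral Re_exp power2_eq_square Re_divide_numeral)
  ultimately have "cos x \<le> 1 - x\<^sup>2 / 2 + \<bar>x\<bar>^4 / 24" by linarith
  moreover have "\<bar>x\<bar>^4 \<le> x\<^sup>2"
    using power_decreasing[of 2 4 "\<bar>x\<bar>"] assms by simp
  ultimately show ?thesis using zero_le_power2[of x] by linarith
qed

lemma Re_ein_diff_small:
  assumes s: "s > 0" and "\<bar>u * q\<bar> \<le> 1"
  shows "Re (ein_diff s u q) \<le> - (u\<^sup>2 / 4) * curvature s q"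
proof -
  have "((\<lambda>r. (u\<^sup>2 / 4) * (r * q\<^sup>2 * exp (r * s * q))) has_integral (u\<^sup>2 / 4) * curvature s q) {0<..<1}"
    by (intro has_integral_mult_right has_integral_curvature s)
  then have "(u\<^sup>2 / 4) * curvature s q \<le> - Re (ein_diff s u q)"
  proof (rule has_integral_le[OF _ has_integral_Re_ein_diff])
    fix r :: real assume r: "r \<in> {0<..<1}"
    have "\<bar>r * u * q\<bar> \<le> 1 * 1"
      using r assms(2) unfolding abs_mult mult.assoc by (intro mult_mono) auto
    then have "(r * u * q)\<^sup>2 / 4 \<le> 1 - cos (r * u * q)" by (intro one_minus_cos_ge) simp
    then have "exp (r * s * q) / r * ((r * u * q)\<^sup>2 / 4) \<le> exp (r * s * q) / r * (1 - cos (r * u * q))"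
      using r by (intro mult_left_mono) auto
    then show "(u\<^sup>2 / 4) * (r * q\<^sup>2 * exp (r * s * q)) \<le> exp (r * s * q) / r * (1 - cos (r * u * q))"
      using r by (simp add: power_mult_distrib field_simps power2_eq_square)
  qed
  then show ?thesis by simp
qed

text \<open>Replacing \<open>1 / r\<close> by \<open>1\<close> leaves integrals of exponentials. The
  oscillating one is at most \<open>(exp (s * q) + 1) / cmod w\<close>, where
  \<open>cmod w = cmod (Complex s u) * q\<close> is larger than \<open>s * q\<close> for nonzero
  \<open>u\<close>; the gap is the damping at frequency \<open>u\<close>.\<close>

lemma Re_ein_diff_large:
  assumes s: "s > 0" and q: "q > 0"
  shows "Re (ein_diff s u q) \<le> - ((exp (s * q) - 1) / (s * q) - (exp (s * q) + 1) / (cmod (Complex s u) *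
      q))"
proof -
  define w where "w = Complex s u * of_real q"
  have w: "w \<noteq> 0" "cmod w = cmod (Complex s u) * q" "Re w = s * q" using s q
      by (auto simp: w_def complex_eq_iff norm_mult)
  have "((\<lambda>r. exp (of_real r * w)) has_integral exp (of_real 1 * w) / w - exp (of_real 0 * w) / w) {0..1}"
  proof (rule fundamental_theorem_of_calculus)
    fix r :: real
    have "((\<lambda>z. exp (z * w) / w) has_field_derivative exp (of_real r * w)) (at (of_real r))"
      using w by (auto intro!: derivative_eq_intros)
    then show "((\<lambda>r. exp (of_real r * w) / w) has_vector_derivative exp (of_real r * w)) (at r within
        {0..1})"
      by (rule has_vector_derivative_real_field)
  qed simp
  then have "((\<lambda>r. exp (of_real r * w)) has_integral (exp w - 1) / w) {0<..<1}"
    by (simp add: has_integral_Icc_iff_Ioo diff_divide_distrib)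
  from has_integral_linear[OF this bounded_linear_Re]
  have 1: "((\<lambda>r. Re (exp (of_real r * w))) has_integral Re ((exp w - 1) / w)) {0<..<1}" by (simp add: o_def)
  have 2: "((\<lambda>r. exp (r * s * q)) has_integral (exp (s * q) - 1) / (s * q)) {0<..<1}"
    using has_integral_mult_right[OF has_integral_exp_linear[OF s, of q], of "1/q"] q
        by (simp add: field_simps)
  have "(exp (s * q) - 1) / (s * q) - Re ((exp w - 1) / w) \<le> - Re (ein_diff s u q)"
  proof (rule has_integral_le[OF has_integral_diff[OF 2 1] has_integral_Re_ein_diff])
    fix r :: real assume r: "r \<in> {0<..<1}"
    have "Re (exp (of_real r * w)) = exp (r * s * q) * cos (r * u * q)"
      by (simp add: w_def Re_exp mult_ac)
    then have "exp (r * s * q) - Re (exp (of_real r * w)) = exp (r * s * q) * (1 - cos (r * u * q))"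
      by (simp add: algebra_simps)
    also have "\<dots> \<le> exp (r * s * q) / r * (1 - cos (r * u * q))"
      using r by (intro mult_right_mono) (auto simp: field_simps)
    finally show "exp (r * s * q) - Re (exp (of_real r * w))
        \<le> exp (r * s * q) / r * (1 - cos (r * u * q))" .
  qed
  moreover have "Re ((exp w - 1) / w) \<le> (exp (s * q) + 1) / (cmod (Complex s u) * q)"
  proof -
    have "Re ((exp w - 1) / w) \<le> cmod (exp w - 1) / cmod w"
      using complex_Re_le_cmod[of "(exp w - 1) / w"] by (simp add: norm_divide)
    also have "\<dots> \<le> (exp (s * q) + 1) / cmod w"
      by (intro divide_right_mono order_trans[OF norm_triangle_ineq4]) (use q in \<open>simp_all add: w\<close>)
    finally show ?thesis by (simp add: w)
  qed
  ultimately show ?thesis by linarith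
qed

text \<open>Taylor expansion in \<open>r * u * q\<close> under the integral. For
  \<open>q \<ge> 0\<close> the cubic remainder gives up one factor \<open>q \<le> b\<close>, and the
  rest is curvature. For \<open>q < 0\<close> the size of \<open>q\<close> is not controlled; the
  quadratic remainder is used instead, and the curvature is at most
  \<open>1 / s\<^sup>2\<close>.\<close>

lemma ein_diff_expansion:
  assumes s: "s > 0" and q: "q \<le> b" and b: "b > 0"
  shows "cmod (ein_diff s u q - \<i> * of_real (u * ((exp (s * q) - 1) / s)) + of_real (u\<^sup>2 / 2 * curvature s
      q))
    \<le> \<bar>u\<bar> ^ 3 * b / 6 * curvature s q + u\<^sup>2 / s\<^sup>2"
proof -
  let ?f = "\<lambda>r. of_real (exp (r * s * q) / r) * (exp (\<i> * of_real (r * u * q)) - 1)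
      - \<i> * of_real (u * (q * exp (r * s * q))) + of_real (u\<^sup>2 / 2 * (r * q\<^sup>2 * exp (r * s * q)))"
  have f: "(?f has_integral ein_diff s u q - \<i> * of_real (u * ((exp (s * q) - 1) / s)) + of_real (u\<^sup>2 / 2 *
      curvature s q)) {0<..<1}"
    by (intro has_integral_add has_integral_diff has_integral_ein_diff has_integral_mult_right
        has_integral_of_real has_integral_exp_linear has_integral_curvature s)
  define c where "c = (if q \<ge> 0 then \<bar>u\<bar> ^ 3 * b / 6 else u\<^sup>2)"
  have g: "((\<lambda>r. c * (r * q\<^sup>2 * exp (r * s * q))) has_integral c * curvature s q) {0<..<1}"
    by (intro has_integral_mult_right has_integral_curvature s)
  have fg: "cmod (?f r) \<le> c * (r * q\<^sup>2 * exp (r * s * q))" if r: "r \<in> {0<..<1}" for r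
  proof -
    define \<theta> where "\<theta> = r * u * q"
    have sum: "(\<Sum>k \<le> 2. (\<i> * of_real \<theta>)^k / fact k) = 1 + \<i> * of_real \<theta> - of_real (\<theta>\<^sup>2 / 2)"
      by (simp add: eval_nat_numeral power2_eq_square field_simps)
    have "?f r = of_real (exp (r * s * q) / r) * (exp (\<i> * of_real \<theta>) - (1 + \<i> * of_real \<theta> - of_real (\<theta>\<^sup>2 /
        2)))"
      using r by (simp add: \<theta>_def field_simps power2_eq_square)
    also have "cmod \<dots> = exp (r * s * q) / r * cmod (exp (\<i> * of_real \<theta>) - (\<Sum>k
        \<le> 2. (\<i> * of_real \<theta>)^k / fact k))"
      using r unfolding sum by (simp add: norm_mult norm_divide)
    finally have eq: "cmod (?f r) = exp (r * s * q) / r * cmod (exp (\<i> * of_real \<theta>) - (\<Sum>k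
        \<le> 2. (\<i> * of_real \<theta>)^k / fact k))" .
    show ?thesis
    proof (cases "q \<ge> 0")
      case True
      have "cmod (exp (\<i> * of_real \<theta>) - (\<Sum>k \<le> 2. (\<i> * of_real \<theta>)^k / fact k)) \<le> \<bar>\<theta>\<bar> ^ 3 / 6"
        using iexp_approx1[of \<theta> 2] by (simp add: eval_nat_numeral)
      also have "\<dots> = (r\<^sup>2 * q\<^sup>2) * (\<bar>u\<bar> ^ 3 / 6) * (r * q)"
        using r True by (simp add: \<theta>_def abs_mult power_mult_distrib eval_nat_numeral)
      also have "\<dots> \<le> (r\<^sup>2 * q\<^sup>2) * (\<bar>u\<bar> ^ 3 / 6) * (1 * b)"
        using r True q by (intro mult_left_mono mult_mono) auto
      also have "\<dots> = r\<^sup>2 * q\<^sup>2 * c" using True by (simp add: c_def)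
      finally have "cmod (?f r) \<le> exp (r * s * q) / r * (r\<^sup>2 * q\<^sup>2 * c)"
        unfolding eq using r by (intro mult_left_mono) auto
      then show ?thesis using r by (simp add: power2_eq_square mult_ac)
    next
      case False
      have "cmod (exp (\<i> * of_real \<theta>) - (\<Sum>k \<le> 2. (\<i> * of_real \<theta>)^k / fact k)) \<le> \<theta>\<^sup>2"
        using iexp_approx2[of \<theta> 2] by (simp add: eval_nat_numeral)
      then have "cmod (?f r) \<le> exp (r * s * q) / r * \<theta>\<^sup>2"
        unfolding eq using r by (intro mult_left_mono) auto
      then show ?thesis using r False by (simp add: \<theta>_def c_def power2_eq_square mult_ac)
    qed
  qed
  have "cmod (ein_diff s u q - \<i> * of_real (u * ((exp (s * q) - 1) / s)) + of_real (u\<^sup>2 / 2 * curvature s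
      q)) \<le> c * curvature s q"
    using integral_norm_bound_integral[OF has_integral_integrable[OF f] has_integral_integrable[OF g] fg]
    by (simp only: integral_unique[OF f] integral_unique[OF g])
  also have "\<dots> \<le> \<bar>u\<bar> ^ 3 * b / 6 * curvature s q + u\<^sup>2 / s\<^sup>2"
  proof (cases "q \<ge> 0")
    case False
    then have "u\<^sup>2 * curvature s q \<le> u\<^sup>2 * (1 / s\<^sup>2)" using s
        by (intro mult_left_mono curvature_neg_le) auto
    moreover have "0 \<le> \<bar>u\<bar> ^ 3 * b / 6 * curvature s q" using b curvature_nonneg[OF s] by simp
    ultimately show ?thesis using False by (simp add: c_def)
  qed (simp add: c_def)
  finally show ?thesis .
qed

context perpetuity_laws begin

text \<open>\<open>tilt s\<close> and \<open>variance_rate s\<close> are the first two derivatives of \<open>\<psi>\<^sub>\<alpha>\<close>, that is, mean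
    and variance of the tilted law of \<open>X\<close>.\<close>

definition tilt :: "real \<Rightarrow> real" where "tilt s = \<alpha> * (mgf_F s - 1) / s"

definition tilted_cf :: "real \<Rightarrow> real \<Rightarrow> complex" where
  "tilted_cf s u = cmgf \<mu> (Complex s u) / of_real (mgf_\<mu> s)"

definition variance_rate :: "real \<Rightarrow> real" where
  "variance_rate s = \<alpha> * (\<integral>q. curvature s q \<partial>F)"

section \<open>Growth of \<open>mgf_F\<close> and \<open>tilt\<close>\<close>

lemma mgf_F_lower:
  assumes "s \<ge> 0" shows "measure F {x..} * exp (s * x) \<le> mgf_F s"
proof -
  have "measure F {x..} * exp (s * x) = (\<integral>q. indicator {x..} q * exp (s * x) \<partial>F)"
    by (simp add: sets_F)
  also have "\<dots> \<le> mgf_F s" unfolding mgf_F_def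
  proof (intro integral_mono F.exp_moment assms)
    show "integrable F (\<lambda>q. indicator {x..} q * exp (s * x))"
      by (rule F.integrable_const_bound[where B="exp (s * x)"]) (auto simp: indicator_def intro!: AE_I2)
  qed (use assms in \<open>auto simp: indicator_def mult_left_mono\<close>)
  finally show ?thesis .
qed

lemma mgf_F_pos: "s \<ge> 0 \<Longrightarrow> mgf_F s > 0"
  using mgf_F_lower[of s 0] mass_near_b[OF b_pos] by simp

lemma mgf_\<mu>_pos: "s > 0 \<Longrightarrow> mgf_\<mu> s > 0"
  by (simp add: mgf_\<mu>_eq_exp)

lemma abs_mult_exp_le:
  assumes "s > 0" "q \<le> b" shows "\<bar>q\<bar> * exp (s * q) \<le> b * exp (s * b) + 1 / s"
proof (cases "q \<ge> 0")
  case True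
  then have "\<bar>q\<bar> * exp (s * q) \<le> b * exp (s * b)" using assms by (intro mult_mono) auto
  then show ?thesis using assms by (simp add: add_increasing2)
next
  case False
  have "- (s * q) \<le> exp (- (s * q))" using exp_ge_add_one_self[of "- (s * q)"] by linarith
  then have "- (s * q) * exp (s * q) \<le> exp (- (s * q)) * exp (s * q)" by (rule mult_right_mono) simp
  then have "s * (\<bar>q\<bar> * exp (s * q)) \<le> 1" using False by (simp add: exp_minus mult_ac)
  then have "\<bar>q\<bar> * exp (s * q) \<le> 1 / s" using assms by (simp add: field_simps)
  then show ?thesis using b_pos by (simp add: add_increasing)
qed

lemma integrable_mult_exp:
  assumes "s > 0" shows "integrable F (\<lambda>q. q * exp (s * q))"
proof (rule F.integrable_const_bound)
  show "AE q in F. norm (q * exp (s * q)) \<le> b * exp (s * b) + 1 / s"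
    using AE_le_b by eventually_elim (use assms abs_mult_exp_le in \<open>simp add: abs_mult\<close>)
qed simp

lemma integrable_curvature: "s > 0 \<Longrightarrow> integrable F (\<lambda>q. curvature s q)"
  unfolding curvature_def mult.assoc
  by (intro integrable_divide_zero Bochner_Integration.integrable_diff Bochner_Integration.integrable_add
      integrable_mult_right integrable_mult_exp F.exp_moment impI) auto

lemma variance_rate_eq:
  assumes s: "s > 0"
  shows "variance_rate s = \<alpha> * (\<integral>q. q * exp (s * q) \<partial>F) / s - tilt s / s"
proof -
  have "(\<integral>q. curvature s q \<partial>F) = (s * (\<integral>q. q * exp (s * q) \<partial>F) - mgf_F s + 1) / s\<^sup>2"
    using s integrable_mult_exp[OF s] F.exp_moment[of s]
    unfolding curvature_def mult.assoc mgf_F_def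
    by (simp add: F.prob_space[simplified])
  then show ?thesis using s unfolding variance_rate_def tilt_def
    by (simp only:) (simp add: field_simps power2_eq_square)
qed

lemma integral_exp_quotient:
  assumes "s > 0" shows "\<alpha> * (\<integral>q. (exp (s * q) - 1) / s \<partial>F) = tilt s"
  using assms F.exp_moment[of s] unfolding tilt_def mgf_F_def
  by (subst integral_divide_zero, subst Bochner_Integration.integral_diff) (auto simp:
      F.prob_space[simplified])

lemma integrable_ein_diff: "s > 0 \<Longrightarrow> integrable F (\<lambda>q. ein_diff s u q)"
  unfolding ein_diff_def by (intro Bochner_Integration.integrable_diff integrable_ein) auto

lemma tilted_cf_eq:
  assumes s: "s > 0"
  shows "tilted_cf s u = exp (of_real \<alpha> * (\<integral>q. ein_diff s u q \<partial>F))"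
proof -
  have "of_real (mgf_\<mu> s) = exp (of_real \<alpha> * (\<integral>q. ein (of_real s * of_real q) \<partial>F))"
    using cmgf_\<mu>_eq_exp_ein[of "of_real s"] \<mu>.cmgf_of_real[of s] s by (simp add: mgf_\<mu>_def)
  then show ?thesis
    unfolding tilted_cf_def ein_diff_def using s cmgf_\<mu>_eq_exp_ein[of "Complex s u"]
    by (subst Bochner_Integration.integral_diff) (auto intro!: integrable_ein simp: exp_diff[symmetric]
        right_diff_distrib)
qed

lemma norm_tilted_cf:
  assumes s: "s > 0"
  shows "cmod (tilted_cf s u) = exp (\<alpha> * (\<integral>q. Re (ein_diff s u q) \<partial>F))"
  using integrable_ein_diff[OF s, of u] by (simp add: tilted_cf_eq[OF s])

text \<open>\<open>mgf_F s\<close> is at least P{Q \<ge> b/2} exp(s b/2), so every power of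
  \<open>s\<close> is beaten. The exponent \<open>4\<close> is the one that yields
  \<open>s\<^sup>2 \<le> sqrt (tilt s)\<close> in \<open>kernel_error_tendsto_0\<close>.\<close>

lemma filterlim_tilt: "filterlim (\<lambda>s. tilt s / s ^ 4) at_top at_top"
proof -
  define m where "m = measure F {b/2..}"
  have m: "m > 0" using mass_near_b[of "b/2"] b_pos by (simp add: m_def)
  have "filterlim (\<lambda>s. \<alpha> * (m * exp (s * (b / 2)) - 1) / s / s ^ 4) at_top at_top"
    using m b_pos \<alpha>_pos by real_asymp
  moreover have "eventually (\<lambda>s. \<alpha> * (m * exp (s * (b / 2)) - 1) / s / s ^ 4 \<le> tilt s / s ^ 4) at_top"
    using eventually_gt_at_top[of 0]
  proof eventually_elim
    fix s :: real assume s: "0 < s"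
    show "\<alpha> * (m * exp (s * (b / 2)) - 1) / s / s ^ 4 \<le> tilt s / s ^ 4"
      unfolding tilt_def m_def using s \<alpha>_pos mgf_F_lower[of s "b/2"]
      by (intro divide_right_mono mult_left_mono) auto
  qed
  ultimately show ?thesis by (rule filterlim_at_top_mono)
qed

lemma tilt_ge_power: "eventually (\<lambda>s. tilt s \<ge> C * s ^ 4) at_top"
proof -
  have "eventually (\<lambda>s. tilt s / s ^ 4 \<ge> C) at_top"
    using filterlim_tilt by (simp add: filterlim_at_top)
  then show ?thesis using eventually_gt_at_top[of 0]
    by eventually_elim (simp add: field_simps)
qed

lemma filterlim_tilt_at_top: "filterlim tilt at_top at_top"
proof (rule filterlim_at_top_mono)
  show "filterlim (\<lambda>s::real. 1 * s ^ 4) at_top at_top" by real_asymp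
  show "eventually (\<lambda>s. 1 * s ^ 4 \<le> tilt s) at_top" by (rule tilt_ge_power)
qed

lemma filterlim_mgf_F: "filterlim mgf_F at_top at_top"
proof (rule filterlim_at_top_mono)
  have "measure F {b/2..} > 0" using mass_near_b[of "b/2"] b_pos by simp
  then show "filterlim (\<lambda>s::real. measure F {b/2..} * exp (s * (b/2))) at_top at_top"
    using b_pos by real_asymp
  show "eventually (\<lambda>s. measure F {b/2..} * exp (s * (b/2)) \<le> mgf_F s) at_top"
    using eventually_ge_at_top[of 0] by eventually_elim (rule mgf_F_lower)
qed

text \<open>Under the tilted law \<open>Q\<close> concentrates at its essential supremum. In the
  mean of \<open>b - Q\<close>, values within \<open>\<epsilon>\<close> of \<open>b\<close>
  contribute at most \<open>\<epsilon>\<close>; the others contribute at most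
  \<open>\<epsilon> * exp (s * (b - \<epsilon>))\<close> before normalisation, which the mass above
  \<open>b - \<epsilon>/2\<close> outweighs.\<close>

lemma tilted_mean_F: "((\<lambda>s. (\<integral>q. q * exp (s * q) \<partial>F) / mgf_F s) \<longlongrightarrow> b) at_top"
proof (rule tendstoI)
  fix e :: real assume "e > 0"
  define \<epsilon> where "\<epsilon> = min (e / 4) (b / 2)"
  have \<epsilon>: "\<epsilon> > 0" "\<epsilon> < b" "2 * \<epsilon> < e" using \<open>e > 0\<close> b_pos by (auto simp: \<epsilon>_def)
  define m where "m = measure F {b - \<epsilon>/2..}"
  have m: "m > 0" using mass_near_b[of "b - \<epsilon>/2"] \<epsilon> by (simp add: m_def)
  have "eventually (\<lambda>s. exp (s * (b - \<epsilon>)) \<le> m * exp (s * (b - \<epsilon>/2))) at_top"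
  proof -
    have "eventually (\<lambda>s. 1 \<le> m * exp (s * (\<epsilon>/2))) at_top" using m \<epsilon> by real_asymp
    then show ?thesis
    proof eventually_elim
      fix s assume "1 \<le> m * exp (s * (\<epsilon>/2))"
      then have "exp (s * (b - \<epsilon>)) * 1 \<le> exp (s * (b - \<epsilon>)) * (m * exp (s * (\<epsilon>/2)))"
          by (intro mult_left_mono) auto
      also have "\<dots> = m * exp (s * (b - \<epsilon>) + s * (\<epsilon>/2))" by (simp add: exp_add)
      also have "s * (b - \<epsilon>) + s * (\<epsilon>/2) = s * (b - \<epsilon>/2)" by (simp add: field_simps)
      finally show "exp (s * (b - \<epsilon>)) \<le> m * exp (s * (b - \<epsilon>/2))" by simp
    qed
  qed
  then show "eventually (\<lambda>s. dist ((\<integral>q. q * exp (s * q) \<partial>F) / mgf_F s) b < e) at_top"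
    using eventually_ge_at_top[of "1 / \<epsilon>"]
  proof eventually_elim
    fix s assume le: "exp (s * (b - \<epsilon>)) \<le> m * exp (s * (b - \<epsilon>/2))" and s\<epsilon>: "s \<ge> 1 / \<epsilon>"
    have s: "s > 0" using s\<epsilon> \<epsilon> by (smt (verit) divide_pos_pos)
    have s1: "s * \<epsilon> \<ge> 1" using s\<epsilon> \<epsilon> by (simp add: field_simps)
    note g = mgf_F_pos[OF less_imp_le[OF s]]
    have int: "integrable F (\<lambda>q. (b - q) * exp (s * q))"
      using integrable_mult_exp[OF s] F.exp_moment[of s] s by (simp add: left_diff_distrib)
    have eq: "(\<integral>q. (b - q) * exp (s * q) \<partial>F) = b * mgf_F s - (\<integral>q. q * exp (s * q) \<partial>F)"
      using integrable_mult_exp[OF s] F.exp_moment[of s] s by (simp add: left_diff_distrib mgf_F_def)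
    have "(\<integral>q. (b - q) * exp (s * q) \<partial>F) \<le> (\<integral>q. \<epsilon> * exp (s * q) + \<epsilon> * exp (s * (b - \<epsilon>)) \<partial>F)"
    proof (intro integral_mono_AE int)
      show "integrable F (\<lambda>q. \<epsilon> * exp (s * q) + \<epsilon> * exp (s * (b - \<epsilon>)))" using F.exp_moment[of s] s by simp
      show "AE q in F. (b - q) * exp (s * q) \<le> \<epsilon> * exp (s * q) + \<epsilon> * exp (s * (b - \<epsilon>))"
        using AE_le_b
      proof eventually_elim
        fix q assume q: "q \<le> b"
        show "(b - q) * exp (s * q) \<le> \<epsilon> * exp (s * q) + \<epsilon> * exp (s * (b - \<epsilon>))"
        proof (cases "b - q \<le> \<epsilon>")
          case True
          then have "(b - q) * exp (s * q) \<le> \<epsilon> * exp (s * q)" by (intro mult_right_mono) auto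
          then show ?thesis using \<epsilon> by (simp add: add_increasing2)
        next
          case False
          \<comment> \<open>With \<open>s * \<epsilon> \<ge> 1\<close> the linear factor
            \<open>b - q\<close> is absorbed by an exponential through
            \<open>1 + y \<le> exp y\<close>.\<close>
          have "b - q = \<epsilon> + 1 * (b - q - \<epsilon>)" by simp
          also have "\<dots> \<le> \<epsilon> + (s * \<epsilon>) * (b - q - \<epsilon>)" using s1 False
              by (intro add_left_mono mult_right_mono) auto
          also have "\<dots> = \<epsilon> * (1 + s * (b - q - \<epsilon>))" by (simp add: algebra_simps)
          also have "\<dots> \<le> \<epsilon> * exp (s * (b - q - \<epsilon>))" using \<epsilon>
              by (intro mult_left_mono exp_ge_add_one_self) auto
          finally have "(b - q) * exp (s * q) \<le> \<epsilon> * exp (s * (b - q - \<epsilon>)) * exp (s * q)"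
              by (rule mult_right_mono) simp
          also have "\<dots> = \<epsilon> * exp (s * (b - \<epsilon>))" by (simp add: exp_add[symmetric] algebra_simps)
          finally show ?thesis using \<epsilon> by (simp add: add_increasing)
        qed
      qed
    qed
    also have "\<dots> = \<epsilon> * mgf_F s + \<epsilon> * exp (s * (b - \<epsilon>))"
      using F.exp_moment[of s] s by (simp add: mgf_F_def F.prob_space[simplified])
    also have "exp (s * (b - \<epsilon>)) \<le> mgf_F s"
      using le mgf_F_lower[of s "b - \<epsilon>/2"] s by (simp add: m_def)
    finally have up: "b * mgf_F s - (\<integral>q. q * exp (s * q) \<partial>F) \<le> 2 * \<epsilon> * mgf_F s"
      using \<epsilon> unfolding eq by simp
    have "(\<integral>q. (b - q) * exp (s * q) \<partial>F) \<ge> 0"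
      using AE_le_b by (intro integral_nonneg_AE) auto
    then have lo: "b * mgf_F s - (\<integral>q. q * exp (s * q) \<partial>F) \<ge> 0" unfolding eq .
    have "b - (\<integral>q. q * exp (s * q) \<partial>F) / mgf_F s \<le> 2 * \<epsilon>" "b - (\<integral>q. q * exp (s * q) \<partial>F) / mgf_F s \<ge> 0"
      using up lo g by (auto simp: field_simps)
    then show "dist ((\<integral>q. q * exp (s * q) \<partial>F) / mgf_F s) b < e"
      using \<epsilon> by (simp add: dist_real_def)
  qed
qed

text \<open>By \<open>variance_rate_eq\<close> the quotient is the tilted mean of \<open>Q\<close>,
  up to the factor \<open>mgf_F s / (mgf_F s - 1)\<close>, minus \<open>1 / s\<close>. This limit is
  the source of \<open>b\<close> under the square root in the theorem.\<close>

lemma variance_rate_over_tilt: "((\<lambda>s. variance_rate s / tilt s) \<longlongrightarrow> b) at_top"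
proof -
  have 1: "((\<lambda>s. mgf_F s / (mgf_F s - 1)) \<longlongrightarrow> 1) at_top"
  proof -
    have "((\<lambda>x::real. x / (x - 1)) \<longlongrightarrow> 1) at_top" by real_asymp
    from filterlim_compose[OF this filterlim_mgf_F] show ?thesis .
  qed
  have 2: "((\<lambda>s::real. 1 / s) \<longlongrightarrow> 0) at_top" by real_asymp
  have "((\<lambda>s. (\<integral>q. q * exp (s * q) \<partial>F) / mgf_F s * (mgf_F s / (mgf_F s - 1)) - 1 / s) \<longlongrightarrow> b * 1 - 0) at_top"
    by (intro tendsto_intros tilted_mean_F 1 2)
  moreover have "eventually (\<lambda>s. (\<integral>q. q * exp (s * q) \<partial>F) / mgf_F s * (mgf_F s / (mgf_F s - 1)) - 1 / s
      = variance_rate s / tilt s) at_top"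
    using eventually_gt_at_top[of 0] filterlim_mgf_F[unfolded filterlim_at_top_dense, rule_format, of 1]
  proof eventually_elim
    fix s :: real assume s: "0 < s" and g: "1 < mgf_F s"
    then have "tilt s > 0" using \<alpha>_pos by (simp add: tilt_def)
    then show "(\<integral>q. q * exp (s * q) \<partial>F) / mgf_F s * (mgf_F s / (mgf_F s - 1)) - 1 / s
        = variance_rate s / tilt s"
      unfolding variance_rate_eq[OF s] diff_divide_distrib using s g \<alpha>_pos by (simp add: tilt_def)
  qed
  ultimately show ?thesis using tendsto_cong by force
qed

text \<open>The range \<open>\<bar>u\<bar> \<le> 1 / b\<close> gives
  \<open>\<bar>u * q\<bar> \<le> 1\<close> for \<open>0 \<le> q \<le> b\<close>. For negative
  \<open>q\<close> the contribution is dropped: subtracting \<open>1 / s\<^sup>2\<close> from the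
  curvature makes a common bound valid for all \<open>q\<close>. The loss
  \<open>\<alpha> / s\<^sup>2\<close> is at most half of the eventual lower bound
  \<open>b / 2 * tilt s\<close> of the variance; the remaining \<open>b / 4\<close>, times the 1/4
  of \<open>one_minus_cos_ge\<close>, is the constant \<open>b / 16\<close>.\<close>

lemma tilted_cf_small:
  "eventually (\<lambda>s. \<forall>u. \<bar>u\<bar> \<le> 1 / b \<longrightarrow> cmod (tilted_cf s u) \<le> exp (- (b / 16 * tilt s * u\<^sup>2))) at_top"
proof -
  have "eventually (\<lambda>s. variance_rate s / tilt s > b / 2) at_top"
    using order_tendstoD(1)[OF variance_rate_over_tilt, of "b/2"] b_pos by simp
  moreover have "eventually (\<lambda>s. tilt s \<ge> (4 * \<alpha> / b) * s ^ 4) at_top" by (rule tilt_ge_power)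
  ultimately show ?thesis using eventually_ge_at_top[of 1]
  proof (eventually_elim, intro allI impI)
    fix s u assume A: "variance_rate s / tilt s > b / 2" and t: "tilt s \<ge> (4 * \<alpha> / b) * s ^ 4"
        and s1: "s \<ge> 1" and u: "\<bar>u\<bar> \<le> 1 / b"
    have s: "s > 0" using s1 by simp
    have tpos: "tilt s > 0" using less_le_trans[OF _ t] \<alpha>_pos b_pos s by simp
    have A': "variance_rate s \<ge> b / 2 * tilt s" using A tpos by (simp add: field_simps)
    have "4 * \<alpha> / b * 1 \<le> 4 * \<alpha> / b * s ^ 4" using s1 \<alpha>_pos b_pos by (intro mult_left_mono) auto
    then have "4 * \<alpha> / b \<le> tilt s" using t by simp
    then have "\<alpha> \<le> b / 4 * tilt s" using b_pos by (simp add: field_simps)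
    moreover have "\<alpha> / s\<^sup>2 \<le> \<alpha> / 1" using s1 \<alpha>_pos by (intro divide_left_mono) auto
    ultimately have \<alpha>s: "\<alpha> / s\<^sup>2 \<le> b / 4 * tilt s" by (metis div_by_1 order_trans)
    have "(\<integral>q. Re (ein_diff s u q) \<partial>F) \<le> (\<integral>q. - (u\<^sup>2 / 4) * (curvature s q - 1 / s\<^sup>2) \<partial>F)"
    proof (rule integral_mono_AE)
      show "integrable F (\<lambda>q. Re (ein_diff s u q))" using integrable_ein_diff[OF s] by (rule integrable_Re)
      show "integrable F (\<lambda>q. - (u\<^sup>2 / 4) * (curvature s q - 1 / s\<^sup>2))"
        using integrable_curvature[OF s] by simp
      show "AE q in F. Re (ein_diff s u q) \<le> - (u\<^sup>2 / 4) * (curvature s q - 1 / s\<^sup>2)"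
        using AE_le_b
      proof eventually_elim
        fix q assume q: "q \<le> b"
        show "Re (ein_diff s u q) \<le> - (u\<^sup>2 / 4) * (curvature s q - 1 / s\<^sup>2)"
        proof (cases "q \<ge> 0")
          case True
          then have "\<bar>u * q\<bar> \<le> 1 / b * b" unfolding abs_mult using u q b_pos by (intro mult_mono) auto
          then have "Re (ein_diff s u q) \<le> - (u\<^sup>2 / 4) * curvature s q"
            using b_pos by (intro Re_ein_diff_small s) auto
          also have "\<dots> \<le> - (u\<^sup>2 / 4) * (curvature s q - 1 / s\<^sup>2)" by (simp add: right_diff_distrib)
          finally show ?thesis .
        next
          case False
          then have "curvature s q - 1 / s\<^sup>2 \<le> 0" using curvature_neg_le[OF s] by simp
          then have "0 \<le> - (u\<^sup>2 / 4) * (curvature s q - 1 / s\<^sup>2)" by (simp add: mult_nonneg_nonpos)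
          then show ?thesis using Re_ein_diff_nonpos[of s u q] by linarith
        qed
      qed
    qed
    also have "\<dots> = - (u\<^sup>2 / 4) * ((\<integral>q. curvature s q \<partial>F) - 1 / s\<^sup>2)"
      using integrable_curvature[OF s] by (simp add: F.prob_space[simplified])
    finally have "\<alpha> * (\<integral>q. Re (ein_diff s u q) \<partial>F) \<le> \<alpha> * (- (u\<^sup>2 / 4) * ((\<integral>q. curvature s q \<partial>F) - 1 / s\<^sup>2))"
      using \<alpha>_pos by (intro mult_left_mono) auto
    also have "\<dots> = - (u\<^sup>2 / 4) * (variance_rate s - \<alpha> / s\<^sup>2)"
      by (simp add: variance_rate_def algebra_simps)
    also have "\<dots> \<le> - (u\<^sup>2 / 4) * (b / 4 * tilt s)"
      using A' \<alpha>s by (intro mult_left_mono_neg) auto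
    finally show "cmod (tilted_cf s u) \<le> exp (- (b / 16 * tilt s * u\<^sup>2))"
      unfolding norm_tilted_cf[OF s] by (simp add: algebra_simps)
  qed
qed

text \<open>For \<open>\<bar>u\<bar> \<ge> 1 / b\<close> the ratio
  \<open>s / cmod (Complex s u)\<close> stays below \<open>1\<close> by an amount of order
  \<open>1 / s\<^sup>2\<close>, and this relative gain multiplies the full size of
  \<open>tilt s\<close>. The bound does not decay in \<open>u\<close>, so the Gaussian smoothing has
  to supply integrability.\<close>

lemma tilted_cf_large:
  obtains \<kappa> C :: real where "\<kappa> > 0" "C > 0"
    "eventually (\<lambda>s. \<forall>u. \<bar>u\<bar> \<ge> 1 / b \<longrightarrow> cmod (tilted_cf s u) \<le> C * exp (- (\<kappa> * tilt s / s\<^sup>2))) at_top"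
proof
  define \<beta> where "\<beta> = (1 / b)\<^sup>2"
  have \<beta>: "\<beta> > 0" using b_pos by (simp add: \<beta>_def)
  \<comment> \<open>\<open>s / sqrt (s\<^sup>2 + \<beta>)\<close> behaves like
    \<open>1 - \<beta> / (2 * s\<^sup>2)\<close>; half of that coefficient leaves room for the
    remainder.\<close>
  define \<kappa>0 where "\<kappa>0 = \<beta> / 4"
  show "\<kappa>0 / b > 0" "exp (2 * \<alpha> / b) > 0" using \<beta> b_pos by (auto simp: \<kappa>0_def)
  have "eventually (\<lambda>s. s / sqrt (s\<^sup>2 + \<beta>) \<le> 1 - \<kappa>0 / s\<^sup>2) at_top"
    using \<beta> unfolding \<kappa>0_def by real_asymp
  then show "eventually (\<lambda>s. \<forall>u. \<bar>u\<bar> \<ge> 1 / b \<longrightarrow> cmod (tilted_cf s u)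
      \<le> exp (2 * \<alpha> / b) * exp (- (\<kappa>0 / b * tilt s / s\<^sup>2))) at_top"
    using eventually_ge_at_top[of 1]
  proof (eventually_elim, intro allI impI)
    fix s u assume \<rho>: "s / sqrt (s\<^sup>2 + \<beta>) \<le> 1 - \<kappa>0 / s\<^sup>2" and s1: "s \<ge> 1" and u: "\<bar>u\<bar> \<ge> 1 / b"
    have s: "s > 0" using s1 by simp
    have cm: "cmod (Complex s u) \<ge> sqrt (s\<^sup>2 + \<beta>)"
    proof -
      have "(1 / b)\<^sup>2 \<le> \<bar>u\<bar>\<^sup>2" using u b_pos by (intro power_mono) auto
      then show ?thesis by (simp add: \<beta>_def cmod_def)
    qed
    have sq: "sqrt (s\<^sup>2 + \<beta>) > 0" using s \<beta> by (simp add: add_pos_pos)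
    have "s / cmod (Complex s u) \<le> s / sqrt (s\<^sup>2 + \<beta>)" using cm sq s less_le_trans[OF sq cm]
        by (intro divide_left_mono mult_pos_pos) auto
    with \<rho> have \<rho>': "s / cmod (Complex s u) \<le> 1 - \<kappa>0 / s\<^sup>2" by simp
    have \<rho>1: "s / cmod (Complex s u) \<le> 1"
      using complex_Re_le_cmod[of "Complex s u"] s by (simp add: divide_le_eq_1)
    have "(\<integral>q. Re (ein_diff s u q) \<partial>F) \<le> (\<integral>q. - ((\<kappa>0 / s\<^sup>2) * exp (s * q) - 2) / (s * b) \<partial>F)"
    proof (rule integral_mono_AE)
      show "integrable F (\<lambda>q. Re (ein_diff s u q))" using integrable_ein_diff[OF s] by (rule integrable_Re)
      show "integrable F (\<lambda>q. - ((\<kappa>0 / s\<^sup>2) * exp (s * q) - 2) / (s * b))"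
        using F.exp_moment[of s] s by simp
      show "AE q in F. Re (ein_diff s u q) \<le> - ((\<kappa>0 / s\<^sup>2) * exp (s * q) - 2) / (s * b)"
        using AE_le_b
      proof eventually_elim
        fix q assume q: "q \<le> b"
        \<comment> \<open>Only \<open>X > 0\<close> calls for an argument, since the real part is
          never positive. It forces \<open>q > 0\<close>, and then \<open>q \<le> b\<close> allows
          the denominator \<open>s * q\<close> to be replaced by \<open>s * b\<close>.\<close>
        define X where "X = (\<kappa>0 / s\<^sup>2) * exp (s * q) - 2"
        show "Re (ein_diff s u q) \<le> - ((\<kappa>0 / s\<^sup>2) * exp (s * q) - 2) / (s * b)"
        proof (cases "X \<le> 0")
          case True
          then have "0 \<le> - X / (s * b)" using s b_pos by (intro divide_nonneg_nonneg) auto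
          then show ?thesis using Re_ein_diff_nonpos[of s u q] unfolding X_def by linarith
        next
          case False
          have qpos: "q > 0"
          proof (rule ccontr)
            assume "\<not> q > 0"
            then have "exp (s * q) \<le> 1" using s by (simp add: mult_le_0_iff)
            moreover have "\<kappa>0 / s\<^sup>2 \<le> 1" using \<rho>' s by (smt (verit) divide_nonneg_nonneg norm_ge_zero)
            ultimately have "(\<kappa>0 / s\<^sup>2) * exp (s * q) \<le> 1 * 1" using \<beta>
                by (intro mult_mono) (auto simp: \<kappa>0_def)
            then show False using False by (simp add: X_def)
          qed
          have "X \<le> (exp (s * q) - 1) - s / cmod (Complex s u) * (exp (s * q) + 1)"
          proof -
            have "s / cmod (Complex s u) * exp (s * q) \<le> (1 - \<kappa>0 / s\<^sup>2) * exp (s * q)"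
              using \<rho>' by (rule mult_right_mono) simp
            moreover have "k * y - 2 \<le> (y - 1) - r * (y + 1)" if "r * y \<le> (1 - k) * y" "r
                \<le> 1" for r k y :: real
              using that by (simp add: algebra_simps)
            ultimately show ?thesis using \<rho>1 unfolding X_def by blast
          qed
          then have "X / (s * q) \<le> ((exp (s * q) - 1) - s / cmod (Complex s u) * (exp (s * q) + 1)) / (s *
              q)"
            using s qpos by (intro divide_right_mono) auto
          also have "\<dots> = (exp (s * q) - 1) / (s * q) - (exp (s * q) + 1) / (cmod (Complex s u) * q)"
            using s qpos by (simp add: diff_divide_distrib)
          also have "\<dots> \<le> - Re (ein_diff s u q)"
            using Re_ein_diff_large[OF s qpos, of u] by linarith
          finally have "Re (ein_diff s u q) \<le> - (X / (s * q))" by simp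
          moreover have "X / (s * b) \<le> X / (s * q)"
            using False q qpos s by (intro divide_left_mono) auto
          ultimately show ?thesis unfolding X_def[symmetric] by simp
        qed
      qed
    qed
    also have "\<dots> = - ((\<kappa>0 / s\<^sup>2) * mgf_F s - 2) / (s * b)"
      using F.exp_moment[of s] s unfolding mgf_F_def by (simp add: F.prob_space[simplified])
    also have "\<dots> \<le> - ((\<kappa>0 / s\<^sup>2) * (mgf_F s - 1) - 2) / (s * b)"
      using s b_pos \<beta> by (intro divide_right_mono) (auto simp: \<kappa>0_def field_simps)
    finally have "\<alpha> * (\<integral>q. Re (ein_diff s u q) \<partial>F) \<le> \<alpha> * (- ((\<kappa>0 / s\<^sup>2) * (mgf_F s - 1) - 2) / (s * b))"
      using \<alpha>_pos by (intro mult_left_mono) auto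
    also have "\<dots> = 2 * \<alpha> / b * (1 / s) - \<kappa>0 / b * tilt s / s\<^sup>2"
      using s b_pos by (simp add: tilt_def field_simps)
    also have "\<dots> \<le> 2 * \<alpha> / b * 1 - \<kappa>0 / b * tilt s / s\<^sup>2"
      using s1 \<alpha>_pos b_pos by (intro diff_right_mono mult_left_mono) (auto simp: field_simps)
    finally show "cmod (tilted_cf s u) \<le> exp (2 * \<alpha> / b) * exp (- (\<kappa>0 / b * tilt s / s\<^sup>2))"
      unfolding norm_tilted_cf[OF s] exp_add[symmetric] by simp
  qed
qed

text \<open>Put \<open>u = v / sqrt (tilt s)\<close> in \<open>ein_diff_expansion\<close> and
  integrate over \<open>F\<close>. The linear term becomes the phase
  \<open>v * sqrt (tilt s)\<close> and cancels against the recentring, the quadratic term tends to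
  \<open>b * v\<^sup>2 / 2\<close> by \<open>variance_rate_over_tilt\<close>, and both remainders
  vanish as \<open>tilt s\<close> grows.\<close>

lemma tilted_cf_limit:
  "((\<lambda>s. tilted_cf s (v / sqrt (tilt s)) * exp (- (\<i> * of_real (v * sqrt (tilt s)))))
      \<longlongrightarrow> of_real (exp (- (b * v\<^sup>2 / 2)))) at_top"
proof -
  define E where "E = (\<lambda>s. of_real \<alpha> * (\<integral>q. ein_diff s (v / sqrt (tilt s)) q \<partial>F) - \<i> * of_real (v * sqrt
      (tilt s)))"
  define R where "R = (\<lambda>s. variance_rate s / tilt s)"
  have R: "(R \<longlongrightarrow> b) at_top" unfolding R_def by (rule variance_rate_over_tilt)
  have bound: "eventually (\<lambda>s. cmod (E s + of_real (v\<^sup>2 / 2 * R s))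
      \<le> \<bar>v\<bar> ^ 3 * b / 6 * R s / sqrt (tilt s) + \<alpha> * v\<^sup>2 / (tilt s * s\<^sup>2)) at_top"
    using eventually_gt_at_top[of 0] filterlim_tilt_at_top[unfolded filterlim_at_top_dense, rule_format, of
        0]
  proof eventually_elim
    fix s assume s: "s > 0" and t: "tilt s > 0"
    define u where "u = v / sqrt (tilt s)"
    let ?X = "\<lambda>q. ein_diff s u q - \<i> * of_real (u * ((exp (s * q) - 1) / s)) + of_real (u\<^sup>2 / 2 * curvature
        s q)"
    have int: "integrable F (\<lambda>q. ein_diff s u q)" "integrable F (\<lambda>q. (exp (s * q) - 1) / s)" "integrable F
        (\<lambda>q. curvature s q)"
      using s F.exp_moment[of s] by (simp_all add: integrable_ein_diff integrable_curvature)
    have u2: "u\<^sup>2 = v\<^sup>2 / tilt s" using t by (simp add: u_def power_divide)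
    have "of_real \<alpha> * (\<integral>q. ?X q \<partial>F) = of_real \<alpha> * (\<integral>q. ein_diff s u q \<partial>F)
        - \<i> * of_real (u * (\<alpha> * (\<integral>q. (exp (s * q) - 1) / s \<partial>F))) + of_real (u\<^sup>2 / 2 * variance_rate s)"
    proof -
      have i1: "(\<integral>q. \<i> * complex_of_real (u * ((exp (s * q) - 1) / s)) \<partial>F)
          = \<i> * of_real (u * (\<integral>q. (exp (s * q) - 1) / s \<partial>F))"
        by (simp only: integral_mult_right_zero integral_complex_of_real)
      have i2: "(\<integral>q. complex_of_real (u\<^sup>2 / 2 * curvature s q) \<partial>F)
          = of_real (u\<^sup>2 / 2 * (\<integral>q. curvature s q \<partial>F))"
        by (simp only: integral_mult_right_zero integral_complex_of_real)
      have j: "integrable F (\<lambda>q. \<i> * complex_of_real (u * ((exp (s * q) - 1) / s)))"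
        "integrable F (\<lambda>q. complex_of_real (u\<^sup>2 / 2 * curvature s q))"
        by (intro integrable_mult_right integrable_of_real int)+
      show ?thesis
        unfolding Bochner_Integration.integral_add[OF Bochner_Integration.integrable_diff[OF int(1) j(1)]
            j(2)]
          Bochner_Integration.integral_diff[OF int(1) j(1)] i1 i2 variance_rate_def
        by (simp add: algebra_simps)
    qed
    also have "u * (\<alpha> * (\<integral>q. (exp (s * q) - 1) / s \<partial>F)) = v * sqrt (tilt s)"
    proof -
      have "u * tilt s = v * (tilt s / sqrt (tilt s))" by (simp add: u_def)
      also have "tilt s / sqrt (tilt s) = sqrt (tilt s)" using t by (intro real_div_sqrt) simp
      finally show ?thesis unfolding integral_exp_quotient[OF s] .
    qed
    also have "u\<^sup>2 / 2 * variance_rate s = v\<^sup>2 / 2 * R s" by (simp add: u2 R_def)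
    finally have "E s + of_real (v\<^sup>2 / 2 * R s) = of_real \<alpha> * (\<integral>q. ?X q \<partial>F)"
      unfolding E_def u_def by simp
    then have "cmod (E s + of_real (v\<^sup>2 / 2 * R s)) \<le> \<alpha> * (\<integral>q. cmod (?X q) \<partial>F)"
      using \<alpha>_pos by (auto simp: norm_mult intro!: mult_left_mono integral_norm_bound)
    also have "\<dots> \<le> \<alpha> * (\<integral>q. \<bar>u\<bar> ^ 3 * b / 6 * curvature s q + u\<^sup>2 / s\<^sup>2 \<partial>F)"
    proof (intro mult_left_mono integral_mono_AE)
      show "integrable F (\<lambda>q. cmod (?X q))"
        using int by (intro integrable_norm Bochner_Integration.integrable_add
            Bochner_Integration.integrable_diff
           integrable_mult_right integrable_of_real) auto
      show "integrable F (\<lambda>q. \<bar>u\<bar> ^ 3 * b / 6 * curvature s q + u\<^sup>2 / s\<^sup>2)" using int by simp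
      show "AE q in F. cmod (?X q) \<le> \<bar>u\<bar> ^ 3 * b / 6 * curvature s q + u\<^sup>2 / s\<^sup>2"
        using AE_le_b by eventually_elim (rule ein_diff_expansion[OF s _ b_pos])
    qed (use \<alpha>_pos in simp)
    also have "\<dots> = \<bar>u\<bar> ^ 3 * b / 6 * variance_rate s + \<alpha> * u\<^sup>2 / s\<^sup>2"
      using int by (simp add: F.prob_space[simplified] variance_rate_def algebra_simps)
    also have "\<bar>u\<bar> ^ 3 * b / 6 * variance_rate s = \<bar>v\<bar> ^ 3 * b / 6 * R s / sqrt (tilt s)"
    proof -
      have "sqrt (tilt s) ^ 3 = tilt s * sqrt (tilt s)" using t by (simp add: power3_eq_cube)
      then show ?thesis using t by (simp add: u_def R_def power_divide abs_divide)
    qed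
    also have "\<alpha> * u\<^sup>2 / s\<^sup>2 = \<alpha> * v\<^sup>2 / (tilt s * s\<^sup>2)" by (simp add: u2)
    finally show "cmod (E s + of_real (v\<^sup>2 / 2 * R s)) \<le> \<bar>v\<bar> ^ 3 * b / 6 * R s / sqrt (tilt s) + \<alpha> * v\<^sup>2 /
        (tilt s * s\<^sup>2)" .
  qed
  have T: "filterlim (\<lambda>s. sqrt (tilt s)) at_top at_top"
    by (rule filterlim_compose[OF sqrt_at_top filterlim_tilt_at_top])
  have "((\<lambda>s. \<bar>v\<bar> ^ 3 * b / 6 * R s / sqrt (tilt s) + \<alpha> * v\<^sup>2 / (tilt s * s\<^sup>2)) \<longlongrightarrow> 0 + 0) at_top"
  proof (intro tendsto_add)
    show "((\<lambda>s. \<bar>v\<bar> ^ 3 * b / 6 * R s / sqrt (tilt s)) \<longlongrightarrow> 0) at_top"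
      by (rule real_tendsto_divide_at_top[OF tendsto_mult[OF tendsto_const R] T])
    show "((\<lambda>s. \<alpha> * v\<^sup>2 / (tilt s * s\<^sup>2)) \<longlongrightarrow> 0) at_top"
    proof (rule real_tendsto_divide_at_top[OF tendsto_const])
      show "filterlim (\<lambda>s. tilt s * s\<^sup>2) at_top at_top"
        by (rule filterlim_at_top_mult_at_top[OF filterlim_tilt_at_top]) real_asymp
    qed
  qed
  then have "((\<lambda>s. E s + of_real (v\<^sup>2 / 2 * R s)) \<longlongrightarrow> 0) at_top"
    by (intro Lim_null_comparison[OF bound]) simp
  moreover have "((\<lambda>s. complex_of_real (v\<^sup>2 / 2 * R s)) \<longlongrightarrow> of_real (v\<^sup>2 / 2 * b)) at_top"
    by (intro tendsto_intros R)
  ultimately have "((\<lambda>s. (E s + of_real (v\<^sup>2 / 2 * R s)) - of_real (v\<^sup>2 / 2 * R s))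
      \<longlongrightarrow> 0 - of_real (v\<^sup>2 / 2 * b)) at_top"
    by (rule tendsto_diff)
  then have "((\<lambda>s. exp (E s)) \<longlongrightarrow> exp (- of_real (v\<^sup>2 / 2 * b))) at_top"
    by (intro tendsto_exp) simp
  also have "exp (- complex_of_real (v\<^sup>2 / 2 * b)) = of_real (exp (- (b * v\<^sup>2 / 2)))"
    by (simp add: exp_of_real[symmetric] mult.commute del: exp_of_real)
  finally have lim: "((\<lambda>s. exp (E s)) \<longlongrightarrow> of_real (exp (- (b * v\<^sup>2 / 2)))) at_top" .
  have "eventually (\<lambda>s. exp (E s) = tilted_cf s (v / sqrt (tilt s)) * exp (- (\<i> * of_real (v * sqrt (tilt
      s))))) at_top"
    using eventually_gt_at_top[of 0] by eventually_elim (simp add: E_def tilted_cf_eq exp_diff exp_minus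
        divide_inverse)
  from Lim_transform_eventually[OF lim this] show ?thesis .
qed

end

section \<open>Gaussian smoothing\<close>

lemma gaussian_integral:
  assumes "c > 0"
  shows "has_bochner_integral lborel (\<lambda>v::real. exp (- (c * v\<^sup>2))) (sqrt (pi / c))"
proof -
  define \<sigma> where "\<sigma> = 1 / sqrt (2 * c)"
  have \<sigma>: "\<sigma> > 0" "\<sigma>\<^sup>2 = 1 / (2 * c)" using assms by (auto simp: \<sigma>_def power_divide)
  have "has_bochner_integral lborel (\<lambda>v. sqrt (pi / c) * normal_density 0 \<sigma> v) (sqrt (pi / c) * 1)"
    using \<sigma> by (intro has_bochner_integral_mult_right) (simp add: has_bochner_integral_iff)
  moreover have "sqrt (pi / c) * normal_density 0 \<sigma> v = exp (- (c * v\<^sup>2))" for v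
    using assms unfolding normal_density_def \<sigma> by (simp add: mult.commute)
  ultimately show ?thesis by simp
qed

lemma integrable_abs_gaussian:
  assumes "c > 0"
  shows "integrable lborel (\<lambda>v::real. \<bar>v\<bar> * exp (- (c * v\<^sup>2)))"
proof -
  define \<sigma> where "\<sigma> = 1 / sqrt (2 * c)"
  have \<sigma>: "\<sigma> > 0" "\<sigma>\<^sup>2 = 1 / (2 * c)" using assms by (auto simp: \<sigma>_def power_divide)
  have "integrable lborel (\<lambda>v. sqrt (pi / c) * (normal_density 0 \<sigma> v * \<bar>v - 0\<bar> ^ 1))"
    using \<sigma> by (intro integrable_mult_right integrable_normal_moment_abs)
  moreover have "sqrt (pi / c) * (normal_density 0 \<sigma> v * \<bar>v - 0\<bar> ^ 1) = \<bar>v\<bar> * exp (- (c * v\<^sup>2))" for v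
    using assms unfolding normal_density_def \<sigma> by (simp add: mult.commute)
  ultimately show ?thesis by (simp only:)
qed

text \<open>The characteristic function of the standard normal law at \<open>x / \<delta>\<close> is
  itself Gaussian; rescaling its integral by \<open>y = \<delta> * u\<close> gives the inversion
  formula for the kernel, the only one on which the proof relies.\<close>

lemma normal_density_fourier:
  assumes \<delta>: "\<delta> > 0"
  shows "complex_of_real (normal_density 0 \<delta> x) =
    of_real (1 / (2 * pi)) * (\<integral>u. exp (\<i> * of_real (u * x)) * of_real (exp (- (\<delta>\<^sup>2 * u\<^sup>2 / 2))) \<partial>lborel)"
proof -
  have "complex_of_real (exp (- (x / \<delta>)\<^sup>2 / 2)) = char std_normal_distribution (x / \<delta>)"
    by (simp add: char_std_normal_distribution)
  also have "\<dots> = (\<integral>y. std_normal_density y *\<^sub>R iexp (x / \<delta> * y) \<partial>lborel)"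
    unfolding char_def by (subst integral_density) auto
  also have "\<dots> = \<bar>\<delta>\<bar> *\<^sub>R (\<integral>u. std_normal_density (0 + \<delta> * u) *\<^sub>R iexp (x / \<delta> * (0 + \<delta> * u)) \<partial>lborel)"
    using \<delta> by (intro lborel_integral_real_affine) auto
  also have "\<dots> = \<delta> *\<^sub>R (\<integral>u. (1 / sqrt (2 * pi)) *\<^sub>R (exp (\<i> * of_real (u * x)) * of_real (exp (- (\<delta>\<^sup>2 * u\<^sup>2
      / 2)))) \<partial>lborel)"
    using \<delta> by (simp add: std_normal_density_def scaleR_conv_of_real power_mult_distrib mult_ac)
  also have "\<dots> = (\<delta> / sqrt (2 * pi)) *\<^sub>R (\<integral>u. exp (\<i> * of_real (u * x)) * of_real (exp (- (\<delta>\<^sup>2 * u\<^sup>2 / 2)))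
      \<partial>lborel)"
    by (subst integral_scaleR_right) simp
  finally have eq: "complex_of_real (exp (- (x / \<delta>)\<^sup>2 / 2))
      = of_real (\<delta> / sqrt (2 * pi)) * (\<integral>u. exp (\<i> * of_real (u * x)) * of_real (exp (- (\<delta>\<^sup>2 * u\<^sup>2 / 2)))
      \<partial>lborel)"
    by (simp only: scaleR_conv_of_real)
  have "normal_density 0 \<delta> x = 1 / (\<delta> * sqrt (2 * pi)) * exp (- (x / \<delta>)\<^sup>2 / 2)"
    using \<delta> by (simp add: normal_density_def real_sqrt_mult power_divide mult_ac)
  also have "complex_of_real \<dots> = of_real (1 / (\<delta> * sqrt (2 * pi))) * complex_of_real (exp (- (x / \<delta>)\<^sup>2 /
      2))"
    by (rule of_real_mult)
  also have "\<dots> = of_real (1 / (\<delta> * sqrt (2 * pi)) * (\<delta> / sqrt (2 * pi))) * (\<integral>u. exp (\<i> * of_real (u * x)) *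
      of_real (exp (- (\<delta>\<^sup>2 * u\<^sup>2 / 2))) \<partial>lborel)"
    unfolding eq of_real_mult mult.assoc ..
  also have "1 / (\<delta> * sqrt (2 * pi)) * (\<delta> / sqrt (2 * pi)) = 1 / (2 * pi)"
    using \<delta> by simp
  finally show ?thesis .
qed

context perpetuity_laws begin

text \<open>Density at \<open>a\<close> of a variable with the tilted law plus an independent
  centred Gaussian of standard deviation \<open>\<delta>\<close>.\<close>

definition smoothed :: "real \<Rightarrow> real \<Rightarrow> real \<Rightarrow> real" where
  "smoothed s \<delta> a = (\<integral>x. exp (s * x) * normal_density 0 \<delta> (x - a) \<partial>\<mu>) / mgf_\<mu> s"

lemma tilted_cf_measurable [measurable]: "tilted_cf s \<in> borel_measurable borel"
proof -
  have "(\<lambda>u. cmgf \<mu> (Complex s u)) \<in> borel_measurable borel"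
    unfolding cmgf_def Complex_eq by (rule \<mu>.borel_measurable_lebesgue_integral) (simp add: split_beta')
  then show ?thesis unfolding tilted_cf_def[abs_def] by simp
qed

lemma norm_tilted_cf_le_1: "s > 0 \<Longrightarrow> cmod (tilted_cf s u) \<le> 1"
proof -
  assume s: "s > 0"
  have "0 \<le> (\<integral>q. - Re (ein_diff s u q) \<partial>F)"
    by (intro integral_nonneg_AE) (simp add: Re_ein_diff_nonpos)
  then show ?thesis unfolding norm_tilted_cf[OF s] using \<alpha>_pos by (simp add: mult_le_0_iff)
qed

text \<open>Insert \<open>normal_density_fourier\<close> and exchange the integrals; the Gaussian
  factor makes the double integral absolutely convergent, whatever \<open>tilted_cf\<close> does at
  infinity.\<close>

lemma smoothed_fourier:
  assumes s: "s > 0" and \<delta>: "\<delta> > 0"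
  shows "of_real (smoothed s \<delta> a) = of_real (1 / (2 * pi)) *
    (\<integral>u. exp (- (\<i> * of_real (u * a))) * tilted_cf s u * of_real (exp (- (\<delta>\<^sup>2 * u\<^sup>2 / 2))) \<partial>lborel)"
proof -
  interpret pair_sigma_finite \<mu> "lborel :: real measure" ..
  let ?k = "\<lambda>x u. of_real (exp (s * x)) * (exp (\<i> * of_real (u * (x - a))) * of_real (exp (- (\<delta>\<^sup>2 * u\<^sup>2 /
      2))))"
  have g: "integrable lborel (\<lambda>u::real. exp (- (\<delta>\<^sup>2 * u\<^sup>2 / 2)))"
    using gaussian_integral[of "\<delta>\<^sup>2 / 2"] \<delta> by (auto simp: has_bochner_integral_iff)
  have nk: "norm (?k x u) = exp (s * x) * exp (- (\<delta>\<^sup>2 * u\<^sup>2 / 2))" for x u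
    by (simp add: norm_mult)
  have int: "integrable (\<mu> \<Otimes>\<^sub>M lborel) (\<lambda>(x, u). ?k x u)"
  proof (rule Fubini_integrable)
    show "(\<lambda>(x, u). ?k x u) \<in> borel_measurable (\<mu> \<Otimes>\<^sub>M lborel)" by (simp add: split_beta')
    show "integrable \<mu> (\<lambda>x. \<integral>u. norm (case (x, u) of (x, u) \<Rightarrow> ?k x u) \<partial>lborel)"
      unfolding prod.case nk integral_mult_right_zero using s
          by (intro integrable_mult_left \<mu>.exp_moment) simp
    show "AE x in \<mu>. integrable lborel (\<lambda>u. case (x, u) of (x, u) \<Rightarrow> ?k x u)"
    proof (rule AE_I2)
      fix x
      show "integrable lborel (\<lambda>u. case (x, u) of (x, u) \<Rightarrow> ?k x u)"
        by (rule Bochner_Integration.integrable_bound[OF integrable_mult_right[OF g, of "exp (s * x)"]])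
          (auto simp: norm_mult)
    qed
  qed
  have 1: "(\<integral>u. ?k x u \<partial>lborel) = of_real (exp (s * x)) * (of_real (2 * pi) * complex_of_real
      (normal_density 0 \<delta> (x - a)))" for x
    unfolding normal_density_fourier[OF \<delta>] by (subst integral_mult_right_zero) simp
  have 2: "(\<integral>x. ?k x u \<partial>\<mu>) = of_real (mgf_\<mu> s) * (exp (- (\<i> * of_real (u * a))) * tilted_cf s u * of_real
      (exp (- (\<delta>\<^sup>2 * u\<^sup>2 / 2))))" for u
  proof -
    have "?k x u = (exp (- (\<i> * of_real (u * a))) * of_real (exp (- (\<delta>\<^sup>2 * u\<^sup>2 / 2)))) * exp (Complex s u *
        of_real x)" for x
      by (simp add: Complex_eq exp_of_real[symmetric] mult_exp_exp algebra_simps del: exp_of_real)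
    then have "(\<integral>x. ?k x u \<partial>\<mu>) = (exp (- (\<i> * of_real (u * a))) * of_real (exp (- (\<delta>\<^sup>2 * u\<^sup>2 / 2)))) * cmgf
        \<mu> (Complex s u)"
      unfolding cmgf_def by (simp only: integral_mult_right_zero)
    then show ?thesis using mgf_\<mu>_pos[OF s] by (simp add: tilted_cf_def)
  qed
  have "of_real (2 * pi) * (of_real (\<integral>x. exp (s * x) * normal_density 0 \<delta> (x - a) \<partial>\<mu>))
      = (\<integral>x. of_real (2 * pi) * complex_of_real (exp (s * x) * normal_density 0 \<delta> (x - a)) \<partial>\<mu>)"
    by (simp only: integral_mult_right_zero integral_complex_of_real)
  also have "\<dots> = (\<integral>x. \<integral>u. ?k x u \<partial>lborel \<partial>\<mu>)"
    unfolding 1 by (intro Bochner_Integration.integral_cong) simp_all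
  also have "\<dots> = (\<integral>u. \<integral>x. ?k x u \<partial>\<mu> \<partial>lborel)" by (rule Fubini_integral[OF int, symmetric])
  also have "\<dots> = of_real (mgf_\<mu> s) * (\<integral>u. exp (- (\<i> * of_real (u * a))) * tilted_cf s u * of_real (exp (-
      (\<delta>\<^sup>2 * u\<^sup>2 / 2))) \<partial>lborel)"
    unfolding 2 by (rule integral_mult_right_zero)
  finally have "of_real (\<integral>x. exp (s * x) * normal_density 0 \<delta> (x - a) \<partial>\<mu>) / of_real (mgf_\<mu> s) =
    (\<integral>u. exp (- (\<i> * of_real (u * a))) * tilted_cf s u * of_real (exp (- (\<delta>\<^sup>2 * u\<^sup>2 / 2))) \<partial>lborel) /
        complex_of_real (2 * pi)"
    using mgf_\<mu>_pos[OF s] by (simp add: field_simps)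
  then show ?thesis unfolding smoothed_def by simp
qed

text \<open>Integrand of \<open>smoothed_fourier\<close> with \<open>\<delta> = k / s\<close>, after
  the substitution \<open>u = v / sqrt (tilt s)\<close> and recentring at the tilted mean. The phase
  split off has modulus one and carries all dependence on the centre \<open>a\<close>.\<close>

definition scaled_kernel :: "real \<Rightarrow> real \<Rightarrow> real \<Rightarrow> complex" where
  "scaled_kernel k s v = tilted_cf s (v / sqrt (tilt s)) * exp (- (\<i> * of_real (v * sqrt (tilt s)))) *
     of_real (exp (- ((k / s)\<^sup>2 * v\<^sup>2 / (2 * tilt s))))"

lemma scaled_kernel_measurable [measurable]: "scaled_kernel k s \<in> borel_measurable borel"
  unfolding scaled_kernel_def[abs_def] by measurable

lemma integrable_scaled_kernel:
  assumes "s > 0" "tilt s > 0" "k > 0" shows "integrable lborel (scaled_kernel k s)"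
proof (rule Bochner_Integration.integrable_bound)
  show "integrable lborel (\<lambda>v. exp (- ((k / s)\<^sup>2 / (2 * tilt s) * v\<^sup>2)))"
    using gaussian_integral[of "(k / s)\<^sup>2 / (2 * tilt s)"] assms by (auto simp: has_bochner_integral_iff)
  show "AE v in lborel. norm (scaled_kernel k s v) \<le> norm (exp (- ((k / s)\<^sup>2 / (2 * tilt s) * v\<^sup>2)))"
    using norm_tilted_cf_le_1[OF assms(1)] by (auto simp: scaled_kernel_def norm_mult intro!: AE_I2)
qed simp

lemma smoothed_scaled:
  assumes s: "s > 0" and t: "tilt s > 0" and k: "k > 0"
  shows "of_real (sqrt (tilt s) * smoothed s (k / s) a) = of_real (1 / (2 * pi)) *
    (\<integral>v. exp (- (\<i> * of_real (v * ((a - tilt s) / sqrt (tilt s))))) * scaled_kernel k s v \<partial>lborel)"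
proof -
  define r where "r = sqrt (tilt s)"
  have r: "r > 0" "r\<^sup>2 = tilt s" using t by (auto simp: r_def)
  let ?f = "\<lambda>u. exp (- (\<i> * of_real (u * a))) * tilted_cf s u * of_real (exp (- ((k / s)\<^sup>2 * u\<^sup>2 / 2)))"
  have *: "?f (0 + (1 / r) * v) = exp (- (\<i> * of_real (v * ((a - tilt s) / r)))) * scaled_kernel k s v" for
      v
  proof -
    have "exp (- (\<i> * of_real ((v / r) * a))) = exp (- (\<i> * of_real (v * ((a - tilt s) / r)))) * exp (- (\<i> *
        of_real (v * r)))"
    proof -
      have "(v / r) * a = v * ((a - tilt s) / r) + v * r"
        using r by (simp add: r(2)[symmetric] field_simps power2_eq_square)
      then show ?thesis by (simp add: mult_exp_exp distrib_left algebra_simps)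
    qed
    then show ?thesis using r
      by (simp add: scaled_kernel_def r_def[symmetric] power_divide mult_ac)
  qed
  have "(\<integral>u. ?f u \<partial>lborel) = \<bar>1 / r\<bar> *\<^sub>R (\<integral>v. ?f (0 + (1 / r) * v) \<partial>lborel)"
    using r by (intro lborel_integral_real_affine) auto
  also have "\<dots> = of_real (1 / r) * (\<integral>v. exp (- (\<i> * of_real (v * ((a - tilt s) / r)))) * scaled_kernel k s v
      \<partial>lborel)"
    unfolding * using r by (simp add: scaleR_conv_of_real)
  finally have A: "of_real r * (\<integral>u. ?f u \<partial>lborel) = (\<integral>v. exp (- (\<i> * of_real (v * ((a - tilt s) / r)))) *
      scaled_kernel k s v \<partial>lborel)"
    using r by simp
  have B: "complex_of_real (smoothed s (k / s) a) = of_real (1 / (2 * pi)) * (\<integral>u. ?f u \<partial>lborel)"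
    using s k by (intro smoothed_fourier) auto
  have "R * I = J \<Longrightarrow> S = c * I \<Longrightarrow> R * S = c * J" for R I J S c :: complex by auto
  from this[OF A B] show ?thesis unfolding r_def[symmetric] of_real_mult .
qed

text \<open>L1 distance of the rescaled integrand from its Gaussian limit. Being free of the phase
  of \<open>a\<close>, it bounds the error for all centres at once.\<close>

definition kernel_error :: "real \<Rightarrow> real \<Rightarrow> real" where
  "kernel_error k s = (\<integral>v. cmod (scaled_kernel k s v - of_real (exp (- (b / 2 * v\<^sup>2)))) \<partial>lborel)"

text \<open>Split at \<open>\<bar>v\<bar> = sqrt (tilt s) / b\<close>, that is
  \<open>\<bar>u\<bar> = 1 / b\<close>. Inside, \<open>tilted_cf_small\<close> is a fixed Gaussian
  majorant for dominated convergence; outside, the uniform bound of \<open>tilted_cf_large\<close>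
  is multiplied by the total mass of the smoothing factor.\<close>

lemma kernel_error_tendsto_0:
  assumes k: "k > 0"
  shows "(kernel_error k \<longlongrightarrow> 0) at_top"
proof -
  define e where "e = (\<lambda>v::real. exp (- (b / 2 * v\<^sup>2)))"
  define g where "g = (\<lambda>s v. if \<bar>v\<bar> \<le> sqrt (tilt s) / b then scaled_kernel k s v else 0)"
  obtain \<kappa> C where \<kappa>: "\<kappa> > 0" "C > 0" and large:
    "eventually (\<lambda>s. \<forall>u. \<bar>u\<bar> \<ge> 1 / b \<longrightarrow> cmod (tilted_cf s u) \<le> C * exp (- (\<kappa> * tilt s / s\<^sup>2))) at_top"
    using tilted_cf_large by blast
  have T: "filterlim (\<lambda>s. sqrt (tilt s)) at_top at_top"
    by (rule filterlim_compose[OF sqrt_at_top filterlim_tilt_at_top])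
  have tpos: "eventually (\<lambda>s. tilt s > 0) at_top"
    using filterlim_tilt_at_top by (auto simp: filterlim_at_top_dense)
  have g_meas: "g s \<in> borel_measurable borel" for s unfolding g_def by measurable
  have e_int: "integrable lborel e"
    using gaussian_integral[of "b/2"] b_pos by (auto simp: has_bochner_integral_iff e_def)
  have small: "eventually (\<lambda>s. \<forall>v. cmod (g s v) \<le> exp (- (b / 16 * v\<^sup>2))) at_top"
    using tilted_cf_small tpos eventually_gt_at_top[of 0]
  proof eventually_elim
    fix s assume H: "\<forall>u. \<bar>u\<bar> \<le> 1 / b \<longrightarrow> cmod (tilted_cf s u) \<le> exp (- (b / 16 * tilt s * u\<^sup>2))" and t: "0
        < tilt s" and s: "0 < s"
    show "\<forall>v. cmod (g s v) \<le> exp (- (b / 16 * v\<^sup>2))"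
    proof
      fix v
      show "cmod (g s v) \<le> exp (- (b / 16 * v\<^sup>2))"
      proof (cases "\<bar>v\<bar> \<le> sqrt (tilt s) / b")
        case True
        then have "\<bar>v / sqrt (tilt s)\<bar> \<le> 1 / b" using t b_pos by (simp add: abs_divide field_simps)
        then have 1: "cmod (tilted_cf s (v / sqrt (tilt s)))
            \<le> exp (- (b / 16 * tilt s * (v / sqrt (tilt s))\<^sup>2))" using H by blast
        have 2: "exp (- ((k / s)\<^sup>2 * v\<^sup>2 / (2 * tilt s))) \<le> 1" using t by simp
        have "cmod (g s v) \<le> exp (- (b / 16 * tilt s * (v / sqrt (tilt s))\<^sup>2)) * 1"
          using True mult_mono[OF 1 2] by (simp add: g_def scaled_kernel_def norm_mult)
        then show ?thesis using t by (simp add: power_divide)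
      qed (simp add: g_def)
    qed
  qed
  have lim1: "((\<lambda>s. \<integral>v. cmod (g s v - of_real (e v)) \<partial>lborel) \<longlongrightarrow> (\<integral>v. 0 \<partial>(lborel :: real measure))) at_top"
  proof (rule integral_dominated_convergence_at_top[where w="\<lambda>v. 2 * exp (- (b / 16 * v\<^sup>2))"])
    show "integrable lborel (\<lambda>v. 2 * exp (- (b / 16 * v\<^sup>2)))"
      using gaussian_integral[of "b/16"] b_pos by (auto simp: has_bochner_integral_iff)
    show "(\<lambda>v. cmod (g s v - of_real (e v))) \<in> borel_measurable lborel" for s
      using g_meas[of s] unfolding e_def by simp
    show "eventually (\<lambda>s. AE v in lborel. norm (cmod (g s v - of_real (e v)))
        \<le> 2 * exp (- (b / 16 * v\<^sup>2))) at_top"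
      using small
    proof (eventually_elim, intro AE_I2)
      fix s v assume H: "\<forall>v. cmod (g s v) \<le> exp (- (b / 16 * v\<^sup>2))"
      have "e v \<le> exp (- (b / 16 * v\<^sup>2))" using b_pos by (simp add: e_def)
      moreover have "cmod (g s v - of_real (e v)) \<le> cmod (g s v) + e v"
        by (rule order_trans[OF norm_triangle_ineq4]) (simp add: e_def)
      ultimately show "norm (cmod (g s v - of_real (e v))) \<le> 2 * exp (- (b / 16 * v\<^sup>2))"
        using H[rule_format, of v] by simp
    qed
    show "AE v in lborel. ((\<lambda>s. cmod (g s v - of_real (e v))) \<longlongrightarrow> 0) at_top"
    proof (rule AE_I2)
      fix v
      have "((\<lambda>s. (k / s)\<^sup>2 * v\<^sup>2 / (2 * tilt s)) \<longlongrightarrow> 0) at_top"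
      proof (rule real_tendsto_divide_at_top)
        have "((\<lambda>s. (k / s)\<^sup>2 * v\<^sup>2) \<longlongrightarrow> 0\<^sup>2 * v\<^sup>2) at_top"
          by (intro tendsto_intros real_tendsto_divide_at_top[OF tendsto_const filterlim_ident])
        then show "((\<lambda>s. (k / s)\<^sup>2 * v\<^sup>2) \<longlongrightarrow> 0) at_top" by simp
        show "filterlim (\<lambda>s. 2 * tilt s) at_top at_top"
          by (rule filterlim_tendsto_pos_mult_at_top[OF tendsto_const _ filterlim_tilt_at_top]) simp
      qed
      then have "((\<lambda>s. complex_of_real (exp (- ((k / s)\<^sup>2 * v\<^sup>2 / (2 * tilt s)))))
          \<longlongrightarrow> of_real (exp (- 0))) at_top"
        by (intro tendsto_intros)
      from tendsto_mult[OF tilted_cf_limit[of v] this]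
      have "((\<lambda>s. scaled_kernel k s v) \<longlongrightarrow> of_real (e v)) at_top"
        by (simp add: scaled_kernel_def e_def)
      moreover have "eventually (\<lambda>s. scaled_kernel k s v = g s v) at_top"
      proof -
        have "eventually (\<lambda>s. sqrt (tilt s) \<ge> \<bar>v\<bar> * b) at_top" using T by (simp add: filterlim_at_top)
        then show ?thesis by eventually_elim (use b_pos in \<open>simp add: g_def field_simps\<close>)
      qed
      ultimately have "((\<lambda>s. g s v) \<longlongrightarrow> of_real (e v)) at_top" by (rule Lim_transform_eventually)
      then show "((\<lambda>s. cmod (g s v - of_real (e v))) \<longlongrightarrow> 0) at_top"
        by (simp add: tendsto_norm_zero LIM_zero)
    qed
  qed simp
  \<comment> \<open>\<open>B\<close> bounds the outer part: the mass \<open>sqrt (pi / c)\<close> of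
    the smoothing factor has order \<open>s * sqrt (tilt s)\<close>, hence at most order
    \<open>tilt s\<close>, and the exponential in \<open>sqrt (tilt s)\<close> beats it.\<close>
  define B where "B = (\<lambda>s. C * exp (- (\<kappa> * sqrt (tilt s))) * (sqrt (2 * pi) / k * tilt s))"
  have lim2: "(B \<longlongrightarrow> 0) at_top"
  proof -
    have "((\<lambda>t. C * exp (- (\<kappa> * sqrt t)) * (sqrt (2 * pi) / k * t)) \<longlongrightarrow> 0) at_top"
      using \<kappa> k by real_asymp
    from filterlim_compose[OF this filterlim_tilt_at_top] show ?thesis by (simp add: B_def)
  qed
  have le: "eventually (\<lambda>s. norm (kernel_error k s) \<le> (\<integral>v. cmod (g s v - of_real (e v)) \<partial>lborel) + B s)
      at_top"
    using large small tpos eventually_ge_at_top[of 1] tilt_ge_power[of 1]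
  proof eventually_elim
    fix s assume L: "\<forall>u. \<bar>u\<bar> \<ge> 1 / b \<longrightarrow> cmod (tilted_cf s u) \<le> C * exp (- (\<kappa> * tilt s / s\<^sup>2))"
      and sm: "\<forall>v. cmod (g s v) \<le> exp (- (b / 16 * v\<^sup>2))"
      and t: "0 < tilt s" and s1: "1 \<le> s" and tp: "1 * s ^ 4 \<le> tilt s"
    have s: "s > 0" using s1 by simp
    have s2: "s\<^sup>2 \<le> sqrt (tilt s)" using tp by (intro real_le_rsqrt) simp
    define D where "D = C * exp (- (\<kappa> * sqrt (tilt s)))"
    define c where "c = (k / s)\<^sup>2 / (2 * tilt s)"
    have c: "c > 0" using k s t by (simp add: c_def)
    \<comment> \<open>Because of \<open>s ^ 4 \<le> tilt s\<close>, the quotient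
      \<open>tilt s / s\<^sup>2\<close> in the exponent of \<open>tilted_cf_large\<close> is at
      least \<open>sqrt (tilt s)\<close>.\<close>
    have "sqrt (tilt s) * s\<^sup>2 \<le> sqrt (tilt s) * sqrt (tilt s)" using s2 t by (intro mult_left_mono) auto
    then have st: "sqrt (tilt s) \<le> tilt s / s\<^sup>2" using s t by (simp add: field_simps)
    have D: "C * exp (- (\<kappa> * tilt s / s\<^sup>2)) \<le> D"
      unfolding D_def using \<kappa> mult_left_mono[OF st, of \<kappa>] by simp
    have g_int: "integrable lborel (g s)"
      by (rule Bochner_Integration.integrable_bound[where f="\<lambda>v. exp (- (b / 16 * v\<^sup>2))"])
        (use gaussian_integral[of "b/16"] b_pos sm g_meas in \<open>auto simp: has_bochner_integral_iff\<close>)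
    have c_int: "has_bochner_integral lborel (\<lambda>v. D * exp (- (c * v\<^sup>2))) (D * sqrt (pi / c))"
      by (intro has_bochner_integral_mult_right gaussian_integral c)
    have pw: "cmod (scaled_kernel k s v - of_real (e v))
        \<le> cmod (g s v - of_real (e v)) + D * exp (- (c * v\<^sup>2))" for v
    proof (cases "\<bar>v\<bar> \<le> sqrt (tilt s) / b")
      case True
      then show ?thesis using \<kappa> by (simp add: g_def D_def)
    next
      case False
      then have "\<bar>v / sqrt (tilt s)\<bar> \<ge> 1 / b" using t b_pos by (simp add: abs_divide field_simps)
      then have "cmod (tilted_cf s (v / sqrt (tilt s))) \<le> D" using L D by (meson order_trans)
      then have "cmod (scaled_kernel k s v) \<le> D * exp (- (c * v\<^sup>2))"
        by (simp add: scaled_kernel_def norm_mult c_def)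
      moreover have "cmod (scaled_kernel k s v - of_real (e v))
          \<le> cmod (scaled_kernel k s v) + cmod (of_real (e v))"
        by (rule norm_triangle_ineq4)
      ultimately show ?thesis using False by (simp add: g_def)
    qed
    have ke: "kernel_error k s = (\<integral>v. cmod (scaled_kernel k s v - of_real (e v)) \<partial>lborel)"
      by (simp only: kernel_error_def e_def)
    have "kernel_error k s \<le> (\<integral>v. cmod (g s v - of_real (e v)) + D * exp (- (c * v\<^sup>2)) \<partial>lborel)"
      unfolding ke
    proof (rule integral_mono)
      show "integrable lborel (\<lambda>v. cmod (scaled_kernel k s v - of_real (e v)))"
        using integrable_scaled_kernel[OF s t k] e_int by auto
      show "integrable lborel (\<lambda>v. cmod (g s v - of_real (e v)) + D * exp (- (c * v\<^sup>2)))"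
        using g_int e_int integrable.intros[OF c_int] by auto
    qed (rule pw)
    also have "\<dots> = (\<integral>v. cmod (g s v - of_real (e v)) \<partial>lborel) + D * sqrt (pi / c)"
      using g_int e_int c_int has_bochner_integral_integral_eq[OF c_int]
      by (subst Bochner_Integration.integral_add) (auto simp: has_bochner_integral_iff)
    also have "D * sqrt (pi / c) \<le> B s"
    proof -
      have "pi / c = (2 * pi) * tilt s * (s / k)\<^sup>2" using s k t
          by (simp add: c_def field_simps power2_eq_square)
      then have "sqrt (pi / c) = sqrt (2 * pi) * sqrt (tilt s) * (s / k)"
        using s k by (simp add: real_sqrt_mult)
      also have "\<dots> = sqrt (2 * pi) / k * (sqrt (tilt s) * s)" by simp
      also have "sqrt (tilt s) * s \<le> sqrt (tilt s) * sqrt (tilt s)"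
      proof (rule mult_left_mono)
        have "s * 1 \<le> s * s" using s1 by (intro mult_left_mono) auto
        then show "s \<le> sqrt (tilt s)" using s2 by (simp add: power2_eq_square)
      qed (use t in simp)
      then have "sqrt (2 * pi) / k * (sqrt (tilt s) * s) \<le> sqrt (2 * pi) / k * tilt s"
        using k t by (intro mult_left_mono) auto
      finally show ?thesis unfolding B_def D_def[symmetric]
        using \<kappa> by (intro mult_left_mono) (auto simp: D_def)
    qed
    finally have "kernel_error k s \<le> (\<integral>v. cmod (g s v - of_real (e v)) \<partial>lborel) + B s" by simp
    moreover have "kernel_error k s \<ge> 0" unfolding kernel_error_def by (intro integral_nonneg_AE) auto
    ultimately show "norm (kernel_error k s) \<le> (\<integral>v. cmod (g s v - of_real (e v)) \<partial>lborel) + B s" by simp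
  qed
  show ?thesis
    by (rule Lim_null_comparison[OF le]) (use tendsto_add[OF lim1 lim2] in simp)
qed

definition gauss_abs :: real where
  "gauss_abs = (\<integral>v. \<bar>v\<bar> * exp (- (b / 2 * v\<^sup>2)) \<partial>lborel)"

text \<open>Two bounds of different scope. The two-sided one compares the phase with
  \<open>1\<close>, so it worsens with the distance of \<open>a\<close> from \<open>tilt s\<close>
  in units of \<open>sqrt (tilt s)\<close>; the first absolute moment \<open>gauss_abs\<close> is
  the Lipschitz constant. The upper one estimates the phase by its modulus and is uniform in
  \<open>a\<close>.\<close>

lemma smoothed_approx:
  assumes s: "s > 0" and t: "tilt s > 0" and k: "k > 0"
  shows "\<bar>sqrt (tilt s) * smoothed s (k / s) a - 1 / sqrt (2 * pi * b)\<bar>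
      \<le> kernel_error k s + gauss_abs * (\<bar>a - tilt s\<bar> / sqrt (tilt s))" (is "?A")
    and "sqrt (tilt s) * smoothed s (k / s) a \<le> 1 / sqrt (2 * pi * b) + kernel_error k s" (is "?B")
proof -
  define d where "d = (a - tilt s) / sqrt (tilt s)"
  define e where "e = (\<lambda>v::real. exp (- (b / 2 * v\<^sup>2)))"
  define w where "w = (\<lambda>v. exp (- (\<i> * of_real (v * d))))"
  have w: "cmod (w v) = 1" "w \<in> borel_measurable borel" for v by (simp_all add: w_def)
  have e: "has_bochner_integral lborel e (sqrt (2 * pi / b))"
    using gaussian_integral[of "b/2"] b_pos by (simp add: e_def[abs_def] mult.commute)
  then have e_int: "integrable lborel e" and e_eq: "integral\<^sup>L lborel e = sqrt (2 * pi / b)"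
    by (auto simp: has_bochner_integral_iff)
  have "1 / (2 * pi) * sqrt (2 * pi / b) = 1 / sqrt (2 * pi * b)"
    using b_pos pi_gt_zero by (simp add: real_sqrt_mult real_sqrt_divide field_simps)
  then have G: "1 / (2 * pi) * integral\<^sup>L lborel e = 1 / sqrt (2 * pi * b)" by (simp add: e_eq)
  have err_nonneg: "kernel_error k s \<ge> 0" unfolding kernel_error_def by (intro integral_nonneg_AE) auto
  note k_int = integrable_scaled_kernel[OF s t k]
  have wk_int: "integrable lborel (\<lambda>v. w v * scaled_kernel k s v)"
    by (rule Bochner_Integration.integrable_bound[OF k_int]) (use w in \<open>auto simp: norm_mult\<close>)
  have we_int: "integrable lborel (\<lambda>v. w v * of_real (e v))"
    by (rule Bochner_Integration.integrable_bound[OF e_int]) (use w in \<open>auto simp: norm_mult e_def\<close>)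
  have S: "of_real (sqrt (tilt s) * smoothed s (k / s) a)
      = of_real (1 / (2 * pi)) * (\<integral>v. w v * scaled_kernel k s v \<partial>lborel)"
    using smoothed_scaled[OF s t k, of a] by (simp only: w_def d_def)
  have err: "cmod ((\<integral>v. w v * scaled_kernel k s v \<partial>lborel) - (\<integral>v. w v * of_real (e v) \<partial>lborel))
      \<le> kernel_error k s"
  proof -
    have "(\<integral>v. w v * scaled_kernel k s v \<partial>lborel) - (\<integral>v. w v * of_real (e v) \<partial>lborel)
        = (\<integral>v. w v * (scaled_kernel k s v - of_real (e v)) \<partial>lborel)"
      using wk_int we_int by (simp add: right_diff_distrib)
    then have "cmod ((\<integral>v. w v * scaled_kernel k s v \<partial>lborel) - (\<integral>v. w v * of_real (e v) \<partial>lborel))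
        \<le> (\<integral>v. cmod (w v * (scaled_kernel k s v - of_real (e v))) \<partial>lborel)"
      by (simp only: integral_norm_bound)
    then show ?thesis by (simp add: norm_mult w kernel_error_def e_def)
  qed
  \<comment> \<open>The errors are stated without the factor \<open>1 / (2 * pi)\<close>, which is
    at most \<open>1\<close>.\<close>
  have pi2: "1 / (2 * pi) \<le> 1" using pi_gt3 by simp
  have sc: "1 / (2 * pi) * x \<le> x" if "x \<ge> 0" for x
    using mult_right_mono[OF pi2 that] by simp
  show ?A
  proof -
    have "cmod ((\<integral>v. w v * of_real (e v) \<partial>lborel) - of_real (integral\<^sup>L lborel e)) \<le> gauss_abs * \<bar>d\<bar>"
    proof -
      have "(\<integral>v. w v * of_real (e v) \<partial>lborel) - of_real (integral\<^sup>L lborel e)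
          = (\<integral>v. w v * of_real (e v) - of_real (e v) \<partial>lborel)"
        using we_int e_int by (simp add: integral_complex_of_real)
      also have "cmod \<dots> \<le> (\<integral>v. cmod (w v * of_real (e v) - of_real (e v)) \<partial>lborel)"
          by (rule integral_norm_bound)
      also have "\<dots> \<le> (\<integral>v. \<bar>d\<bar> * (\<bar>v\<bar> * exp (- (b / 2 * v\<^sup>2))) \<partial>lborel)"
      proof (rule integral_mono)
        show "integrable lborel (\<lambda>v. cmod (w v * of_real (e v) - of_real (e v)))"
          using we_int e_int by auto
        show "integrable lborel (\<lambda>v. \<bar>d\<bar> * (\<bar>v\<bar> * exp (- (b / 2 * v\<^sup>2))))"
          using b_pos by (intro integrable_mult_right integrable_abs_gaussian) simp
        fix v
        have "cmod (iexp (- (v * d)) - (\<Sum>j\<le>0. (\<i> * of_real (- (v * d))) ^ j / fact j))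
            \<le> \<bar>- (v * d)\<bar> ^ Suc 0 / fact (Suc 0)"
          by (rule iexp_approx1)
        then have "cmod (w v - 1) \<le> \<bar>v\<bar> * \<bar>d\<bar>" by (simp add: w_def abs_mult)
        then have "cmod (w v - 1) * e v \<le> \<bar>v\<bar> * \<bar>d\<bar> * e v" by (rule mult_right_mono) (simp add: e_def)
        moreover have "w v * of_real (e v) - of_real (e v) = (w v - 1) * of_real (e v)"
            by (simp add: algebra_simps)
        ultimately show "cmod (w v * of_real (e v) - of_real (e v)) \<le> \<bar>d\<bar> * (\<bar>v\<bar> * exp (- (b / 2 * v\<^sup>2)))"
          by (simp add: norm_mult e_def mult_ac)
      qed
      also have "\<dots> = gauss_abs * \<bar>d\<bar>" unfolding gauss_abs_def by simp
      finally show ?thesis .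
    qed
    from err this have tot: "cmod ((\<integral>v. w v * scaled_kernel k s v \<partial>lborel) - of_real (integral\<^sup>L lborel e))
        \<le> kernel_error k s + gauss_abs * \<bar>d\<bar>"
      by (rule norm_diff_triangle_le)
    have Sd: "of_real (sqrt (tilt s) * smoothed s (k / s) a - 1 / sqrt (2 * pi * b)) =
       of_real (1 / (2 * pi)) * ((\<integral>v. w v * scaled_kernel k s v \<partial>lborel) - of_real (integral\<^sup>L lborel e))"
    proof -
      have "complex_of_real (1 / sqrt (2 * pi * b)) = of_real (1 / (2 * pi)) * of_real (integral\<^sup>L lborel
          e)"
        by (simp only: G[symmetric] of_real_mult)
      then show ?thesis unfolding of_real_diff S by (simp only: right_diff_distrib)
    qed
    have "\<bar>sqrt (tilt s) * smoothed s (k / s) a - 1 / sqrt (2 * pi * b)\<bar>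
       = 1 / (2 * pi) * cmod ((\<integral>v. w v * scaled_kernel k s v \<partial>lborel) - of_real (integral\<^sup>L lborel e))"
      using arg_cong[OF Sd, of cmod] unfolding norm_of_real norm_mult by simp
    also have "\<dots> \<le> cmod ((\<integral>v. w v * scaled_kernel k s v \<partial>lborel) - of_real (integral\<^sup>L lborel e))"
      by (rule sc) simp
    also note tot
    finally show ?thesis using t by (simp add: d_def abs_divide)
  qed
  show ?B
  proof -
    have "cmod (\<integral>v. w v * of_real (e v) \<partial>lborel) \<le> (\<integral>v. cmod (w v * of_real (e v)) \<partial>lborel)"
        by (rule integral_norm_bound)
    also have "\<dots> = integral\<^sup>L lborel e" by (simp add: norm_mult w e_def)
    finally have "cmod (\<integral>v. w v * scaled_kernel k s v \<partial>lborel) \<le> integral\<^sup>L lborel e + kernel_error k s"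
      using err norm_triangle_ineq2[of "\<integral>v. w v * scaled_kernel k s v \<partial>lborel" "\<integral>v. w v * of_real (e v)
          \<partial>lborel"] by linarith
    then have "1 / (2 * pi) * cmod (\<integral>v. w v * scaled_kernel k s v \<partial>lborel)
        \<le> 1 / (2 * pi) * (integral\<^sup>L lborel e + kernel_error k s)"
      by (rule mult_left_mono) simp
    also have "\<dots> \<le> 1 / sqrt (2 * pi * b) + kernel_error k s"
      using sc[OF err_nonneg] G by (simp add: distrib_left)
    finally have "1 / (2 * pi) * cmod (\<integral>v. w v * scaled_kernel k s v \<partial>lborel)
        \<le> 1 / sqrt (2 * pi * b) + kernel_error k s" .
    moreover have "cmod (of_real (sqrt (tilt s) * smoothed s (k / s) a))
        = 1 / (2 * pi) * cmod (\<integral>v. w v * scaled_kernel k s v \<partial>lborel)"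
      unfolding S norm_mult norm_of_real by simp
    ultimately show ?thesis by (simp only: norm_of_real)
  qed
qed

end

section \<open>Local limit theorem\<close>

text \<open>The tail of the Gaussian kernel is absorbed by a kernel of twice the width, so it is controlled
    by the smoothed local limit theorem itself.\<close>

lemma normal_density_tail_le:
  assumes \<delta>: "\<delta> > 0" and \<eta>: "\<eta> \<ge> 0"
  shows "normal_density a \<delta> y \<le> normal_density a \<delta> y * indicator {a - \<eta>..a + \<eta>} y
    + 2 * exp (- (3 * \<eta>\<^sup>2 / (8 * \<delta>\<^sup>2))) * normal_density a (2 * \<delta>) y"
proof (cases "\<bar>y - a\<bar> \<le> \<eta>")
  case True
  then have "y \<in> {a - \<eta>..a + \<eta>}" by auto
  then show ?thesis by simp
next
  case False
  have sq: "\<eta>\<^sup>2 \<le> (y - a)\<^sup>2" using False \<eta> by (simp add: abs_le_square_iff[symmetric])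
  \<comment> \<open>The splitting 1/2 = 3/8 + 1/8 of the exponent: 1/8 belongs to the kernel of
    twice the width, and 3/8 is the gain outside the window. The factor \<open>2\<close> below is
    the ratio of the normalising constants.\<close>
  have "- (y - a)\<^sup>2 / (2 * \<delta>\<^sup>2) = - (3 * (y - a)\<^sup>2 / (8 * \<delta>\<^sup>2)) + - (y - a)\<^sup>2 / (2 * (2 * \<delta>)\<^sup>2)"
    using \<delta> by (simp add: field_simps)
  then have "exp (- (y - a)\<^sup>2 / (2 * \<delta>\<^sup>2)) = exp (- (3 * (y - a)\<^sup>2 / (8 * \<delta>\<^sup>2))) * exp (- (y - a)\<^sup>2 / (2 *
      (2 * \<delta>)\<^sup>2))"
    by (simp only: exp_add)
  moreover have "1 / sqrt (2 * pi * \<delta>\<^sup>2) = 2 * (1 / sqrt (2 * pi * (2 * \<delta>)\<^sup>2))"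
  proof -
    have "sqrt (2 * pi * (2 * \<delta>)\<^sup>2) = sqrt (2 * pi) * (2 * \<delta>)" "sqrt (2 * pi * \<delta>\<^sup>2) = sqrt (2 * pi) * \<delta>"
      using \<delta> by (subst real_sqrt_mult, subst real_sqrt_abs, simp)+
    then show ?thesis by simp
  qed
  ultimately have "normal_density a \<delta> y = 2 * exp (- (3 * (y - a)\<^sup>2 / (8 * \<delta>\<^sup>2))) * normal_density a (2 * \<delta>)
      y"
    unfolding normal_density_def by (simp only: mult_ac)
  also have "\<dots> \<le> 2 * exp (- (3 * \<eta>\<^sup>2 / (8 * \<delta>\<^sup>2))) * normal_density a (2 * \<delta>) y"
    using sq by (intro mult_right_mono mult_left_mono) (auto intro!: divide_right_mono)
  finally show ?thesis by (simp add: add_increasing)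
qed

lemma normal_density_mass_ge:
  assumes \<delta>: "\<delta> > 0" and \<eta>: "\<eta> \<ge> 0"
  shows "1 - 2 * exp (- (3 * \<eta>\<^sup>2 / (8 * \<delta>\<^sup>2))) \<le> (\<integral>y. normal_density a \<delta> y * indicator {a - \<eta>..a + \<eta>} y
      \<partial>lborel)"
proof -
  have int: "integrable lborel (\<lambda>y. normal_density a \<delta> y * indicator {a - \<eta>..a + \<eta>} y)"
    using \<delta> by (intro integrable_real_mult_indicator) auto
  have "(\<integral>y. normal_density a \<delta> y \<partial>lborel) \<le> (\<integral>y. normal_density a \<delta> y * indicator {a - \<eta>..a + \<eta>} y
    + 2 * exp (- (3 * \<eta>\<^sup>2 / (8 * \<delta>\<^sup>2))) * normal_density a (2 * \<delta>) y \<partial>lborel)"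
    using \<delta> \<eta> int by (intro integral_mono normal_density_tail_le) auto
  then show ?thesis using \<delta> int by simp
qed

text \<open>The points compared later differ by at most \<open>2\<close>, so for large
  \<open>x\<close> their ratio is close to \<open>1\<close>, and the monotonicity of
  \<open>x powr (1 - \<alpha>) * q0 x\<close> becomes near monotonicity of \<open>q0\<close>
  itself.\<close>

lemma powr_ratio_near_1:
  fixes p \<epsilon> :: real
  assumes "\<epsilon> > 0"
  obtains X where "X \<ge> 4" "\<And>x y. x \<ge> X \<Longrightarrow> \<bar>y - x\<bar> \<le> 2 \<Longrightarrow> y > 0 \<and> 1 - \<epsilon> \<le> (y / x) powr p \<and> (y / x) powr p
      \<le> 1 + \<epsilon>"
proof -
  have "isCont (\<lambda>t::real. t powr p) 1" by (intro continuous_intros) auto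
  then obtain d where d: "d > 0" "\<And>t. dist t 1 < d \<Longrightarrow> dist (t powr p) (1 powr p) < \<epsilon>"
    using assms unfolding continuous_at_eps_delta by blast
  show ?thesis
  proof (rule that[of "max 4 (4 / d)"])
    fix x y :: real assume x: "x \<ge> max 4 (4 / d)" and y: "\<bar>y - x\<bar> \<le> 2"
    have xp: "x > 0" "y > 0" using x y by auto
    have "4 \<le> d * x" using x d by (simp add: field_simps)
    then have "\<bar>y - x\<bar> < d * x" using y by linarith
    then have "\<bar>y - x\<bar> / x < d" using xp by (simp add: field_simps)
    moreover have "\<bar>y / x - 1\<bar> = \<bar>y - x\<bar> / x" using xp by (simp add: abs_divide[symmetric] field_simps)
    ultimately have "dist (y / x) 1 < d" by (simp add: dist_real_def)
    from d(2)[OF this] show "y > 0 \<and> 1 - \<epsilon> \<le> (y / x) powr p \<and> (y / x) powr p \<le> 1 + \<epsilon>"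
      using xp by (auto simp: dist_real_def)
  qed simp
qed

section \<open>From smoothed to pointwise bounds\<close>

context perpetuity_laws begin

definition tilted_density :: "real \<Rightarrow> real \<Rightarrow> real" where
  "tilted_density s x = exp (s * x) * q0 x / mgf_\<mu> s"

lemma q0_ratio:
  assumes "0 < y" "y \<le> x"
  shows "(y / x) powr (\<alpha> - 1) * q0 x \<le> q0 y"
proof -
  have x: "x > 0" using assms by simp
  have *: "w powr (\<alpha> - 1) * (w powr (1 - \<alpha>) * c) = c" if "w > 0" for w c :: real
    using that by (simp add: powr_add[symmetric] mult.assoc[symmetric])
  have "y powr (\<alpha> - 1) * (x powr (1 - \<alpha>) * q0 x) \<le> y powr (\<alpha> - 1) * (y powr (1 - \<alpha>) * q0 y)"
    by (intro mult_left_mono q0_antimono assms) simp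
  also have "\<dots> = q0 y" by (rule *[OF assms(1)])
  also have "y powr (\<alpha> - 1) * (x powr (1 - \<alpha>) * q0 x) = (y / x) powr (\<alpha> - 1) * q0 x"
    using assms x by (simp add: powr_divide powr_diff mult_ac)
  finally show ?thesis .
qed

lemma nn_integral_smoothed:
  assumes s: "s > 0" and \<delta>: "\<delta> > 0"
  shows "(\<integral>\<^sup>+y. ennreal (exp (s * y) * normal_density a \<delta> y) \<partial>\<mu>) = ennreal (mgf_\<mu> s * smoothed s \<delta> a)"
    and "smoothed s \<delta> a \<ge> 0"
proof -
  have eq: "normal_density 0 \<delta> (y - a) = normal_density a \<delta> y" for y by (simp add: normal_density_def)
  have "integrable \<mu> (\<lambda>y. exp (s * y) * normal_density a \<delta> y)"
  proof (rule Bochner_Integration.integrable_bound)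
    show "integrable \<mu> (\<lambda>y. exp (s * y) * (1 / sqrt (2 * pi * \<delta>\<^sup>2)))"
      using \<mu>.exp_moment[of s] s by simp
    show "AE y in \<mu>. norm (exp (s * y) * normal_density a \<delta> y)
        \<le> norm (exp (s * y) * (1 / sqrt (2 * pi * \<delta>\<^sup>2)))"
      using \<delta> by (auto simp: abs_mult normal_density_def intro!: AE_I2 divide_right_mono)
  qed simp
  then show "(\<integral>\<^sup>+y. ennreal (exp (s * y) * normal_density a \<delta> y) \<partial>\<mu>) = ennreal (mgf_\<mu> s * smoothed s \<delta> a)"
    using mgf_\<mu>_pos[OF s] by (subst nn_integral_eq_integral) (auto simp: smoothed_def eq)
  show "smoothed s \<delta> a \<ge> 0" unfolding smoothed_def eq using mgf_\<mu>_pos[OF s]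
    by (intro divide_nonneg_nonneg integral_nonneg_AE) auto
qed

text \<open>The kernel is centred to the left of \<open>x\<close>, so its window
  \<open>[x - 2 * \<epsilon> / s, x]\<close> lies where \<open>q0\<close> is almost at least
  \<open>q0 x\<close>, and over this length \<open>exp (s * y)\<close> loses at most the factor
  \<open>exp (- (2 * \<epsilon>))\<close>. The standard deviation is \<open>\<epsilon>\<close> times
  the half-width, hence for small \<open>\<epsilon>\<close> nearly all mass of the kernel falls
  inside. Read backwards, this bounds \<open>tilted_density s x\<close> from above.\<close>

lemma smoothed_ge:
  assumes s: "s \<ge> 1" and \<epsilon>: "0 < \<epsilon>" "\<epsilon> < 1"
    and near: "\<And>y. \<bar>y - x\<bar> \<le> 2 \<Longrightarrow> y > 0 \<and> 1 - \<epsilon> \<le> (y / x) powr (\<alpha> - 1)"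
  shows "(1 - \<epsilon>) * exp (- (2 * \<epsilon>)) * (1 - 2 * exp (- (3 / (8 * \<epsilon>\<^sup>2)))) * tilted_density s x
    \<le> smoothed s (\<epsilon>\<^sup>2 / s) (x - \<epsilon> / s)"
proof -
  define \<delta> \<eta> a where "\<delta> = \<epsilon>\<^sup>2 / s" and "\<eta> = \<epsilon> / s" and "a = x - \<eta>"
  define A where "A = (1 - \<epsilon>) * exp (s * x - 2 * \<epsilon>) * q0 x"
  have spos: "s > 0" using s by simp
  have \<delta>: "\<delta> > 0" and \<eta>: "\<eta> > 0" "\<eta> \<le> 1" "s * \<eta> = \<epsilon>"
    using s \<epsilon> by (auto simp: \<delta>_def \<eta>_def divide_le_eq)
  have A: "A \<ge> 0" using \<epsilon> q0_nonneg[of x] by (simp add: A_def)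
  have "\<eta>\<^sup>2 / \<delta>\<^sup>2 = 1 / \<epsilon>\<^sup>2" using spos \<epsilon> by (simp add: \<eta>_def \<delta>_def power_divide field_simps
      power2_eq_square)
  then have \<theta>: "3 * \<eta>\<^sup>2 / (8 * \<delta>\<^sup>2) = 3 / (8 * \<epsilon>\<^sup>2)" by (simp add: field_simps)
  have int: "integrable lborel (\<lambda>y. normal_density a \<delta> y * indicator {a - \<eta>..a + \<eta>} y)"
    using \<delta> by (intro integrable_real_mult_indicator) auto
  have "ennreal (A * (1 - 2 * exp (- (3 / (8 * \<epsilon>\<^sup>2))))) \<le> ennreal (A * (\<integral>y. normal_density a \<delta> y * indicator
      {a - \<eta>..a + \<eta>} y \<partial>lborel))"
    using normal_density_mass_ge[OF \<delta>, of \<eta> a] \<eta> A unfolding \<theta> by (intro ennreal_leI mult_left_mono) auto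
  also have "\<dots> = ennreal (\<integral>y. A * (normal_density a \<delta> y * indicator {a - \<eta>..a + \<eta>} y) \<partial>lborel)"
    by (simp only: integral_mult_right_zero)
  also have "\<dots> = (\<integral>\<^sup>+y. ennreal (A * (normal_density a \<delta> y * indicator {a - \<eta>..a + \<eta>} y)) \<partial>lborel)"
    using int A by (intro nn_integral_eq_integral[symmetric]) auto
  also have "\<dots> \<le> (\<integral>\<^sup>+y. ennreal (q0 y * indicator {0<..} y) * (ennreal (exp (s * y) * normal_density a \<delta> y)
      * indicator {a - \<eta>..a + \<eta>} y) \<partial>lborel)"
  proof (rule nn_integral_mono)
    fix y
    show "ennreal (A * (normal_density a \<delta> y * indicator {a - \<eta>..a + \<eta>} y))
        \<le> ennreal (q0 y * indicator {0<..} y) * (ennreal (exp (s * y) * normal_density a \<delta> y) * indicator {a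
        - \<eta>..a + \<eta>} y)"
    proof (cases "y \<in> {a - \<eta>..a + \<eta>}")
      case True
      then have y: "x - 2 * \<eta> \<le> y" "y \<le> x" by (auto simp: a_def)
      then have n: "y > 0" "1 - \<epsilon> \<le> (y / x) powr (\<alpha> - 1)" using near[of y] \<eta> by auto
      have "(1 - \<epsilon>) * q0 x \<le> (y / x) powr (\<alpha> - 1) * q0 x" using n q0_nonneg by (intro mult_right_mono) auto
      also have "\<dots> \<le> q0 y" by (rule q0_ratio[OF n(1) y(2)])
      finally have 1: "(1 - \<epsilon>) * q0 x \<le> q0 y" .
      have "s * (x - 2 * \<eta>) \<le> s * y" using y spos by (intro mult_left_mono) auto
      then have "s * x - 2 * \<epsilon> \<le> s * y" using \<eta>(3) by (simp add: algebra_simps)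
      then have "exp (s * x - 2 * \<epsilon>) * ((1 - \<epsilon>) * q0 x) \<le> exp (s * y) * q0 y"
        using 1 \<epsilon> q0_nonneg[of x] by (intro mult_mono) auto
      then have "A * normal_density a \<delta> y \<le> (exp (s * y) * q0 y) * normal_density a \<delta> y"
        by (intro mult_right_mono) (auto simp: A_def mult_ac)
      then show ?thesis using True n q0_nonneg[of y] by (simp add: ennreal_mult'[symmetric] mult_ac
          ennreal_leI)
    qed simp
  qed
  also have "\<dots> = (\<integral>\<^sup>+y. indicator {0<..} y * (ennreal (exp (s * y) * normal_density a \<delta> y) * indicator {a -
      \<eta>..a + \<eta>} y) \<partial>\<mu>)"
    by (rule nn_integral_\<mu>_pos[symmetric]) simp
  also have "\<dots> \<le> (\<integral>\<^sup>+y. ennreal (exp (s * y) * normal_density a \<delta> y) \<partial>\<mu>)"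
    by (intro nn_integral_mono) (auto simp: indicator_def)
  also have "\<dots> = ennreal (mgf_\<mu> s * smoothed s \<delta> a)" by (rule nn_integral_smoothed(1)[OF spos \<delta>])
  finally have "A * (1 - 2 * exp (- (3 / (8 * \<epsilon>\<^sup>2)))) \<le> mgf_\<mu> s * smoothed s \<delta> a"
    using mgf_\<mu>_pos[OF spos] nn_integral_smoothed(2)[OF spos \<delta>] by (subst (asm) ennreal_le_iff) auto
  moreover have "A = (1 - \<epsilon>) * exp (- (2 * \<epsilon>)) * tilted_density s x * mgf_\<mu> s"
    using mgf_\<mu>_pos[OF spos] by (simp add: A_def tilted_density_def exp_diff exp_minus divide_inverse)
  ultimately have "mgf_\<mu> s * ((1 - \<epsilon>) * exp (- (2 * \<epsilon>)) * (1 - 2 * exp (- (3 / (8 * \<epsilon>\<^sup>2)))) * tilted_density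
      s x) \<le> mgf_\<mu> s * smoothed s \<delta> a"
    by (simp only: mult_ac)
  then show ?thesis using mgf_\<mu>_pos[OF spos] unfolding \<delta>_def a_def \<eta>_def
    by (simp only: mult_le_cancel_left_pos)
qed

text \<open>Mirror image of \<open>smoothed_ge\<close>, with the window
  \<open>[x, x + 2 * \<epsilon> / s]\<close> on the right. In this direction the part of the kernel
  outside the window cannot be discarded; it is estimated by the smoothed density of twice the
  width, for which an upper bound uniform in the centre is at hand.\<close>

lemma smoothed_le:
  assumes s: "s \<ge> 1" and \<epsilon>: "0 < \<epsilon>" "\<epsilon> < 1"
    and near: "\<And>y. \<bar>y - x\<bar> \<le> 2 \<Longrightarrow> y > 0 \<and> (y / x) powr (\<alpha> - 1) \<le> 1 + \<epsilon>"
  shows "smoothed s (\<epsilon>\<^sup>2 / s) (x + \<epsilon> / s) \<le> (1 + \<epsilon>) * exp (2 * \<epsilon>) * tilted_density s x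
    + 2 * exp (- (3 / (8 * \<epsilon>\<^sup>2))) * smoothed s (2 * \<epsilon>\<^sup>2 / s) (x + \<epsilon> / s)"
proof -
  define \<delta> \<eta> a where "\<delta> = \<epsilon>\<^sup>2 / s" and "\<eta> = \<epsilon> / s" and "a = x + \<eta>"
  define A where "A = (1 + \<epsilon>) * exp (s * x + 2 * \<epsilon>) * q0 x"
  define \<theta> where "\<theta> = 2 * exp (- (3 / (8 * \<epsilon>\<^sup>2)))"
  have \<theta>_nn: "\<theta> \<ge> 0" by (simp add: \<theta>_def)
  have xpos: "x > 0" using near[of x] by simp
  have spos: "s > 0" using s by simp
  have \<delta>: "\<delta> > 0" and \<eta>: "\<eta> > 0" "\<eta> \<le> 1" "s * \<eta> = \<epsilon>"
    using s \<epsilon> by (auto simp: \<delta>_def \<eta>_def divide_le_eq)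
  have A: "A \<ge> 0" using \<epsilon> q0_nonneg[of x] by (simp add: A_def)
  have "\<eta>\<^sup>2 / \<delta>\<^sup>2 = 1 / \<epsilon>\<^sup>2" using spos \<epsilon> by (simp add: \<eta>_def \<delta>_def power_divide field_simps
      power2_eq_square)
  then have "3 * \<eta>\<^sup>2 / (8 * \<delta>\<^sup>2) = 3 / (8 * \<epsilon>\<^sup>2)" by (simp add: field_simps)
  then have \<theta>: "2 * exp (- (3 * \<eta>\<^sup>2 / (8 * \<delta>\<^sup>2))) = \<theta>" by (simp add: \<theta>_def)
  have "ennreal (mgf_\<mu> s * smoothed s \<delta> a) = (\<integral>\<^sup>+y. ennreal (exp (s * y) * normal_density a \<delta> y) \<partial>\<mu>)"
    by (rule nn_integral_smoothed(1)[OF spos \<delta>, symmetric])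
  also have "\<dots> \<le> (\<integral>\<^sup>+y. indicator {0<..} y * (ennreal (exp (s * y) * normal_density a \<delta> y) * indicator {a -
      \<eta>..a + \<eta>} y)
     + ennreal \<theta> * ennreal (exp (s * y) * normal_density a (2 * \<delta>) y) \<partial>\<mu>)"
  proof (rule nn_integral_mono)
    fix y
    have pos: "y > 0" if "y \<in> {a - \<eta>..a + \<eta>}" using that xpos by (auto simp: a_def)
    have "exp (s * y) * normal_density a \<delta> y \<le> exp (s * y) * (normal_density a \<delta> y * indicator {a - \<eta>..a +
        \<eta>} y
      + \<theta> * normal_density a (2 * \<delta>) y)"
      using normal_density_tail_le[OF \<delta>, of \<eta> a y] \<eta> unfolding \<theta> by (intro mult_left_mono) auto
    also have "\<dots> = exp (s * y) * normal_density a \<delta> y * indicator {a - \<eta>..a + \<eta>} y + \<theta> * (exp (s * y) *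
        normal_density a (2 * \<delta>) y)"
      by (simp add: algebra_simps)
    finally have "ennreal (exp (s * y) * normal_density a \<delta> y) \<le>
       ennreal (exp (s * y) * normal_density a \<delta> y * indicator {a - \<eta>..a + \<eta>} y) + ennreal (\<theta> * (exp (s * y)
           * normal_density a (2 * \<delta>) y))"
      using \<theta>_nn by (subst ennreal_plus[symmetric]) (auto intro!: ennreal_leI simp del: ennreal_plus)
    also have "\<dots> = indicator {0<..} y * (ennreal (exp (s * y) * normal_density a \<delta> y) * indicator {a - \<eta>..a
        + \<eta>} y)
     + ennreal \<theta> * ennreal (exp (s * y) * normal_density a (2 * \<delta>) y)"
      using pos \<theta>_nn by (cases "y \<in> {a - \<eta>..a + \<eta>}") (auto simp: ennreal_mult')
    finally show "ennreal (exp (s * y) * normal_density a \<delta> y)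
        \<le> indicator {0<..} y * (ennreal (exp (s * y) * normal_density a \<delta> y) * indicator {a - \<eta>..a + \<eta>} y)
     + ennreal \<theta> * ennreal (exp (s * y) * normal_density a (2 * \<delta>) y)" .
  qed
  also have "\<dots> = (\<integral>\<^sup>+y. indicator {0<..} y * (ennreal (exp (s * y) * normal_density a \<delta> y) * indicator {a -
      \<eta>..a + \<eta>} y) \<partial>\<mu>)
     + ennreal \<theta> * ennreal (mgf_\<mu> s * smoothed s (2 * \<delta>) a)"
    using nn_integral_smoothed(1)[OF spos, of "2 * \<delta>" a] \<delta> by (simp add: nn_integral_add nn_integral_cmult)
  also have "(\<integral>\<^sup>+y. indicator {0<..} y * (ennreal (exp (s * y) * normal_density a \<delta> y) * indicator {a - \<eta>..a
      + \<eta>} y) \<partial>\<mu>)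
    = (\<integral>\<^sup>+y. ennreal (q0 y * indicator {0<..} y) * (ennreal (exp (s * y) * normal_density a \<delta> y) * indicator
        {a - \<eta>..a + \<eta>} y) \<partial>lborel)"
    by (rule nn_integral_\<mu>_pos) simp
  also have "\<dots> \<le> (\<integral>\<^sup>+y. ennreal (A * normal_density a \<delta> y) \<partial>lborel)"
  proof (rule nn_integral_mono)
    fix y
    show "ennreal (q0 y * indicator {0<..} y) * (ennreal (exp (s * y) * normal_density a \<delta> y) * indicator {a
        - \<eta>..a + \<eta>} y) \<le> ennreal (A * normal_density a \<delta> y)"
    proof (cases "y \<in> {a - \<eta>..a + \<eta>}")
      case True
      then have y: "x \<le> y" "y \<le> x + 2 * \<eta>" by (auto simp: a_def)
      then have n: "y > 0" "(y / x) powr (\<alpha> - 1) \<le> 1 + \<epsilon>" using near[of y] \<eta> by auto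
      have "(x / y) powr (\<alpha> - 1) * q0 y \<le> q0 x" by (rule q0_ratio[OF xpos y(1)])
      then have "(y / x) powr (\<alpha> - 1) * ((x / y) powr (\<alpha> - 1) * q0 y) \<le> (1 + \<epsilon>) * q0 x"
        using n \<epsilon> q0_nonneg by (intro mult_mono) auto
      moreover have "(y / x) powr (\<alpha> - 1) * (x / y) powr (\<alpha> - 1) = 1"
        using n xpos by (simp add: powr_mult[symmetric])
      ultimately have 1: "q0 y \<le> (1 + \<epsilon>) * q0 x" by (simp add: mult.assoc[symmetric])
      have "s * y \<le> s * (x + 2 * \<eta>)" using y spos by (intro mult_left_mono) auto
      then have "s * y \<le> s * x + 2 * \<epsilon>" using \<eta>(3) by (simp add: algebra_simps)
      then have "exp (s * y) * q0 y \<le> exp (s * x + 2 * \<epsilon>) * ((1 + \<epsilon>) * q0 x)"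
        using 1 \<epsilon> q0_nonneg[of y] by (intro mult_mono) auto
      then have "(exp (s * y) * q0 y) * normal_density a \<delta> y \<le> A * normal_density a \<delta> y"
        by (intro mult_right_mono) (auto simp: A_def mult_ac)
      then show ?thesis using True n q0_nonneg[of y] by (simp add: ennreal_mult'[symmetric] mult_ac
          ennreal_leI)
    qed simp
  qed
  also have "\<dots> = ennreal A"
    using A \<delta> by (subst nn_integral_eq_integral) auto
  finally have "ennreal (mgf_\<mu> s * smoothed s \<delta> a) \<le> ennreal A + ennreal \<theta> * ennreal (mgf_\<mu> s * smoothed s
      (2 * \<delta>) a)"
    by (simp add: add_right_mono)
  also have "\<dots> = ennreal (A + \<theta> * (mgf_\<mu> s * smoothed s (2 * \<delta>) a))"
    using A \<theta>_nn mgf_\<mu>_pos[OF spos] nn_integral_smoothed(2)[OF spos, of "2 * \<delta>" a] \<delta>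
    by (simp add: ennreal_mult' ennreal_plus)
  finally have "mgf_\<mu> s * smoothed s \<delta> a \<le> A + \<theta> * (mgf_\<mu> s * smoothed s (2 * \<delta>) a)"
    using A \<theta>_nn mgf_\<mu>_pos[OF spos] nn_integral_smoothed(2)[OF spos, of "2 * \<delta>" a] \<delta>
    by (subst (asm) ennreal_le_iff) auto
  moreover have "A = mgf_\<mu> s * ((1 + \<epsilon>) * exp (2 * \<epsilon>) * tilted_density s x)"
    using mgf_\<mu>_pos[OF spos] by (simp add: A_def tilted_density_def exp_add)
  ultimately have "mgf_\<mu> s * smoothed s \<delta> a \<le> mgf_\<mu> s * ((1 + \<epsilon>) * exp (2 * \<epsilon>) * tilted_density s x + \<theta> *
      smoothed s (2 * \<delta>) a)"
    by (simp add: algebra_simps)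
  then show ?thesis using mgf_\<mu>_pos[OF spos] unfolding \<delta>_def a_def \<eta>_def \<theta>_def
    by (simp only: mult_le_cancel_left_pos times_divide_eq_right)
qed

text \<open>\<open>smoothed_ge\<close> combined with the uniform bound of
  \<open>smoothed_approx\<close>. The half-line from \<open>tilt s - b\<close> contains
  \<open>tilt s - y\<close> for every \<open>y \<le> b\<close>, however negative, as the convolution
  with the law of \<open>Q\<close> requires.\<close>

lemma tilted_density_upper:
  assumes "e > 0"
  shows "eventually (\<lambda>s. \<forall>x \<ge> tilt s - b. sqrt (tilt s) * tilted_density s x
      \<le> 1 / sqrt (2 * pi * b) + e) at_top"
proof -
  define c where "c = 1 / sqrt (2 * pi * b)"
  have c: "c > 0" using b_pos by (simp add: c_def)
  \<comment> \<open>\<open>D\<close> collects the losses of \<open>smoothed_ge\<close>;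
    \<open>\<epsilon>\<close> is fixed first, and \<open>s\<close> tends to infinity
    afterwards.\<close>
  define D where "D = (\<lambda>\<epsilon>::real. (1 - \<epsilon>) * exp (- (2 * \<epsilon>)) * (1 - 2 * exp (- (3 / (8 * \<epsilon>\<^sup>2)))))"
  have "(D \<longlongrightarrow> 1) (at_right 0)" unfolding D_def by real_asymp
  moreover from this have "((\<lambda>\<epsilon>. c / D \<epsilon>) \<longlongrightarrow> c / 1) (at_right 0)" by (intro tendsto_intros) auto
  ultimately have "eventually (\<lambda>\<epsilon>. D \<epsilon> > 0) (at_right 0)" "eventually (\<lambda>\<epsilon>. c / D \<epsilon> < c + e) (at_right 0)"
    using assms order_tendstoD(1)[of D 1 _ 0] order_tendstoD(2)[of "\<lambda>\<epsilon>. c / D \<epsilon>" "c / 1" _ "c + e"] by auto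
  then have "eventually (\<lambda>\<epsilon>. D \<epsilon> > 0 \<and> c / D \<epsilon> < c + e \<and> 0 < \<epsilon> \<and> \<epsilon> < 1) (at_right 0)"
    using eventually_at_right_real[OF zero_less_one] by eventually_elim auto
  then obtain \<epsilon> where \<epsilon>: "D \<epsilon> > 0" "c / D \<epsilon> < c + e" "0 < \<epsilon>" "\<epsilon> < 1"
    using eventually_happens[of _ "at_right (0::real)"] trivial_limit_at_right_real by blast
  obtain X where X: "X \<ge> 4" "\<And>x y. x \<ge> X \<Longrightarrow> \<bar>y - x\<bar> \<le> 2 \<Longrightarrow> y > 0 \<and> 1 - \<epsilon>
      \<le> (y / x) powr (\<alpha> - 1) \<and> (y / x) powr (\<alpha> - 1) \<le> 1 + \<epsilon>"
    using powr_ratio_near_1[OF \<epsilon>(3)] by metis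
  have k: "\<epsilon>\<^sup>2 > 0" using \<epsilon> by simp
  have "((\<lambda>s. (c + kernel_error (\<epsilon>\<^sup>2) s) / D \<epsilon>) \<longlongrightarrow> (c + 0) / D \<epsilon>) at_top"
    using \<epsilon> by (intro tendsto_intros kernel_error_tendsto_0 k) auto
  then have "eventually (\<lambda>s. (c + kernel_error (\<epsilon>\<^sup>2) s) / D \<epsilon> < c + e) at_top"
    using \<epsilon> by (intro order_tendstoD) auto
  moreover have "eventually (\<lambda>s. tilt s \<ge> X + b) at_top"
    using filterlim_tilt_at_top by (simp add: filterlim_at_top)
  ultimately show ?thesis using eventually_ge_at_top[of 1]
  proof (eventually_elim, intro allI impI)
    fix s x assume err: "(c + kernel_error (\<epsilon>\<^sup>2) s) / D \<epsilon> < c + e" and t: "X + b \<le> tilt s" and s: "1 \<le> s"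
        and x: "tilt s - b \<le> x"
    have tpos: "tilt s > 0" using t X b_pos by linarith
    have "D \<epsilon> * tilted_density s x \<le> smoothed s (\<epsilon>\<^sup>2 / s) (x - \<epsilon> / s)"
      unfolding D_def using X(2)[of x] x t by (intro smoothed_ge s \<epsilon>) auto
    then have "sqrt (tilt s) * (D \<epsilon> * tilted_density s x)
        \<le> sqrt (tilt s) * smoothed s (\<epsilon>\<^sup>2 / s) (x - \<epsilon> / s)"
      using tpos by (intro mult_left_mono) auto
    also have "\<dots> \<le> c + kernel_error (\<epsilon>\<^sup>2) s"
      unfolding c_def using s tpos k by (intro smoothed_approx) auto
    finally have "sqrt (tilt s) * tilted_density s x \<le> (c + kernel_error (\<epsilon>\<^sup>2) s) / D \<epsilon>"
      using \<epsilon> by (simp add: field_simps)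
    then show "sqrt (tilt s) * tilted_density s x \<le> 1 / sqrt (2 * pi * b) + e"
      using err by (simp add: c_def)
  qed
qed

text \<open>Restricted to bounded windows because the two-sided bound of
  \<open>smoothed_approx\<close> is effective only for centres near \<open>tilt s\<close> on the
  scale \<open>sqrt (tilt s)\<close>. The shift of the centre by
  \<open>\<epsilon> / s \<le> 1\<close> explains \<open>K + 1\<close> in the error.\<close>

lemma tilted_density_lower:
  assumes "e > 0"
  shows "eventually (\<lambda>s. \<forall>x. \<bar>x - tilt s\<bar> \<le> K \<longrightarrow> sqrt (tilt s) * tilted_density s x \<ge> 1 / sqrt (2 * pi * b) -
      e) at_top"
proof -
  define c where "c = 1 / sqrt (2 * pi * b)"
  have c: "c > 0" using b_pos by (simp add: c_def)
  define D where "D = (\<lambda>\<epsilon>::real. (1 + \<epsilon>) * exp (2 * \<epsilon>))"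
  define \<theta> where "\<theta> = (\<lambda>\<epsilon>::real. 2 * exp (- (3 / (8 * \<epsilon>\<^sup>2))))"
  have "(D \<longlongrightarrow> 1) (at_right 0)" unfolding D_def by real_asymp
  moreover have "(\<theta> \<longlongrightarrow> 0) (at_right 0)" unfolding \<theta>_def by real_asymp
  ultimately have "((\<lambda>\<epsilon>. (c - \<theta> \<epsilon> * c) / D \<epsilon>) \<longlongrightarrow> (c - 0 * c) / 1) (at_right 0)"
      by (intro tendsto_intros) auto
  then have "eventually (\<lambda>\<epsilon>. (c - \<theta> \<epsilon> * c) / D \<epsilon> > c - e) (at_right 0)"
    by (rule order_tendstoD(1)) (use assms in simp)
  then have "eventually (\<lambda>\<epsilon>. (c - \<theta> \<epsilon> * c) / D \<epsilon> > c - e \<and> 0 < \<epsilon> \<and> \<epsilon> < 1) (at_right 0)"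
    using eventually_at_right_real[OF zero_less_one] by eventually_elim auto
  then obtain \<epsilon> where \<epsilon>: "(c - \<theta> \<epsilon> * c) / D \<epsilon> > c - e" "0 < \<epsilon>" "\<epsilon> < 1"
    using eventually_happens[of _ "at_right (0::real)"] trivial_limit_at_right_real by blast
  have D: "D \<epsilon> > 0" using \<epsilon> by (simp add: D_def)
  have \<theta>_nn: "\<theta> \<epsilon> \<ge> 0" by (simp add: \<theta>_def)
  obtain X where X: "X \<ge> 4" "\<And>x y. x \<ge> X \<Longrightarrow> \<bar>y - x\<bar> \<le> 2 \<Longrightarrow> y > 0 \<and> 1 - \<epsilon>
      \<le> (y / x) powr (\<alpha> - 1) \<and> (y / x) powr (\<alpha> - 1) \<le> 1 + \<epsilon>"
    using powr_ratio_near_1[OF \<epsilon>(2)] by metis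
  have k: "\<epsilon>\<^sup>2 > 0" using \<epsilon> by simp
  define R where "R = (\<lambda>s. kernel_error (\<epsilon>\<^sup>2) s + gauss_abs * ((K + 1) / sqrt (tilt s)))"
  have T: "filterlim (\<lambda>s. sqrt (tilt s)) at_top at_top"
    by (rule filterlim_compose[OF sqrt_at_top filterlim_tilt_at_top])
  have "((\<lambda>s. (c - R s - \<theta> \<epsilon> * (c + kernel_error (2 * \<epsilon>\<^sup>2) s)) / D \<epsilon>)
      \<longlongrightarrow> (c - (0 + gauss_abs * 0) - \<theta> \<epsilon> * (c + 0)) / D \<epsilon>) at_top"
    unfolding R_def using k D
    by (intro tendsto_intros kernel_error_tendsto_0 real_tendsto_divide_at_top[OF tendsto_const T]) auto
  then have "eventually (\<lambda>s. (c - R s - \<theta> \<epsilon> * (c + kernel_error (2 * \<epsilon>\<^sup>2) s)) / D \<epsilon> > c - e) at_top"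
    using \<epsilon> by (intro order_tendstoD) auto
  moreover have "eventually (\<lambda>s. tilt s \<ge> X + \<bar>K\<bar>) at_top"
    using filterlim_tilt_at_top by (simp add: filterlim_at_top)
  ultimately show ?thesis using eventually_ge_at_top[of 1]
  proof (eventually_elim, intro allI impI)
    fix s x assume err: "c - e < (c - R s - \<theta> \<epsilon> * (c + kernel_error (2 * \<epsilon>\<^sup>2) s)) / D \<epsilon>"
      and t: "X + \<bar>K\<bar> \<le> tilt s" and s: "1 \<le> s" and x: "\<bar>x - tilt s\<bar> \<le> K"
    have tpos: "tilt s > 0" using t X by linarith
    have spos: "s > 0" using s by simp
    have xX: "x \<ge> X" using x t by linarith
    define a where "a = x + \<epsilon> / s"
    have "\<epsilon> / s \<le> 1" "\<epsilon> / s \<ge> 0" using \<epsilon> s by (auto simp: divide_le_eq)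
    then have "\<bar>a - tilt s\<bar> \<le> K + 1" using x by (simp add: a_def)
    moreover have "gauss_abs \<ge> 0" unfolding gauss_abs_def by (intro integral_nonneg_AE) auto
    ultimately have "kernel_error (\<epsilon>\<^sup>2) s + gauss_abs * (\<bar>a - tilt s\<bar> / sqrt (tilt s)) \<le> R s"
      unfolding R_def using tpos by (intro add_left_mono mult_left_mono divide_right_mono) auto
    then have 1: "c - R s \<le> sqrt (tilt s) * smoothed s (\<epsilon>\<^sup>2 / s) a"
      using smoothed_approx(1)[OF spos tpos k, of a] unfolding c_def by linarith
    have "smoothed s (\<epsilon>\<^sup>2 / s) a \<le> D \<epsilon> * tilted_density s x + \<theta> \<epsilon> * smoothed s (2 * \<epsilon>\<^sup>2 / s) a"
      unfolding D_def \<theta>_def a_def using X(2)[OF xX] by (intro smoothed_le s \<epsilon>) auto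
    then have "sqrt (tilt s) * smoothed s (\<epsilon>\<^sup>2 / s) a \<le> sqrt (tilt s) * (D \<epsilon> * tilted_density s x + \<theta> \<epsilon> *
        smoothed s (2 * \<epsilon>\<^sup>2 / s) a)"
      using tpos by (intro mult_left_mono) auto
    also have "\<dots> = D \<epsilon> * (sqrt (tilt s) * tilted_density s x) + \<theta> \<epsilon> * (sqrt (tilt s) * smoothed s (2 * \<epsilon>\<^sup>2 /
        s) a)"
      by (simp add: algebra_simps)
    also have "\<dots> \<le> D \<epsilon> * (sqrt (tilt s) * tilted_density s x) + \<theta> \<epsilon> * (c + kernel_error (2 * \<epsilon>\<^sup>2) s)"
      unfolding c_def using k \<theta>_nn by (intro add_left_mono mult_left_mono smoothed_approx spos tpos) auto
    finally have "(c - R s - \<theta> \<epsilon> * (c + kernel_error (2 * \<epsilon>\<^sup>2) s)) / D \<epsilon>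
        \<le> sqrt (tilt s) * tilted_density s x"
      using 1 D by (simp add: field_simps)
    then show "1 / sqrt (2 * pi * b) - e \<le> sqrt (tilt s) * tilted_density s x"
      using err by (simp add: c_def)
  qed
qed

end

section \<open>Asymptotics at the saddle point\<close>

lemma exp_add_one_strict: "y \<noteq> 0 \<Longrightarrow> 1 + y < exp (y::real)"
  using exp_ge_add_one_self[of y] ln_eq_minus_one[of "exp y"] by (auto simp: less_le)

lemma curvature_pos:
  assumes "s > 0" "q \<noteq> 0" shows "curvature s q > 0"
proof -
  have "1 + - (s * q) < exp (- (s * q))" using assms by (intro exp_add_one_strict) auto
  then have "(1 + - (s * q)) * exp (s * q) < exp (- (s * q)) * exp (s * q)"
      by (rule mult_strict_right_mono) simp
  then have "s * q * exp (s * q) - exp (s * q) + 1 > 0" by (simp add: exp_minus algebra_simps)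
  then show ?thesis using assms by (simp add: curvature_def)
qed

lemma exp_quotient_strict_mono:
  fixes q :: real
  assumes "0 < s" "s < s'" "q \<noteq> 0" shows "(exp (s * q) - 1) / s < (exp (s' * q) - 1) / s'"
proof (rule DERIV_pos_imp_increasing[OF assms(2)])
  fix x assume "s \<le> x"
  then have x: "x > 0" using assms by simp
  have "((\<lambda>s. (exp (s * q) - 1) / s) has_real_derivative curvature x q) (at x)"
    using x by (auto intro!: derivative_eq_intros simp: curvature_def power2_eq_square)
  then show "\<exists>y. ((\<lambda>s. (exp (s * q) - 1) / s) has_real_derivative y) (at x) \<and> 0 < y"
    using curvature_pos[OF x assms(3)] by blast
qed

lemma AE_lborel_obtain_in_interval:
  fixes a c :: real
  assumes "AE x in lborel. R x" "a < c"
  obtains x where "a < x" "x < c" "R x"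
proof (rule ccontr)
  assume nt: "\<not> thesis"
  have "AE x in lborel. x \<notin> {a<..<c}"
    using assms(1) by eventually_elim (use that nt in auto)
  then have "{a<..<c} \<in> null_sets lborel" by (subst AE_iff_null_sets) auto
  then show False using assms(2) by (auto simp: null_sets_def)
qed

context perpetuity_laws begin

lemma tilt_strict_mono:
  assumes "0 < s" "s < s'" shows "tilt s < tilt s'"
proof -
  have int: "integrable F (\<lambda>q. (exp (r * q) - 1) / r)" if "r > 0" for r
    using F.exp_moment[of r] that by simp
  have "(\<integral>q. (exp (s * q) - 1) / s \<partial>F) < (\<integral>q. (exp (s' * q) - 1) / s' \<partial>F)"
  \<comment> \<open>Strictness comes from positive mass on nonzero values of \<open>q\<close>; those
    above \<open>b/2\<close> provide it.\<close>
  proof (rule F.integral_less_AE[where A="{b/2..}"])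
    show "emeasure F {b/2..} \<noteq> 0" using mass_near_b[of "b/2"] b_pos by (simp add: F.emeasure_eq_measure)
    show "AE q in F. q \<in> {b/2..} \<longrightarrow> (exp (s * q) - 1) / s \<noteq> (exp (s' * q) - 1) / s'"
      using exp_quotient_strict_mono[OF assms] b_pos by (intro AE_I2) (force simp: less_le)
    show "AE q in F. (exp (s * q) - 1) / s \<le> (exp (s' * q) - 1) / s'"
    proof (rule AE_I2)
      fix q show "(exp (s * q) - 1) / s \<le> (exp (s' * q) - 1) / s'"
        using exp_quotient_strict_mono[OF assms, of q] by (cases "q = 0") auto
    qed
  qed (use assms int in \<open>auto simp: sets_F\<close>)
  then have "\<alpha> * (\<integral>q. (exp (s * q) - 1) / s \<partial>F) < \<alpha> * (\<integral>q. (exp (s' * q) - 1) / s' \<partial>F)"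
    using \<alpha>_pos by (rule mult_strict_left_mono)
  then show ?thesis using assms by (simp only: integral_exp_quotient)
qed

lemma continuous_on_tilt: "continuous_on {0<..} tilt"
proof -
  have "continuous_on {0..} (\<lambda>r. Re (cmgf F (of_real r * 1)))"
    by (intro continuous_intros F.continuous_on_cmgf_ray) simp
  then have "continuous_on {0..} mgf_F"
    by (simp add: F.cmgf_of_real mgf_F_def[abs_def])
  then have "continuous_on {0<..} mgf_F" by (rule continuous_on_subset) auto
  then show ?thesis unfolding tilt_def[abs_def] by (intro continuous_intros) auto
qed

definition saddle_point :: "real \<Rightarrow> real" where
  "saddle_point t = (THE s. s > 0 \<and> tilt s = t)"

text \<open>The intermediate value theorem on \<open>[S, S']\<close> gives a solution and strict
  monotonicity its uniqueness, so the definite description in \<open>saddle_point\<close> denotes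
  it.\<close>

lemma saddle_point_ge:
  assumes "S > 0" "t \<ge> tilt S" shows "saddle_point t \<ge> S" "tilt (saddle_point t) = t"
proof -
  obtain S' where S': "S' \<ge> S" "tilt S' \<ge> t"
    using filterlim_tilt_at_top unfolding filterlim_at_top eventually_at_top_linorder
    by (meson linear)
  have "continuous_on {S..S'} tilt"
    by (rule continuous_on_subset[OF continuous_on_tilt]) (use assms in auto)
  then obtain s where s: "S \<le> s" "s \<le> S'" "tilt s = t"
    using IVT'[of tilt S t S'] assms S' by auto
  have "saddle_point t = s" unfolding saddle_point_def
  proof (rule the_equality)
    show "s > 0 \<and> tilt s = t" using s assms by auto
    fix r assume "r > 0 \<and> tilt r = t"
    then show "r = s" using s assms tilt_strict_mono[of r s] tilt_strict_mono[of s r]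
      by (cases r s rule: linorder_cases) auto
  qed
  then show "saddle_point t \<ge> S" "tilt (saddle_point t) = t" using s by auto
qed

lemma filterlim_saddle_point: "filterlim saddle_point at_top at_top"
  unfolding filterlim_at_top
proof
  fix Z :: real
  show "eventually (\<lambda>t. Z \<le> saddle_point t) at_top"
    using eventually_ge_at_top[of "tilt (max Z 1)"]
    by eventually_elim (use saddle_point_ge(1)[of "max Z 1"] in auto)
qed

lemma tilt_saddle_point: "eventually (\<lambda>t. tilt (saddle_point t) = t) at_top"
  using eventually_ge_at_top[of "tilt 1"] by eventually_elim (rule saddle_point_ge(2)[of 1], auto)

text \<open>A continuous version must coincide with \<open>q0\<close> everywhere on \<open>(0, \<infinity>)\<close>, because \<open>x\<^bsup>1 - \<alpha>\<^esup> q0(x)\<close> is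
    monotone.\<close>

lemma density_eq_q0:
  assumes q_nn: "\<And>x. q x \<ge> 0" and q_meas [measurable]: "q \<in> borel_measurable borel"
    and \<mu>: "\<mu> = density lborel (\<lambda>x. ennreal (q x))"
    and cont: "continuous_on {0<..} q" and x: "x > 0"
  shows "q x = q0 x"
proof -
  have "density lborel (\<lambda>x. ennreal (q x * indicator {0<..} x))
      = density lborel (\<lambda>x. ennreal (q0 x * indicator {0<..} x))"
  proof (rule measure_eqI)
    fix A assume "A \<in> sets (density lborel (\<lambda>x. ennreal (q x * indicator {0<..} x)))"
    then have [measurable]: "A \<in> sets borel" by simp
    have "emeasure (density lborel (\<lambda>x. ennreal (q x * indicator {0<..} x))) A
      = (\<integral>\<^sup>+x. ennreal (q x) * (indicator {0<..} x * indicator A x) \<partial>lborel)"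
      by (subst emeasure_density) (auto intro!: nn_integral_cong simp: indicator_def)
    also have "\<dots> = (\<integral>\<^sup>+x. indicator {0<..} x * indicator A x \<partial>\<mu>)"
      by (subst \<mu>, subst nn_integral_density) auto
    also have "\<dots> = (\<integral>\<^sup>+x. ennreal (q0 x * indicator {0<..} x) * indicator A x \<partial>lborel)"
      by (rule nn_integral_\<mu>_pos) simp
    also have "\<dots> = emeasure (density lborel (\<lambda>x. ennreal (q0 x * indicator {0<..} x))) A"
      by (subst emeasure_density) auto
    finally show "emeasure (density lborel (\<lambda>x. ennreal (q x * indicator {0<..} x))) A
        = emeasure (density lborel (\<lambda>x. ennreal (q0 x * indicator {0<..} x))) A" .
  qed simp
  then have "AE x in lborel. ennreal (q x * indicator {0<..} x) = ennreal (q0 x * indicator {0<..} x)"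
    by (rule sigma_finite_measure.density_unique[OF sigma_finite_lborel, rotated 2]) auto
  then have AE: "AE x in lborel. x > 0 \<longrightarrow> q x = q0 x"
    by eventually_elim (auto simp: q_nn q0_nonneg)
  define k where "k = (\<lambda>y. y powr (1 - \<alpha>) * q y)"
  have "continuous_on {0<..} k" unfolding k_def using cont by (intro continuous_intros) auto
  then have kc: "isCont k x" using x by (simp add: continuous_on_eq_continuous_at)
  have "k x = x powr (1 - \<alpha>) * q0 x"
  proof (rule ccontr)
    assume "k x \<noteq> x powr (1 - \<alpha>) * q0 x"
    then have "\<bar>k x - x powr (1 - \<alpha>) * q0 x\<bar> > 0" by simp
    then obtain d where d: "d > 0" "\<And>y. dist y x < d \<Longrightarrow> dist (k y) (k x) < \<bar>k x - x powr (1 - \<alpha>) * q0 x\<bar>"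
      using kc unfolding continuous_at_eps_delta by blast
    \<comment> \<open>Points of agreement on both sides of \<open>x\<close> give
      \<open>k y2 \<le> x powr (1 - \<alpha>) * q0 x \<le> k y1\<close>, while both outer values
      differ from \<open>k x\<close> by less than the supposed gap. The maximum with
      \<open>x / 2\<close> keeps \<open>y1\<close> positive.\<close>
    obtain y1 where y1: "max (x - d) (x / 2) < y1" "y1 < x" "y1 > 0 \<longrightarrow> q y1 = q0 y1"
      using AE_lborel_obtain_in_interval[OF AE, of "max (x - d) (x / 2)" x] d x
          by (auto simp: less_max_iff_disj)
    obtain y2 where y2: "x < y2" "y2 < x + d" "y2 > 0 \<longrightarrow> q y2 = q0 y2"
      using AE_lborel_obtain_in_interval[OF AE, of x "x + d"] d by auto
    have y1': "y1 > 0" "dist y1 x < d" using y1 x by (auto simp: dist_real_def)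
    have y2': "y2 > 0" "dist y2 x < d" using y2 x by (auto simp: dist_real_def)
    have "k y2 \<le> x powr (1 - \<alpha>) * q0 x" using q0_antimono[of x y2] y2 y2' x by (simp add: k_def)
    moreover have "x powr (1 - \<alpha>) * q0 x \<le> k y1" using q0_antimono[of y1 x] y1 y1' by (simp add: k_def)
    ultimately show False using d(2)[OF y1'(2)] d(2)[OF y2'(2)]
        by (auto simp: dist_real_def abs_if split: if_splits)
  qed
  then show ?thesis using x by (simp add: k_def)
qed

text \<open>The tail asymptotics of the theorem as a function of \<open>s\<close>, with
  \<open>t = tilt s\<close> and with \<open>mgf_\<mu> s\<close> for the exponential of the integral;
  limits are taken in \<open>s\<close> and transferred to \<open>t\<close> at the end.\<close>

definition tail_asymp :: "real \<Rightarrow> real" where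
  "tail_asymp s = 1 / (\<alpha> * sqrt (2 * pi * b)) * sqrt (tilt s) * (exp (- tilt s * s) * mgf_\<mu> s)"

lemma q0_eq_tilted_density:
  assumes "s > 0" shows "q0 x = mgf_\<mu> s * exp (- (s * x)) * tilted_density s x"
  using mgf_\<mu>_pos[OF assms] by (simp add: tilted_density_def exp_minus)

lemma tail_\<mu>_le:
  assumes s: "s > 0" shows "measure \<mu> {t<..} \<le> exp (- (s * t)) * mgf_\<mu> s"
proof -
  have "measure \<mu> {t<..} = (\<integral>x. indicator {t<..} x \<partial>\<mu>)" by (simp add: sets_\<mu>)
  also have "\<dots> \<le> (\<integral>x. exp (- (s * t)) * exp (s * x) \<partial>\<mu>)"
  proof (rule integral_mono)
    show "integrable \<mu> (\<lambda>x. indicator {t<..} x :: real)"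
      by (rule \<mu>.integrable_const_bound[where B=1]) auto
    show "integrable \<mu> (\<lambda>x. exp (- (s * t)) * exp (s * x))" using \<mu>.exp_moment[of s] s by simp
    fix x show "indicator {t<..} x \<le> exp (- (s * t)) * exp (s * x)"
      using s by (auto simp: indicator_def exp_add[symmetric] mult_left_mono)
  qed
  finally show ?thesis by (simp add: mgf_\<mu>_def)
qed

lemma tilted_density_limit:
  "((\<lambda>s. sqrt (tilt s) * tilted_density s (tilt s)) \<longlongrightarrow> 1 / sqrt (2 * pi * b)) at_top"
proof (rule tendstoI)
  fix e :: real assume e: "e > 0"
  then have "e / 2 > 0" by simp
  from tilted_density_upper[OF this] tilted_density_lower[OF this, of 0]
  show "eventually (\<lambda>s. dist (sqrt (tilt s) * tilted_density s (tilt s)) (1 / sqrt (2 * pi * b))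
      < e) at_top"
  proof eventually_elim
    fix s assume U: "\<forall>x\<ge>tilt s - b. sqrt (tilt s) * tilted_density s x \<le> 1 / sqrt (2 * pi * b) + e / 2"
      and L: "\<forall>x. \<bar>x - tilt s\<bar> \<le> 0 \<longrightarrow> 1 / sqrt (2 * pi * b) - e / 2 \<le> sqrt (tilt s) * tilted_density s x"
    have "sqrt (tilt s) * tilted_density s (tilt s) \<le> 1 / sqrt (2 * pi * b) + e / 2"
      "1 / sqrt (2 * pi * b) - e / 2 \<le> sqrt (tilt s) * tilted_density s (tilt s)"
      using U L b_pos by auto
    then show "dist (sqrt (tilt s) * tilted_density s (tilt s)) (1 / sqrt (2 * pi * b)) < e"
      using e unfolding dist_real_def by linarith
  qed
qed

text \<open>Both parts of \<open>tail_\<zeta>\<close> are compared with \<open>tail_asymp\<close>.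
  Markov's inequality bounds P{X > t} by the exponential factor without the power
  \<open>sqrt t\<close>, so its share vanishes like \<open>1 / sqrt (tilt s)\<close>; the share of
  \<open>t * q0 t / \<alpha>\<close> is the rescaled tilted density at its mean, divided by
  \<open>c\<close>.\<close>

lemma tail_asymptotics: "((\<lambda>s. measure \<zeta> {tilt s<..} / tail_asymp s) \<longlongrightarrow> 1) at_top"
proof -
  define c where "c = 1 / sqrt (2 * pi * b)"
  have c: "c > 0" using b_pos by (simp add: c_def)
  have ta: "tail_asymp s = c / \<alpha> * sqrt (tilt s) * (exp (- (s * tilt s)) * mgf_\<mu> s)" for s
    by (simp add: tail_asymp_def c_def mult.commute)
  have T: "filterlim (\<lambda>s. sqrt (tilt s)) at_top at_top"
    by (rule filterlim_compose[OF sqrt_at_top filterlim_tilt_at_top])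
  have tpos: "eventually (\<lambda>s. tilt s > 0) at_top"
    using filterlim_tilt_at_top by (auto simp: filterlim_at_top_dense)
  have "((\<lambda>s. \<alpha> / c / sqrt (tilt s)) \<longlongrightarrow> 0) at_top"
    by (rule real_tendsto_divide_at_top[OF tendsto_const T])
  then have 1: "((\<lambda>s. measure \<mu> {tilt s<..} / tail_asymp s) \<longlongrightarrow> 0) at_top"
  proof (rule Lim_null_comparison[rotated])
    show "eventually (\<lambda>s. norm (measure \<mu> {tilt s<..} / tail_asymp s) \<le> \<alpha> / c / sqrt (tilt s)) at_top"
      using tpos eventually_gt_at_top[of 0]
    proof eventually_elim
      fix s assume t: "0 < tilt s" and s: "0 < s"
      define E where "E = exp (- (s * tilt s)) * mgf_\<mu> s"
      have E: "E > 0" using mgf_\<mu>_pos[OF s] by (simp add: E_def)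
      have pos: "tail_asymp s > 0" unfolding ta E_def[symmetric] using c \<alpha>_pos t E by simp
      have "measure \<mu> {tilt s<..} / tail_asymp s \<le> E / tail_asymp s"
        using tail_\<mu>_le[OF s, of "tilt s"] pos unfolding E_def by (intro divide_right_mono) auto
      also have "\<dots> = \<alpha> / c / sqrt (tilt s)" unfolding ta E_def[symmetric] using E by simp
      finally show "norm (measure \<mu> {tilt s<..} / tail_asymp s) \<le> \<alpha> / c / sqrt (tilt s)"
        using pos by simp
    qed
  qed
  have "((\<lambda>s. sqrt (tilt s) * tilted_density s (tilt s) / c) \<longlongrightarrow> c / c) at_top"
    using c unfolding c_def by (intro tendsto_intros tilted_density_limit) auto
  with 1 have "((\<lambda>s. measure \<mu> {tilt s<..} / tail_asymp s + sqrt (tilt s) * tilted_density s (tilt s) / c)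
      \<longlongrightarrow> 0 + c / c) at_top"
    by (rule tendsto_add)
  then have lim: "((\<lambda>s. measure \<mu> {tilt s<..} / tail_asymp s + sqrt (tilt s) * tilted_density s (tilt s) /
      c) \<longlongrightarrow> 1) at_top"
    using c by simp
  have "eventually (\<lambda>s. measure \<mu> {tilt s<..} / tail_asymp s + sqrt (tilt s) * tilted_density s (tilt s) / c
      = measure \<zeta> {tilt s<..} / tail_asymp s) at_top"
    using tpos eventually_gt_at_top[of 0]
  proof eventually_elim
    fix s assume t: "0 < tilt s" and s: "0 < s"
    define E where "E = exp (- (s * tilt s)) * mgf_\<mu> s"
    have E: "E > 0" using mgf_\<mu>_pos[OF s] by (simp add: E_def)
    have "tilt s * q0 (tilt s) / \<alpha> = E * (sqrt (tilt s) * sqrt (tilt s)) * tilted_density s (tilt s) / \<alpha>"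
      using t unfolding q0_eq_tilted_density[OF s] by (simp add: E_def)
    also have "\<dots> / tail_asymp s = sqrt (tilt s) * tilted_density s (tilt s) / c"
      unfolding ta E_def[symmetric] using E t c \<alpha>_pos by (simp add: field_simps)
    finally show "measure \<mu> {tilt s<..} / tail_asymp s + sqrt (tilt s) * tilted_density s (tilt s) / c
        = measure \<zeta> {tilt s<..} / tail_asymp s"
      using tail_\<zeta>[OF t] by (simp add: add_divide_distrib)
  qed
  from Lim_transform_eventually[OF lim this] show ?thesis .
qed

text \<open>Write \<open>q0 (t - y)\<close> as \<open>E * exp (s * y)\<close> times the rescaled
  tilted density, which is nearly \<open>c\<close>; integration over \<open>F\<close> produces
  \<open>mgf_F s\<close>. The saddle equation \<open>mgf_F s - 1 = t * s / \<alpha>\<close> turns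
  this into \<open>tail_asymp s * s\<close>, as \<open>mgf_F s\<close> and
  \<open>mgf_F s - 1\<close> are asymptotically equal.\<close>

lemma density_asymptotics:
  assumes q: "\<And>x. x > 0 \<Longrightarrow> q x = q0 x"
  shows "((\<lambda>s. (LINT y:{..b}|F. q (tilt s - y)) / (tail_asymp s * s)) \<longlongrightarrow> 1) at_top"
proof (rule tendstoI)
  fix e0 :: real assume "e0 > 0"
  define c where "c = 1 / sqrt (2 * pi * b)"
  have c: "c > 0" using b_pos by (simp add: c_def)
  define e where "e = min (c / 2) (c * e0 / 4)"
  have e: "e > 0" "e \<le> c / 2" "e \<le> c * e0 / 4" using c \<open>e0 > 0\<close> by (auto simp: e_def)
  have ratio: "((\<lambda>s. (c + e) / c * (mgf_F s / (mgf_F s - 1))) \<longlongrightarrow> (c + e) / c * 1) at_top"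
  proof -
    have "((\<lambda>x::real. x / (x - 1)) \<longlongrightarrow> 1) at_top" by real_asymp
    from filterlim_compose[OF this filterlim_mgf_F] show ?thesis by (intro tendsto_intros)
  qed
  have "(c + e) / c * 1 < 1 + e0" using c e \<open>e0 > 0\<close> by (simp add: field_simps)
  from order_tendstoD(2)[OF ratio this]
  have "eventually (\<lambda>s. (c + e) / c * (mgf_F s / (mgf_F s - 1)) < 1 + e0) at_top" .
  moreover have "eventually (\<lambda>s. tilt s > b) at_top"
    using filterlim_tilt_at_top by (auto simp: filterlim_at_top_dense)
  moreover have "eventually (\<lambda>s. mgf_F s > 1) at_top"
    using filterlim_mgf_F by (auto simp: filterlim_at_top_dense)
  ultimately show "eventually (\<lambda>s. dist ((LINT y:{..b}|F. q (tilt s - y)) / (tail_asymp s * s)) 1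
      < e0) at_top"
    using tilted_density_upper[OF e(1)] tilted_density_lower[OF e(1), of b] eventually_gt_at_top[of 0]
  proof eventually_elim
    fix s assume up: "(c + e) / c * (mgf_F s / (mgf_F s - 1)) < 1 + e0" and tb: "b < tilt s" and g: "1
        < mgf_F s"
      and U: "\<forall>x\<ge>tilt s - b. sqrt (tilt s) * tilted_density s x \<le> 1 / sqrt (2 * pi * b) + e"
      and L: "\<forall>x. \<bar>x - tilt s\<bar> \<le> b \<longrightarrow> 1 / sqrt (2 * pi * b) - e \<le> sqrt (tilt s) * tilted_density s x"
      and s: "0 < s"
    have t: "tilt s > 0" using tb b_pos by simp
    define E where "E = exp (- (s * tilt s)) * mgf_\<mu> s / sqrt (tilt s)"
    have E: "E > 0" using mgf_\<mu>_pos[OF s] t by (simp add: E_def)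
    have ta: "tail_asymp s * s = c * E * (mgf_F s - 1)"
    proof -
      have "sqrt (tilt s) * sqrt (tilt s) = tilt s" using t by simp
      moreover have "mgf_F s - 1 = tilt s * s / \<alpha>" using s \<alpha>_pos by (simp add: tilt_def)
      moreover define r where "r = sqrt (tilt s)"
      ultimately have g_eq: "mgf_F s - 1 = r * r * s / \<alpha>" by simp
      have ta: "tail_asymp s = c / \<alpha> * r * (exp (- (s * tilt s)) * mgf_\<mu> s)"
        by (simp add: tail_asymp_def c_def r_def mult.commute)
      have "r > 0" using t by (simp add: r_def)
      then show ?thesis unfolding E_def r_def[symmetric] g_eq ta by simp
    qed
    define f where "f = (\<lambda>y. indicator {..b} y * q0 (tilt s - y))"
    have f_eq: "f y = indicator {..b} y * (E * exp (s * y) * (sqrt (tilt s) * tilted_density s (tilt s -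
        y)))" for y
    proof -
      have "q0 (tilt s - y) = E * exp (s * y) * (sqrt (tilt s) * tilted_density s (tilt s - y))"
        using t unfolding q0_eq_tilted_density[OF s, of "tilt s - y"] E_def
        by (simp add: right_diff_distrib exp_diff exp_minus divide_inverse)
      then show ?thesis by (simp add: f_def)
    qed
    have LINT: "(LINT y:{..b}|F. q (tilt s - y)) = (\<integral>y. f y \<partial>F)"
      unfolding set_lebesgue_integral_def f_def using tb
      by (intro Bochner_Integration.integral_cong) (auto simp: indicator_def q)
    have f_up: "f y \<le> E * (c + e) * exp (s * y)" for y
    proof (cases "y \<le> b")
      case True
      then have "sqrt (tilt s) * tilted_density s (tilt s - y) \<le> c + e" using U by (simp add: c_def)
      then have "E * exp (s * y) * (sqrt (tilt s) * tilted_density s (tilt s - y))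
          \<le> E * exp (s * y) * (c + e)"
        using E by (intro mult_left_mono) auto
      then show ?thesis using True by (simp add: f_eq mult_ac)
    qed (use E c e in \<open>simp add: f_def\<close>)
    have f_nn: "f y \<ge> 0" for y using q0_nonneg by (simp add: f_def)
    \<comment> \<open>For \<open>y < 0\<close> the only lower bound at hand is nonnegativity.
      Subtracting \<open>1\<close> makes the claimed bound nonpositive there, and its integral
      becomes \<open>mgf_F s - 1\<close>, the factor in \<open>ta\<close>.\<close>
    have f_lo: "E * (c - e) * (exp (s * y) - 1) \<le> f y" if "y \<le> b" for y
    proof (cases "y \<ge> 0")
      case True
      have "c - e \<le> sqrt (tilt s) * tilted_density s (tilt s - y)" using L True that by (simp add: c_def)
      then have "E * exp (s * y) * (c - e) \<le> f y"
        using E that by (simp add: f_eq)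
      moreover have "E * (c - e) * (exp (s * y) - 1) \<le> E * exp (s * y) * (c - e)"
        using E e c by (simp add: algebra_simps)
      ultimately show ?thesis by simp
    next
      case False
      then have "exp (s * y) - 1 \<le> 0" using s by (simp add: mult_le_0_iff)
      then have "E * (c - e) * (exp (s * y) - 1) \<le> 0" using E e c by (intro mult_nonneg_nonpos) auto
      then show ?thesis using f_nn[of y] by simp
    qed
    have e_int: "integrable F (\<lambda>y. exp (s * y))" using F.exp_moment[of s] s by simp
    have f_meas: "f \<in> borel_measurable F"
    proof -
      have [measurable]: "(\<lambda>x. q0 x * indicator {0<..} x) \<in> borel_measurable borel"
      proof -
        have "(\<lambda>x. q0 x * indicator {0<..} x) = (\<lambda>x. enn2real (ennreal (q0 x * indicator {0<..} x)))"
          using q0_nonneg by (auto simp: indicator_def)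
        then show ?thesis by simp
      qed
      have "f = (\<lambda>y. indicator {..b} y * (q0 (tilt s - y) * indicator {0<..} (tilt s - y)))"
        using tb by (auto simp: f_def indicator_def)
      then show ?thesis by simp
    qed
    have f_int: "integrable F f"
      by (rule Bochner_Integration.integrable_bound[OF integrable_mult_right[OF e_int, of "E * (c + e)"]
          f_meas])
        (use f_up f_nn E c e in \<open>auto intro!: AE_I2\<close>)
    have "(\<integral>y. f y \<partial>F) \<le> (\<integral>y. E * (c + e) * exp (s * y) \<partial>F)"
      using e_int by (intro integral_mono f_int f_up) auto
    also have "\<dots> = E * (c + e) * mgf_F s" by (simp add: mgf_F_def)
    finally have "(\<integral>y. f y \<partial>F) / (tail_asymp s * s) \<le> E * (c + e) * mgf_F s / (tail_asymp s * s)"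
      unfolding ta using E c g by (intro divide_right_mono) auto
    also have "\<dots> = (c + e) / c * (mgf_F s / (mgf_F s - 1))" unfolding ta using E by simp
    finally have 1: "(\<integral>y. f y \<partial>F) / (tail_asymp s * s) < 1 + e0" using up by simp
    have "E * (c - e) * (mgf_F s - 1) = (\<integral>y. E * (c - e) * (exp (s * y) - 1) \<partial>F)"
      using e_int by (simp add: mgf_F_def F.prob_space[simplified])
    also have "\<dots> \<le> (\<integral>y. f y \<partial>F)"
    proof (intro integral_mono_AE f_int)
      show "AE y in F. E * (c - e) * (exp (s * y) - 1) \<le> f y"
        using AE_le_b by eventually_elim (rule f_lo)
    qed (use e_int in simp)
    finally have "E * (c - e) * (mgf_F s - 1) / (tail_asymp s * s) \<le> (\<integral>y. f y \<partial>F) / (tail_asymp s * s)"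
      unfolding ta using E c g by (intro divide_right_mono) auto
    moreover have "E * (c - e) * (mgf_F s - 1) / (tail_asymp s * s) = 1 - e / c" unfolding ta using E g c
        by (simp add: diff_divide_distrib)
    moreover have "e / c \<le> e0 / 4" using e c by (simp add: field_simps)
    ultimately have 2: "(\<integral>y. f y \<partial>F) / (tail_asymp s * s) > 1 - e0" using \<open>e0 > 0\<close> by linarith
    show "dist ((LINT y:{..b}|F. q (tilt s - y)) / (tail_asymp s * s)) 1 < e0"
      unfolding LINT dist_real_def using 1 2 by (simp add: abs_if)
  qed
qed

end

section \<open>The law of the perpetuity\<close>

text \<open>Pointwise form of the comparison between a sum of tail probabilities and an expectation:
  the \<open>k\<close> with \<open>real k * c < y\<close> number at most the ceiling of
  \<open>y / c\<close>. It feeds the Borel-Cantelli lemma.\<close>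

lemma sum_tail_probabilities_le:
  fixes c y :: real
  assumes "c > 0" "y \<ge> 0"
  shows "(\<Sum>k. indicator {x. real k * c < x} y :: ennreal) \<le> ennreal (y / c + 1)"
  unfolding suminf_eq_SUP
proof (rule SUP_least)
  fix n
  let ?K = "{k \<in> {..<n}. real k * c < y}"
  have "?K \<subseteq> {..<nat \<lceil>y / c\<rceil>}"
  proof
    fix k assume "k \<in> ?K"
    then have "real k < y / c" using assms by (simp add: field_simps)
    then show "k \<in> {..<nat \<lceil>y / c\<rceil>}" by (simp add: zless_nat_eq_int_zless less_ceiling_iff)
  qed
  then have "card ?K \<le> nat \<lceil>y / c\<rceil>" using card_mono[of "{..<nat \<lceil>y / c\<rceil>}" ?K] by simp
  then have "real (card ?K) \<le> real (nat \<lceil>y / c\<rceil>)" by simp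
  also have "\<dots> \<le> y / c + 1"
  proof -
    have "y / c \<ge> 0" using assms by simp
    then have "0 \<le> \<lceil>y / c\<rceil>" by linarith
    then have "real (nat \<lceil>y / c\<rceil>) = of_int \<lceil>y / c\<rceil>" by simp
    then show ?thesis by linarith
  qed
  finally have "real (card ?K) \<le> y / c + 1" .
  have "(\<Sum>k<n. indicator {x. real k * c < x} y :: ennreal) = (\<Sum>k\<in>?K. 1)"
    by (intro sum.mono_neutral_cong_right) (auto simp: indicator_def)
  also have "\<dots> = ennreal (real (card ?K))" by (simp add: ennreal_of_nat_eq_real_of_nat)
  also have "\<dots> \<le> ennreal (y / c + 1)" by (rule ennreal_leI) fact
  finally show "(\<Sum>k<n. indicator {x. real k * c < x} y :: ennreal) \<le> ennreal (y / c + 1)" .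
qed

text \<open>Canonical model: the fixed-point identities are derived on the product space of pairs
  and then transported to arbitrary independent copies.\<close>

locale iid_pairs = N: prob_space N + F: prob_space F for N F :: "real measure" +
  assumes sets_N [measurable_cong]: "sets N = sets borel"
    and sets_F [measurable_cong]: "sets F = sets borel"
    and AE_N: "AE m in N. 0 < m \<and> m < 1"
    and int_log: "integrable F (\<lambda>q. log_plus \<bar>q\<bar>)"
begin

lemma space_N [simp]: "space N = UNIV" and space_F [simp]: "space F = UNIV"
  using sets_N sets_F by (auto dest: sets_eq_imp_space_eq)

abbreviation D :: "(real \<times> real) measure" where "D \<equiv> N \<Otimes>\<^sub>M F"

sublocale NF: pair_prob_space N F ..

sublocale sequence_space D
  by unfold_locales

text \<open>First-step decomposition: the first pair is independent of the shifted sequence, which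
  again has law \<open>S\<close>.\<close>

lemma nn_integral_S_iter:
  assumes [measurable]: "f \<in> borel_measurable S"
  shows "(\<integral>\<^sup>+\<omega>. f \<omega> \<partial>S) = (\<integral>\<^sup>+d. \<integral>\<^sup>+\<omega>. f (case_nat d \<omega>) \<partial>S \<partial>D)"
proof -
  have "(\<integral>\<^sup>+\<omega>. f \<omega> \<partial>S) = (\<integral>\<^sup>+\<omega>. f \<omega> \<partial>distr (D \<Otimes>\<^sub>M S) S (\<lambda>(s, \<omega>). case_nat s \<omega>))"
    by (simp only: PiM_iter)
  also have "\<dots> = (\<integral>\<^sup>+w. f (case_nat (fst w) (snd w)) \<partial>(D \<Otimes>\<^sub>M S))"
    by (subst nn_integral_distr) (auto simp: split_beta')
  also have "\<dots> = (\<integral>\<^sup>+d. \<integral>\<^sup>+\<omega>. f (case_nat d \<omega>) \<partial>S \<partial>D)"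
    by (subst P.nn_integral_fst[symmetric]) auto
  finally show ?thesis .
qed

definition summand :: "(nat \<Rightarrow> real \<times> real) \<Rightarrow> nat \<Rightarrow> real" where
  "summand \<omega> k = (\<Prod>j<k. fst (\<omega> j)) * snd (\<omega> k)"

text \<open>The first term is kept apart as in \<open>perpetuity\<close>, so that the two agree at
  every point, including those where the series diverges.\<close>

definition series :: "(nat \<Rightarrow> real \<times> real) \<Rightarrow> real" where
  "series \<omega> = snd (\<omega> 0) + (\<Sum>k. summand \<omega> (Suc k))"

lemma summand_measurable [measurable]: "(\<lambda>\<omega>. summand \<omega> k) \<in> borel_measurable S"
  unfolding summand_def by measurable

lemma series_measurable [measurable]: "series \<in> borel_measurable S"
  unfolding series_def[abs_def] by measurable

lemma nn_integral_prod_fst: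
  "(\<integral>\<^sup>+\<omega>. (\<Prod>j<k. ennreal (fst (\<omega> j))) \<partial>S) = (\<integral>\<^sup>+m. ennreal m \<partial>N) ^ k"
proof (induction k)
  case 0
  then show ?case by (simp add: P.emeasure_space_1)
next
  case (Suc k)
  have "(\<integral>\<^sup>+\<omega>. (\<Prod>j<Suc k. ennreal (fst (\<omega> j))) \<partial>S) = (\<integral>\<^sup>+d. \<integral>\<^sup>+\<omega>. (\<Prod>j<Suc k. ennreal (fst ((case_nat d \<omega> ::
      nat \<Rightarrow> real \<times> real) j))) \<partial>S \<partial>D)"
    by (rule nn_integral_S_iter) simp
  also have "\<dots> = (\<integral>\<^sup>+d. ennreal (fst d) * (\<integral>\<^sup>+m. ennreal m \<partial>N) ^ k \<partial>D)"
    by (simp add: prod.lessThan_Suc_shift nn_integral_cmult Suc.IH del: prod.lessThan_Suc)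
  also have "\<dots> = (\<integral>\<^sup>+d. ennreal (fst d) \<partial>D) * (\<integral>\<^sup>+m. ennreal m \<partial>N) ^ k"
    by (rule nn_integral_multc) simp
  also have "(\<integral>\<^sup>+d. ennreal (fst d) \<partial>D) = (\<integral>\<^sup>+m. ennreal m \<partial>N)"
    by (subst F.nn_integral_fst[symmetric]) (auto simp: F.emeasure_space_1[simplified])
  finally show ?case by simp
qed

lemma mean_N_less_1:
  obtains \<rho> where "(\<integral>\<^sup>+m. ennreal m \<partial>N) = ennreal \<rho>" "0 \<le> \<rho>" "\<rho> < 1"
proof
  have int: "integrable N (\<lambda>m. m)"
    by (rule N.integrable_const_bound[where B=1]) (use AE_N in \<open>auto elim!: AE_mp\<close>)
  show "(\<integral>\<^sup>+m. ennreal m \<partial>N) = ennreal (\<integral>m. m \<partial>N)"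
    using int AE_N by (intro nn_integral_eq_integral) (auto elim!: AE_mp)
  show "0 \<le> (\<integral>m. m \<partial>N)" using AE_N by (intro integral_nonneg_AE) (auto elim!: AE_mp)
  have "(\<integral>m. m \<partial>N) < (\<integral>m. 1 \<partial>N)"
    using AE_N N.emeasure_space_1
    by (intro N.integral_less_AE[where A="space N"] int) (auto elim!: AE_mp)
  then show "(\<integral>m. m \<partial>N) < 1" by (simp add: N.prob_space[simplified])
qed

lemma AE_S_component:
  assumes "AE d in D. R d" shows "AE \<omega> in S. R (\<omega> k)"
  by (rule AE_PiM_component[where M="\<lambda>_. D" and I=UNIV and i=k
      and P=R]) (use assms NF.prob_space_axioms in auto)

lemma AE_D_fst: "AE d in D. 0 < fst d \<and> fst d < 1"
  by (rule NF.AE_pair_measure) (use AE_N in \<open>auto elim!: AE_mp intro!: AE_I2\<close>)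

text \<open>Borel-Cantelli: the logarithm of \<open>\<bar>snd (\<omega> k)\<bar>\<close> exceeds
  \<open>k * ln \<gamma>\<close> with probabilities that are summable by the logarithmic
  moment.\<close>

lemma AE_snd_le_geometric:
  assumes \<gamma>: "\<gamma> > 1"
  shows "AE \<omega> in S. eventually (\<lambda>k. \<bar>snd (\<omega> k)\<bar> \<le> \<gamma> ^ k) sequentially"
proof -
  define c where "c = ln \<gamma>"
  have c: "c > 0" using \<gamma> by (simp add: c_def)
  define A where "A = (\<lambda>k. {\<omega> \<in> space S. real k * c < log_plus \<bar>snd (\<omega> k)\<bar>})"
  have [measurable]: "log_plus \<in> borel_measurable borel" unfolding log_plus_def[abs_def] by measurable
  have A_meas [measurable]: "A k \<in> sets S" for k unfolding A_def by measurable
  have A_eq: "emeasure S (A k) = (\<integral>\<^sup>+q. indicator {x. real k * c < x} (log_plus \<bar>q\<bar>) \<partial>F)" for k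
  proof -
    have "emeasure S (A k) = (\<integral>\<^sup>+\<omega>. indicator {x. real k * c < x} (log_plus \<bar>snd (\<omega> k)\<bar>) \<partial>S)"
    proof -
      have "emeasure S (A k) = (\<integral>\<^sup>+\<omega>. indicator (A k) \<omega> \<partial>S)" by (rule nn_integral_indicator[symmetric]) simp
      also have "\<dots> = (\<integral>\<^sup>+\<omega>. indicator {x. real k * c < x} (log_plus \<bar>snd (\<omega> k)\<bar>) \<partial>S)"
        by (intro nn_integral_cong) (auto simp: A_def indicator_def)
      finally show ?thesis .
    qed
    also have "\<dots> = (\<integral>\<^sup>+d. indicator {x. real k * c < x} (log_plus \<bar>snd d\<bar>) \<partial>distr S D (\<lambda>\<omega>. \<omega> k))"
      by (subst nn_integral_distr) auto
    also have "distr S D (\<lambda>\<omega>. \<omega> k) = D" by (rule PiM_component) simp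
    also have "(\<integral>\<^sup>+d. indicator {x. real k * c < x} (log_plus \<bar>snd d\<bar>) \<partial>D) = (\<integral>\<^sup>+q. indicator {x. real k * c
        < x} (log_plus \<bar>q\<bar>) \<partial>F)"
      by (subst F.nn_integral_fst[symmetric]) (auto simp: N.emeasure_space_1[simplified])
    finally show ?thesis .
  qed
  have "(\<Sum>k. emeasure S (A k)) = (\<integral>\<^sup>+q. (\<Sum>k. indicator {x. real k * c < x} (log_plus \<bar>q\<bar>)) \<partial>F)"
    unfolding A_eq by (rule nn_integral_suminf[symmetric]) simp
  also have "\<dots> \<le> (\<integral>\<^sup>+q. ennreal (log_plus \<bar>q\<bar> / c + 1) \<partial>F)"
    by (intro nn_integral_mono sum_tail_probabilities_le c) (simp add: log_plus_def)
  also have "\<dots> < \<infinity>"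
    using integrableD(2)[of F "\<lambda>q. log_plus \<bar>q\<bar> / c + 1"] int_log c
    by (subst nn_integral_eq_integral) (auto simp: log_plus_def)
  finally have fin: "(\<Sum>k. emeasure S (A k)) < \<infinity>" .
  have "summable (\<lambda>k. measure S (A k))"
  proof -
    have "(\<Sum>k. ennreal (measure S (A k))) \<noteq> \<top>" using fin by (simp add: P.emeasure_eq_measure)
    then show ?thesis by (intro summable_suminf_not_top) auto
  qed
  then have "AE \<omega> in S. eventually (\<lambda>k. \<omega> \<in> space S - A k) sequentially"
    by (intro borel_cantelli_AE1) (auto simp: P.emeasure_eq_measure)
  then show ?thesis
  proof eventually_elim
    fix \<omega> assume "eventually (\<lambda>k. \<omega> \<in> space S - A k) sequentially"
    then show "eventually (\<lambda>k. \<bar>snd (\<omega> k)\<bar> \<le> \<gamma> ^ k) sequentially"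
    proof eventually_elim
      fix k assume "\<omega> \<in> space S - A k"
      then have le: "log_plus \<bar>snd (\<omega> k)\<bar> \<le> real k * c" by (auto simp: A_def)
      show "\<bar>snd (\<omega> k)\<bar> \<le> \<gamma> ^ k"
      proof (cases "\<bar>snd (\<omega> k)\<bar> \<ge> 1")
        case True
        then have "ln \<bar>snd (\<omega> k)\<bar> \<le> ln (\<gamma> ^ k)" using le \<gamma> by (simp add: log_plus_def c_def ln_realpow)
        then show ?thesis using True \<gamma> by (subst (asm) ln_le_cancel_iff) auto
      next
        case False
        then show ?thesis using one_le_power[of \<gamma> k] \<gamma> by linarith
      qed
    qed
  qed
qed

text \<open>The products of the first components have mean \<open>\<rho> ^ k\<close> with
  \<open>\<rho> < 1\<close>, while the second components are eventually below any growing geometric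
  sequence; an intermediate rate gives absolute convergence.\<close>

lemma AE_summable_summand: "AE \<omega> in S. summable (summand \<omega>)"
proof -
  obtain \<rho> where \<rho>: "(\<integral>\<^sup>+m. ennreal m \<partial>N) = ennreal \<rho>" "0 \<le> \<rho>" "\<rho> < 1" by (rule mean_N_less_1)
  \<comment> \<open>Chosen so that \<open>\<gamma> > 1\<close> and
    \<open>\<gamma> * \<rho> < 1\<close> hold together, also for \<open>\<rho> = 0\<close>.\<close>
  define \<gamma> where "\<gamma> = 2 / (1 + \<rho>)"
  have \<gamma>: "\<gamma> > 1" "\<gamma> * \<rho> < 1" using \<rho> by (auto simp: \<gamma>_def field_simps)
  have "(\<integral>\<^sup>+\<omega>. (\<Sum>k. ennreal (\<gamma> ^ k) * (\<Prod>j<k. ennreal (fst (\<omega> j)))) \<partial>S)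
      = (\<Sum>k. ennreal (\<gamma> ^ k) * ennreal \<rho> ^ k)"
    by (subst nn_integral_suminf) (auto simp: nn_integral_cmult nn_integral_prod_fst \<rho>)
  also have "\<dots> = (\<Sum>k. ennreal ((\<gamma> * \<rho>) ^ k))"
    using \<gamma> \<rho> by (simp add: ennreal_power ennreal_mult'[symmetric] power_mult_distrib)
  also have "\<dots> < \<infinity>"
    using \<gamma> \<rho> by (subst suminf_ennreal2) (auto intro!: summable_geometric)
  finally have "AE \<omega> in S. (\<Sum>k. ennreal (\<gamma> ^ k) * (\<Prod>j<k. ennreal (fst (\<omega> j)))) \<noteq> \<infinity>"
    by (intro nn_integral_PInf_AE) auto
  moreover have "AE \<omega> in S. \<forall>j. 0 < fst (\<omega> j) \<and> fst (\<omega> j) < 1"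
    unfolding AE_all_countable by (intro allI AE_S_component AE_D_fst)
  ultimately show ?thesis using AE_snd_le_geometric[OF \<gamma>(1)]
  proof eventually_elim
    fix \<omega> assume fin: "(\<Sum>k. ennreal (\<gamma> ^ k) * (\<Prod>j<k. ennreal (fst (\<omega> j)))) \<noteq> \<infinity>"
      and pos: "\<forall>j. 0 < fst (\<omega> j) \<and> fst (\<omega> j) < 1"
      and le: "eventually (\<lambda>k. \<bar>snd (\<omega> k)\<bar> \<le> \<gamma> ^ k) sequentially"
    have pn: "(\<Prod>j<k. fst (\<omega> j)) \<ge> 0" for k using pos by (intro prod_nonneg) (auto simp: less_imp_le)
    have "ennreal (\<gamma> ^ k) * (\<Prod>j<k. ennreal (fst (\<omega> j))) = ennreal (\<gamma> ^ k * (\<Prod>j<k. fst (\<omega> j)))" for k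
      using pos \<gamma> by (subst prod_ennreal) (auto simp: less_imp_le ennreal_mult' )
    then have "summable (\<lambda>k. \<gamma> ^ k * (\<Prod>j<k. fst (\<omega> j)))"
      using fin pn \<gamma> by (intro summable_suminf_not_top) auto
    then show "summable (summand \<omega>)"
    proof (rule summable_comparison_test_ev[rotated])
      show "eventually (\<lambda>k. norm (summand \<omega> k) \<le> \<gamma> ^ k * (\<Prod>j<k. fst (\<omega> j))) sequentially"
        using le
      proof eventually_elim
        fix k assume "\<bar>snd (\<omega> k)\<bar> \<le> \<gamma> ^ k"
        then have "\<bar>snd (\<omega> k)\<bar> * (\<Prod>j<k. fst (\<omega> j)) \<le> \<gamma> ^ k * (\<Prod>j<k. fst (\<omega> j))"
          using pn by (intro mult_right_mono) auto
        then show "norm (summand \<omega> k) \<le> \<gamma> ^ k * (\<Prod>j<k. fst (\<omega> j))"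
          using pn[of k] by (simp add: summand_def abs_mult mult.commute)
      qed
    qed
  qed
qed

lemma series_iter:
  assumes "summable (summand \<omega>)"
  shows "series (case_nat d \<omega>) = snd d + fst d * series \<omega>"
proof -
  have "summand (case_nat d \<omega>) (Suc k) = fst d * summand \<omega> k" for k
    by (simp add: summand_def prod.lessThan_Suc_shift del: prod.lessThan_Suc)
  then have "series (case_nat d \<omega>) = snd d + fst d * (\<Sum>k. summand \<omega> k)"
    using assms by (simp add: series_def suminf_mult)
  also have "(\<Sum>k. summand \<omega> k) = series \<omega>"
    using suminf_split_head[OF assms] by (simp add: series_def summand_def[of \<omega> 0])
  finally show ?thesis .
qed

definition series_law :: "real measure" where "series_law = distr S borel series"
definition tail_law :: "real measure" where "tail_law = distr S borel (\<lambda>\<omega>. series \<omega> - snd (\<omega> 0))"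

text \<open>Peel off the first pair: almost surely, the series without its first term is
  \<open>fst d\<close> times the series of the shifted sequence, and the two factors are
  independent.\<close>

lemma nn_integral_tail_law:
  assumes [measurable]: "f \<in> borel_measurable borel"
  shows "(\<integral>\<^sup>+x. f x \<partial>tail_law) = (\<integral>\<^sup>+z. \<integral>\<^sup>+m. f (m * z) \<partial>N \<partial>series_law)"
proof -
  have "(\<integral>\<^sup>+x. f x \<partial>tail_law) = (\<integral>\<^sup>+\<omega>. f (series \<omega> - snd (\<omega> 0)) \<partial>S)"
    unfolding tail_law_def by (subst nn_integral_distr) auto
  also have "\<dots> = (\<integral>\<^sup>+d. \<integral>\<^sup>+\<omega>. f (series (case_nat d \<omega>) - snd ((case_nat d \<omega> :: nat \<Rightarrow> real \<times> real) 0)) \<partial>S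
      \<partial>D)"
    by (rule nn_integral_S_iter) simp
  also have "\<dots> = (\<integral>\<^sup>+d. \<integral>\<^sup>+\<omega>. f (fst d * series \<omega>) \<partial>S \<partial>D)"
    by (intro nn_integral_cong nn_integral_cong_AE) (use AE_summable_summand in \<open>auto elim!: AE_mp simp:
        series_iter\<close>)
  also have "\<dots> = (\<integral>\<^sup>+d. \<integral>\<^sup>+z. f (fst d * z) \<partial>series_law \<partial>D)"
    unfolding series_law_def by (intro nn_integral_cong) (subst nn_integral_distr, auto)
  also have "\<dots> = (\<integral>\<^sup>+m. \<integral>\<^sup>+z. f (m * z) \<partial>series_law \<partial>N)"
  proof -
    interpret sl: prob_space series_law unfolding series_law_def by (rule P.prob_space_distr) simp
    have [measurable_cong]: "sets series_law = sets borel" by (simp add: series_law_def)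
    show ?thesis by (subst F.nn_integral_fst[symmetric]) (auto simp: F.emeasure_space_1[simplified])
  qed
  also have "\<dots> = (\<integral>\<^sup>+z. \<integral>\<^sup>+m. f (m * z) \<partial>N \<partial>series_law)"
  proof -
    interpret sl: prob_space series_law unfolding series_law_def by (rule P.prob_space_distr) simp
    have [measurable_cong]: "sets series_law = sets borel" by (simp add: series_law_def)
    interpret pair_sigma_finite N series_law ..
    show ?thesis by (rule Fubini'[symmetric]) (simp add: split_beta')
  qed
  finally show ?thesis .
qed

text \<open>The same decomposition with the first term kept: Z has the law of Q + M Z' with M, Q and
  Z' independent, and \<open>nn_integral_tail_law\<close> recognises the inner integrals over M and
  Z' as the law of X.\<close>

lemma nn_integral_series_law:
  assumes [measurable]: "f \<in> borel_measurable borel"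
  shows "(\<integral>\<^sup>+z. f z \<partial>series_law) = (\<integral>\<^sup>+q. \<integral>\<^sup>+x. f (q + x) \<partial>tail_law \<partial>F)"
proof -
  interpret sl: prob_space series_law unfolding series_law_def by (rule P.prob_space_distr) simp
  have [measurable_cong]: "sets series_law = sets borel" by (simp add: series_law_def)
  have "(\<integral>\<^sup>+z. f z \<partial>series_law) = (\<integral>\<^sup>+\<omega>. f (series \<omega>) \<partial>S)"
    unfolding series_law_def by (subst nn_integral_distr) auto
  also have "\<dots> = (\<integral>\<^sup>+d. \<integral>\<^sup>+\<omega>. f (series (case_nat d \<omega>)) \<partial>S \<partial>D)"
    by (rule nn_integral_S_iter) simp
  also have "\<dots> = (\<integral>\<^sup>+d. \<integral>\<^sup>+\<omega>. f (snd d + fst d * series \<omega>) \<partial>S \<partial>D)"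
    by (intro nn_integral_cong nn_integral_cong_AE) (use AE_summable_summand in \<open>auto elim!: AE_mp simp:
        series_iter\<close>)
  also have "\<dots> = (\<integral>\<^sup>+d. \<integral>\<^sup>+z. f (snd d + fst d * z) \<partial>series_law \<partial>D)"
    unfolding series_law_def by (intro nn_integral_cong) (subst nn_integral_distr, auto)
  also have "\<dots> = (\<integral>\<^sup>+q. \<integral>\<^sup>+m. \<integral>\<^sup>+z. f (q + m * z) \<partial>series_law \<partial>N \<partial>F)"
    by (subst NF.nn_integral_snd[symmetric]) (auto simp: split_beta')
  also have "\<dots> = (\<integral>\<^sup>+q. \<integral>\<^sup>+z. \<integral>\<^sup>+m. f (q + m * z) \<partial>N \<partial>series_law \<partial>F)"
  proof (rule nn_integral_cong)
    fix q
    interpret pair_sigma_finite N series_law ..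
    show "(\<integral>\<^sup>+m. \<integral>\<^sup>+z. f (q + m * z) \<partial>series_law \<partial>N) = (\<integral>\<^sup>+z. \<integral>\<^sup>+m. f (q + m * z) \<partial>N \<partial>series_law)"
      by (rule Fubini'[symmetric]) (simp add: split_beta')
  qed
  also have "\<dots> = (\<integral>\<^sup>+q. \<integral>\<^sup>+x. f (q + x) \<partial>tail_law \<partial>F)"
    by (intro nn_integral_cong) (subst nn_integral_tail_law, auto)
  finally show ?thesis .
qed

end

context iid_pairs begin

lemma prob_space_series_law: "prob_space series_law"
  unfolding series_law_def by (rule P.prob_space_distr) simp

lemma prob_space_tail_law: "prob_space tail_law"
  unfolding tail_law_def by (rule P.prob_space_distr) simp

lemma perpetuity_laws_series:
  assumes \<alpha>: "\<alpha> > 0" and b: "b > 0"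
    and N: "N = density lborel (\<lambda>m. ennreal (power_density \<alpha> m))"
    and le: "AE q in F. q \<le> b" and mass: "\<And>x. x < b \<Longrightarrow> measure F {x..} > 0"
  shows "perpetuity_laws F tail_law series_law \<alpha> b"
proof -
  interpret \<mu>: prob_space tail_law by (rule prob_space_tail_law)
  interpret \<zeta>: prob_space series_law by (rule prob_space_series_law)
  show ?thesis
  proof
    fix f :: "real \<Rightarrow> ennreal" assume f [measurable]: "f \<in> borel_measurable borel"
    show "(\<integral>\<^sup>+z. f z \<partial>series_law) = (\<integral>\<^sup>+q. \<integral>\<^sup>+x. f (q + x) \<partial>tail_law \<partial>F)"
      by (rule nn_integral_series_law[OF f])
    show "(\<integral>\<^sup>+x. f x \<partial>tail_law) = (\<integral>\<^sup>+z. \<integral>\<^sup>+m. ennreal (power_density \<alpha> m) * f (m * z) \<partial>lborel \<partial>series_law)"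
    proof -
      have "(\<integral>\<^sup>+m. f (m * z) \<partial>N) = (\<integral>\<^sup>+m. ennreal (power_density \<alpha> m) * f (m * z) \<partial>lborel)" for z
        by (subst N, subst nn_integral_density) auto
      then show ?thesis by (simp only: nn_integral_tail_law[OF f])
    qed
  qed (use \<alpha> b le mass int_log in \<open>auto simp: sets_F series_law_def tail_law_def\<close>)
qed

end

section \<open>Transfer to arbitrary independent copies\<close>

lemma perpetuity_eq_series:
  "perpetuity Ms Qs \<omega> = Qs 1 \<omega> + (\<Sum>k. (\<Prod>j<Suc k. Ms (Suc j) \<omega>) * Qs (Suc (Suc k)) \<omega>)"
proof -
  have "(\<Prod>j=1..Suc k. Ms j \<omega>) = (\<Prod>j<Suc k. Ms (Suc j) \<omega>)" for k
    by (simp only: One_nat_def prod.atLeast1_atMost_eq)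
  then show ?thesis unfolding perpetuity_def by (simp only:)
qed

text \<open>Independence identifies the joint law of the copies with a product measure; a shift of
  the index and pushing forward yield the laws computed on the canonical space.\<close>

lemma perpetuity_law:
  assumes N: "iid_pairs N F" and P: "prob_space P"
    and D: "distr \<Omega> (borel \<Otimes>\<^sub>M borel) (\<lambda>\<omega>. (M \<omega>, Q \<omega>)) = N \<Otimes>\<^sub>M F"
    and copies: "independent_copies P Ms Qs \<Omega> M Q"
  shows "perpetuity Ms Qs \<in> borel_measurable P" "Qs 1 \<in> borel_measurable P"
    and "distr P borel (perpetuity Ms Qs) = iid_pairs.series_law N F"
    and "distr P borel (\<lambda>\<omega>. perpetuity Ms Qs \<omega> - Qs 1 \<omega>) = iid_pairs.tail_law N F"
proof -
  interpret iid_pairs N F by fact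
  interpret P': prob_space P by fact
  define X where "X = (\<lambda>k \<omega>. (Ms (Suc k) \<omega>, Qs (Suc k) \<omega>))"
  define \<tau> where "\<tau> = (\<lambda>\<omega>. \<lambda>k\<in>UNIV. X k \<omega>)"
  let ?B = "borel \<Otimes>\<^sub>M borel :: (real \<times> real) measure"
  have ind: "P'.indep_vars (\<lambda>_. ?B) (\<lambda>k \<omega>. (Ms k \<omega>, Qs k \<omega>)) {1..}"
    and law: "\<And>k. k \<ge> 1 \<Longrightarrow> distr P ?B (\<lambda>\<omega>. (Ms k \<omega>, Qs k \<omega>)) = D"
    using copies D unfolding independent_copies_def by auto
  have pair [measurable]: "(\<lambda>\<omega>. (Ms k \<omega>, Qs k \<omega>)) \<in> P \<rightarrow>\<^sub>M ?B" if "k \<ge> 1" for k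
    using ind that by (auto simp: P'.indep_vars_def)
  have sets_D: "sets D = sets ?B" by (intro sets_pair_measure_cong sets_N sets_F)
  have sets_S: "sets (PiM I (\<lambda>_. ?B)) = sets (PiM I (\<lambda>_. D))" for I :: "nat set"
    by (intro sets_PiM_cong refl) (simp add: sets_D)
  \<comment> \<open>Nothing is assumed about the sequences at index \<open>0\<close>, so the joint
    map is formed over \<open>{1..}\<close> and reindexed by \<open>Suc\<close> afterwards.\<close>
  define \<sigma> where "\<sigma> = (\<lambda>\<omega>. \<lambda>k\<in>{1::nat..}. (Ms k \<omega>, Qs k \<omega>))"
  have \<sigma> [measurable]: "\<sigma> \<in> P \<rightarrow>\<^sub>M PiM {1..} (\<lambda>_. D)"
    unfolding measurable_cong_sets[OF refl sets_S[symmetric]] \<sigma>_def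
        by (rule measurable_restrict) (simp add: pair)
  have "distr P (PiM {1..} (\<lambda>_. ?B)) \<sigma> = PiM {1..} (\<lambda>k. distr P ?B (\<lambda>\<omega>. (Ms k \<omega>, Qs k \<omega>)))"
    using ind unfolding \<sigma>_def by (subst (asm) P'.indep_vars_iff_distr_eq_PiM') (auto simp: pair)
  also have "\<dots> = PiM {1..} (\<lambda>_. D)" by (intro PiM_cong law) auto
  finally have \<sigma>_law: "distr P (PiM {1..} (\<lambda>_. D)) \<sigma> = PiM {1..} (\<lambda>_. D)"
    by (simp only: distr_cong[OF refl sets_S refl])
  have shift [measurable]: "(\<lambda>\<omega>. \<lambda>n\<in>UNIV. \<omega> (Suc n)) \<in> PiM {1..} (\<lambda>_. D) \<rightarrow>\<^sub>M S"
    by (intro measurable_restrict measurable_component_singleton) auto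
  have \<tau>_eq: "\<tau> = (\<lambda>\<omega>. \<lambda>n\<in>UNIV. \<omega> (Suc n)) \<circ> \<sigma>"
    by (auto simp: \<tau>_def \<sigma>_def X_def fun_eq_iff)
  have \<tau>_S: "distr P S \<tau> = S"
  proof -
    have "distr (PiM {1..} (\<lambda>_. D)) S (\<lambda>\<omega>. \<lambda>n\<in>UNIV. \<omega> (Suc n)) = S"
      by (rule distr_PiM_reindex) (auto intro: NF.prob_space_axioms)
    then show ?thesis unfolding \<tau>_eq distr_distr[OF shift \<sigma>, symmetric] \<sigma>_law .
  qed
  have \<tau> [measurable]: "\<tau> \<in> P \<rightarrow>\<^sub>M S"
    unfolding \<tau>_eq using \<sigma> shift by (rule measurable_comp)
  have perp: "perpetuity Ms Qs = (\<lambda>\<omega>. series (\<tau> \<omega>))"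
    by (rule ext) (simp add: perpetuity_eq_series series_def summand_def \<tau>_def X_def)
  have Q1: "Qs 1 = (\<lambda>\<omega>. snd (\<tau> \<omega> 0))" by (simp add: \<tau>_def X_def)
  show "perpetuity Ms Qs \<in> borel_measurable P" unfolding perp by measurable
  have snd0 [measurable]: "(\<lambda>\<omega>. snd (\<omega> 0)) \<in> borel_measurable S" by measurable
  show "Qs 1 \<in> borel_measurable P" unfolding Q1 by (rule measurable_compose[OF \<tau> snd0])
  have "distr P borel (\<lambda>\<omega>. series (\<tau> \<omega>)) = distr (distr P S \<tau>) borel series"
    by (subst distr_distr) (auto simp: o_def)
  then show "distr P borel (perpetuity Ms Qs) = series_law"
    by (simp only: perp \<tau>_S series_law_def)
  have "distr P borel (\<lambda>\<omega>. series (\<tau> \<omega>) - snd (\<tau> \<omega> 0)) = distr (distr P S \<tau>) borel (\<lambda>\<omega>. series \<omega> - snd (\<omega>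
      0))"
    by (subst distr_distr) (auto simp: o_def)
  then show "distr P borel (\<lambda>\<omega>. perpetuity Ms Qs \<omega> - Qs 1 \<omega>) = tail_law"
    by (simp only: perp Q1 \<tau>_S tail_law_def)
qed

text \<open>For \<open>x < b\<close> some \<open>y > x\<close> in the set has positive probability,
  and monotonicity passes it on to \<open>x\<close>. Above \<open>b\<close> each event
  \<open>Q \<omega> \<ge> b + 1 / real (Suc n)\<close> is null, and countably many of them exhaust
  \<open>Q \<omega> > b\<close>.\<close>

lemma essential_supremum_facts:
  fixes Q :: "'a \<Rightarrow> real"
  assumes "prob_space \<Omega>" and [measurable]: "Q \<in> borel_measurable \<Omega>"
    and b: "ereal b = (SUP x\<in>{x. measure \<Omega> {\<omega>\<in>space \<Omega>. Q \<omega> \<ge> x} > 0}. ereal x)"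
  shows "AE q in distr \<Omega> borel Q. q \<le> b"
    and "\<And>x. x < b \<Longrightarrow> measure (distr \<Omega> borel Q) {x..} > 0"
proof -
  interpret prob_space \<Omega> by fact
  have eq: "measure (distr \<Omega> borel Q) {x..} = measure \<Omega> {\<omega>\<in>space \<Omega>. Q \<omega> \<ge> x}" for x
    by (subst measure_distr) (auto intro!: arg_cong[where f="measure \<Omega>"])
  show "measure (distr \<Omega> borel Q) {x..} > 0" if "x < b" for x
  proof -
    have "ereal x < (SUP x\<in>{x. measure \<Omega> {\<omega>\<in>space \<Omega>. Q \<omega> \<ge> x} > 0}. ereal x)" using that by (simp flip: b)
    then obtain y where y: "measure \<Omega> {\<omega>\<in>space \<Omega>. Q \<omega> \<ge> y} > 0" "x < y"
      by (auto simp: less_SUP_iff)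
    have "measure \<Omega> {\<omega>\<in>space \<Omega>. Q \<omega> \<ge> y} \<le> measure \<Omega> {\<omega>\<in>space \<Omega>. Q \<omega> \<ge> x}"
      using y by (intro finite_measure_mono) auto
    then show ?thesis using y unfolding eq by simp
  qed
  have "AE \<omega> in \<Omega>. Q \<omega> < b + 1 / real (Suc n)" for n
  proof -
    have "\<not> measure \<Omega> {\<omega>\<in>space \<Omega>. Q \<omega> \<ge> b + 1 / real (Suc n)} > 0"
    proof
      assume "measure \<Omega> {\<omega>\<in>space \<Omega>. Q \<omega> \<ge> b + 1 / real (Suc n)} > 0"
      then have "ereal (b + 1 / real (Suc n)) \<le> ereal b" unfolding b by (intro SUP_upper) simp
      then show False by (simp add: field_simps)
    qed
    then have "prob {\<omega>\<in>space \<Omega>. Q \<omega> \<ge> b + 1 / real (Suc n)} = 0"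
      by (simp add: zero_less_measure_iff measure_eq_0_null_sets)
    then have "AE \<omega> in \<Omega>. \<not> Q \<omega> \<ge> b + 1 / real (Suc n)"
      by (subst (asm) prob_Collect_eq_0) auto
    then show ?thesis by (simp add: not_le)
  qed
  then have "AE \<omega> in \<Omega>. \<forall>n. Q \<omega> < b + 1 / real (Suc n)" unfolding AE_all_countable by blast
  then have "AE \<omega> in \<Omega>. Q \<omega> \<le> b"
  proof eventually_elim
    fix \<omega> assume H: "\<forall>n. Q \<omega> < b + 1 / real (Suc n)"
    show "Q \<omega> \<le> b"
    proof (rule ccontr)
      assume "\<not> Q \<omega> \<le> b"
      then obtain n where "inverse (real (Suc n)) < Q \<omega> - b" using reals_Archimedean[of "Q \<omega> - b"] by auto
      then show False using H[rule_format, of n] by (simp add: inverse_eq_divide)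
    qed
  qed
  then show "AE q in distr \<Omega> borel Q. q \<le> b" by (subst AE_distr_iff) auto
qed

theorem theorem1p2:
  fixes \<Omega> :: "'a measure" and M Q :: "'a \<Rightarrow> real"
    and P :: "'b measure" and Ms Qs :: "nat \<Rightarrow> 'b \<Rightarrow> real"
    and \<alpha> b :: real and g s :: "real \<Rightarrow> real" and Z :: "'b \<Rightarrow> real"
  assumes "\<alpha> > 0"
    and "prob_space \<Omega>"
    and "prob_space.indep_var \<Omega> borel M borel Q"
    and "density_of \<Omega> M (\<lambda>x. \<alpha> * x powr (\<alpha> - 1) * indicator {0<..<1} x)"
    and "integrable \<Omega> (\<lambda>\<omega>. log_plus \<bar>Q \<omega>\<bar>)"
    and "ereal b = (SUP x\<in>{x. measure \<Omega> {\<omega>\<in>space \<Omega>. Q \<omega> \<ge> x} > 0}. ereal x)"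
    and "b > 0"
    and "prob_space P"
    and "independent_copies P Ms Qs \<Omega> M Q"
  defines "Z \<equiv> perpetuity Ms Qs"
    and "g \<equiv> mgf \<Omega> Q"
    and "s \<equiv> saddle \<alpha> g"
  shows "(\<forall>q. density_of P (\<lambda>\<omega>. Z \<omega> - Qs 1 \<omega>) q \<and> continuous_on {0<..} q \<longrightarrow>
           p_fun \<Omega> Q b q \<sim>[at_top]
             (\<lambda>t. 1 / (\<alpha> * sqrt (2 * pi * b)) * sqrt t * s t *
                exp (- t * s t + \<alpha> * (LBINT y=0..ereal (s t). (g y - 1) / y)))) \<and>
         (\<lambda>t. measure P {\<omega>\<in>space P. Z \<omega> > t}) \<sim>[at_top]
           (\<lambda>t. 1 / (\<alpha> * sqrt (2 * pi * b)) * sqrt t *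
              exp (- t * s t + \<alpha> * (LBINT y=0..ereal (s t). (g y - 1) / y)))"
proof -
  interpret \<Omega>: prob_space \<Omega> by fact
  define N where "N = distr \<Omega> borel M"
  define F where "F = distr \<Omega> borel Q"
  have M [measurable]: "M \<in> borel_measurable \<Omega>" and Q [measurable]: "Q \<in> borel_measurable \<Omega>"
    using \<Omega>.indep_var_rv1[OF assms(3)] \<Omega>.indep_var_rv2[OF assms(3)] by auto
  have N: "N = density lborel (\<lambda>m. ennreal (power_density \<alpha> m))"
  proof -
    have "distr \<Omega> lborel M = density lborel (\<lambda>m. ennreal (power_density \<alpha> m))"
      using assms(4) unfolding density_of_def power_density_def by (intro distributed_distr_eq_density) simp
    moreover have "distr \<Omega> lborel M = N" unfolding N_def by (rule distr_cong) auto
    ultimately show ?thesis by simp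
  qed
  have D: "distr \<Omega> (borel \<Otimes>\<^sub>M borel) (\<lambda>\<omega>. (M \<omega>, Q \<omega>)) = N \<Otimes>\<^sub>M F"
    using assms(3) unfolding \<Omega>.indep_var_distribution_eq N_def F_def by simp
  have meas_log: "log_plus \<in> borel_measurable borel" unfolding log_plus_def[abs_def] by measurable
  have iid: "iid_pairs N F"
  proof -
    interpret N: prob_space N unfolding N_def by (rule \<Omega>.prob_space_distr) simp
    interpret F: prob_space F unfolding F_def by (rule \<Omega>.prob_space_distr) simp
    show ?thesis
    proof
      show "AE m in N. 0 < m \<and> m < 1" unfolding N
        by (subst AE_density) (auto simp: power_density_def indicator_def)
      show "integrable F (\<lambda>q. log_plus \<bar>q\<bar>)" unfolding F_def
        using assms(5) meas_log by (subst integrable_distr_eq) auto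
    qed (auto simp: N_def F_def)
  qed
  interpret iid_pairs N F by (rule iid)
  note law = perpetuity_law[OF iid assms(8) D assms(9)]
  interpret perpetuity_laws F tail_law series_law \<alpha> b
    using essential_supremum_facts[OF assms(2) Q assms(6), folded F_def] assms(1,7) N
    by (intro perpetuity_laws_series)
  have g: "g = mgf_F"
  proof
    fix x
    have "(\<integral>q. exp (x * q) \<partial>F) = (\<integral>\<omega>. exp (x * Q \<omega>) \<partial>\<Omega>)"
      unfolding F_def by (subst integral_distr) auto
    then show "g x = mgf_F x" by (simp only: g_def mgf_def mgf_F_def)
  qed
  have s: "s t = saddle_point t" for t
    unfolding s_def saddle_def saddle_point_def g tilt_def ..
  \<comment> \<open>For large \<open>t\<close> the saddle equation replaces
    \<open>tilt (s t)\<close> by \<open>t\<close>, and \<open>s t > 0\<close> gives access to the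
    integral formula for \<open>mgf_\<mu>\<close>.\<close>
  have rhs: "eventually (\<lambda>t. tail_asymp (saddle_point t) = 1 / (\<alpha> * sqrt (2 * pi * b)) * sqrt t *
              exp (- t * s t + \<alpha> * (LBINT y=0..ereal (s t). (g y - 1) / y))) at_top"
    using tilt_saddle_point filterlim_saddle_point[unfolded filterlim_at_top_dense, rule_format, of 0]
  proof eventually_elim
    fix t assume t: "tilt (saddle_point t) = t" and pos: "saddle_point t > 0"
    show "tail_asymp (saddle_point t) = 1 / (\<alpha> * sqrt (2 * pi * b)) * sqrt t *
              exp (- t * s t + \<alpha> * (LBINT y=0..ereal (s t). (g y - 1) / y))"
      unfolding tail_asymp_def t s g mgf_\<mu>_eq_exp[OF pos] exp_add ..
  qed
  have tail: "measure P {\<omega>\<in>space P. Z \<omega> > t} = measure series_law {t<..}" for t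
    unfolding law(3)[symmetric] Z_def using law(1)
    by (subst measure_distr) (auto intro!: arg_cong[where f="measure P"])
  show ?thesis
  proof (intro conjI allI impI)
    \<comment> \<open>The limit in \<open>s\<close> is composed with \<open>saddle_point\<close>,
      which tends to infinity.\<close>
    have "((\<lambda>t. measure series_law {tilt (saddle_point t)<..} / tail_asymp (saddle_point t)) \<longlongrightarrow> 1) at_top"
      by (rule filterlim_compose[OF tail_asymptotics filterlim_saddle_point])
    moreover have "eventually (\<lambda>t. measure series_law {tilt (saddle_point t)<..} / tail_asymp (saddle_point
        t)
       = measure P {\<omega>\<in>space P. Z \<omega> > t} / (1 / (\<alpha> * sqrt (2 * pi * b)) * sqrt t *
              exp (- t * s t + \<alpha> * (LBINT y=0..ereal (s t). (g y - 1) / y)))) at_top"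
      using rhs tilt_saddle_point by eventually_elim (simp only: tail)
    ultimately show "(\<lambda>t. measure P {\<omega>\<in>space P. Z \<omega> > t}) \<sim>[at_top]
           (\<lambda>t. 1 / (\<alpha> * sqrt (2 * pi * b)) * sqrt t *
              exp (- t * s t + \<alpha> * (LBINT y=0..ereal (s t). (g y - 1) / y)))"
      by (intro asymp_equivI') (rule Lim_transform_eventually)
  next
    fix q assume q: "density_of P (\<lambda>\<omega>. Z \<omega> - Qs 1 \<omega>) q \<and> continuous_on {0<..} q"
    then have dist: "distributed P lborel (\<lambda>\<omega>. Z \<omega> - Qs 1 \<omega>) (\<lambda>x. ennreal (q x))" and nn: "\<And>x. 0 \<le> q x"
      by (auto simp: density_of_def)
    \<comment> \<open>Measurability is first known for the \<open>ennreal\<close> version;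
      nonnegativity recovers \<open>q\<close> from it.\<close>
    have "(\<lambda>x. ennreal (q x)) \<in> borel_measurable borel"
      using distributed_borel_measurable[OF dist] by simp
    then have "(\<lambda>x. enn2real (ennreal (q x))) \<in> borel_measurable borel" by measurable
    then have q_meas: "q \<in> borel_measurable borel" using nn by simp
    have "tail_law = distr P lborel (\<lambda>\<omega>. Z \<omega> - Qs 1 \<omega>)"
      unfolding law(4)[symmetric] Z_def by (rule distr_cong) auto
    also have "\<dots> = density lborel (\<lambda>x. ennreal (q x))"
      by (rule distributed_distr_eq_density[OF dist])
    finally have q_eq: "\<And>x. x > 0 \<Longrightarrow> q x = q0 x"
      using q by (intro density_eq_q0[OF nn q_meas]) auto
    have "((\<lambda>t. (LINT y:{..b}|F. q (tilt (saddle_point t) - y)) / (tail_asymp (saddle_point t) *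
        saddle_point t)) \<longlongrightarrow> 1) at_top"
      by (rule filterlim_compose[OF density_asymptotics[OF q_eq] filterlim_saddle_point])
    moreover have "eventually (\<lambda>t. (LINT y:{..b}|F. q (tilt (saddle_point t) - y)) / (tail_asymp
        (saddle_point t) * saddle_point t)
       = p_fun \<Omega> Q b q t / (1 / (\<alpha> * sqrt (2 * pi * b)) * sqrt t * s t *
                exp (- t * s t + \<alpha> * (LBINT y=0..ereal (s t). (g y - 1) / y)))) at_top"
      using rhs tilt_saddle_point
    proof eventually_elim
      fix t
      assume 1: "tail_asymp (saddle_point t) = 1 / (\<alpha> * sqrt (2 * pi * b)) * sqrt t *
              exp (- t * s t + \<alpha> * (LBINT y=0..ereal (s t). (g y - 1) / y))"
        and 2: "tilt (saddle_point t) = t"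
      show "(LINT y:{..b}|F. q (tilt (saddle_point t) - y)) / (tail_asymp (saddle_point t) * saddle_point t)
       = p_fun \<Omega> Q b q t / (1 / (\<alpha> * sqrt (2 * pi * b)) * sqrt t * s t *
                exp (- t * s t + \<alpha> * (LBINT y=0..ereal (s t). (g y - 1) / y)))"
        unfolding 1 2 p_fun_def F_def[symmetric] unfolding s by (simp only: mult_ac)
    qed
    ultimately show "p_fun \<Omega> Q b q \<sim>[at_top]
             (\<lambda>t. 1 / (\<alpha> * sqrt (2 * pi * b)) * sqrt t * s t *
                exp (- t * s t + \<alpha> * (LBINT y=0..ereal (s t). (g y - 1) / y)))"
      by (intro asymp_equivI') (rule Lim_transform_eventually)
  qed
qed

end
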